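(* To each relative $GL(V)$-invariant $$I\in \Lambda^{p_1+1}V^{\vee}\otimes\cdots\otimes\Lambda^{p_n+1}V^{\vee}$$ there corresponds (by the constructions given in the context): 1. a $GL(V)$-invariant weighted differential form $$\eta=\eta(I)\in H^{0}\big(\Omega^{p_1}\boxtimes\cdots\boxtimes\Omega^{p_n}(p_1+1,\dots,p_n+1),\ (\mathbb{P}V)^n\big)\subset H^{0}\big(\Omega^{p_1+\cdots+p_n}(p_1+1,\dots,p_n+1),\ (\mathbb{P}V)^n\big);$$ 2. a $GL(V)$-invariant tensor $$\tau=\tau(I)\in\Big[\bigotimes_{i=1}^n\mathcal{O}_{GL(V)}\underset{bal}{\otimes} L\otimes\Lambda^{p_i}W\Big]^{H^n};$$ 3. a $GL(V)$-invariant regular function $$f_w=f_w(I): F_w^{\,n}\to\bigotimes_{i=1}^n L\otimes\Lambda^{p_i}W;$$ 4. $GL(V)$-invariant rational functions $$f=f(I):F^{n}\dashrightarrow \mathbb{P}\Big(\bigotimes_{i=1}^n\Lambda^{p_i}T^{\vee}\Big),\qquad f_s=f_s(I):(F/k^{\times})^{n}\dashrightarrow \mathbb{P}\Big(\bigotimes_{i=1}^n\Lambda^{p_i}T^{\vee}\Big).$$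
   Context: $k$ is a field of characteristic zero, $V$ a finite-dimensional $k$-vector space, $V^\vee$ its dual, $\mathbb{P}V=(V\setminus\{0\})/k^\times$, and $p_1,\dots,p_n\ge 0$. Groups, representations and characters are algebraic. A relative $GL(V)$-invariant $I\in\Lambda^{p_1+1}V^{\vee}\otimes\cdots\otimes\Lambda^{p_n+1}V^{\vee}$ is one for which, for some 1-dimensional character $\chi$ of $GL(V)$, $I\in(\Lambda^{p_1+1}V^{\vee}\otimes\cdots\otimes\Lambda^{p_n+1}V^{\vee}\otimes\chi)^{GL(V)}$. Fix $0\ne v_0\in V$; $[v_0]$ denotes both the line $kv_0$ and the corresponding point of $\mathbb{P}V$. Let $H\subset GL(V)$ be the stabilizer of $[v_0]$, and consider the $H$-representations $L=[v_0]^{\vee}$, $W=(V/[v_0])^{\vee}$, $T=L\otimes W^{\vee}$ (so $T\cong T_{[v_0]}\mathbb{P}V$). Then $L^q\otimes\Lambda^pW=L^{p+q}\otimes\Lambda^pT^{\vee}$. For an $H$-representation $M$, $\mathcal{O}_{GL(V)}\underset{bal}{\otimes}M$ is the space of regular maps $\varphi:GL(V)\to M$ with the right $H$-action whose invariants are the $\varphi$ with $\varphi(gh)=h^{-1}\varphi(g)$ for all $h\in H$; likewise for $n$ factors and $H^n$. $GL(V)$ acts on such maps through left translation on $GL(V)$ (with trivial action on the target), and acts diagonally on $n$-fold products. Subgroups of $H$: $K_T$ is the set of elements acting trivially on $T$; $\widetilde K_T$ the set of elements acting on $T$ by scalars; $K_{LTW}$ the set of elements acting trivially on $L$, $T$ and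 $W$. Set $F=GL(V)/K_T$ (frames), $F_w=GL(V)/K_{LTW}$ (weighted frames), and $F/k^\times\cong GL(V)/\widetilde K_T$ (frames up to scale). $\Omega^p$ is the sheaf of algebraic differential $p$-forms (on $\mathbb{P}V$, or on $(\mathbb{P}V)^n$ where so indicated), $(m)$ denotes the twist by $\mathcal{O}(m)$, $\boxtimes$ is the external tensor product, $(m_1,\dots,m_n)$ denotes the twist by $\mathcal{O}(m_1)\boxtimes\cdots\boxtimes\mathcal{O}(m_n)$ on $(\mathbb{P}V)^n$, and $H^0(\mathcal{F},X)$ denotes the global sections of $\mathcal{F}$ over $X$. Since $\Omega^p(p+1)$ is the homogeneous bundle $GL(V)\times_H(L\otimes\Lambda^pW)$, there is a $GL(V)$-isomorphism $H^0(\Omega^p(p+1),\mathbb{P}V)\cong(\mathcal{O}_{GL(V)}\underset{bal}{\otimes}L\otimes\Lambda^pW)^H$. Constructions. For $p\ge0$, the map $\psi_p:\Lambda^{p+1}V^{\vee}\to\mathcal{O}_{GL(V)}\underset{bal}{\otimes}L\otimes\Lambda^pW$ sends $\xi$ to the function $g\mapsto\big(v_0\otimes y\mapsto \xi(g(v_0\wedge y))\big)$, $y\in\Lambda^p(V/[v_0])$ (a linear form on $[v_0]\otimes\Lambda^p(V/[v_0])$, i.e. an element of $L\otimes\Lambda^pW$). - $\tau(I)=(\psi_{p_1}\otimes\cdots\otimes\psi_{p_n})(I)$, regarded also as an $H^n$-equivariant map $h:GL(V)^n\to\bigotimes_i L\otimes\Lambda^{p_i}W$. - $\eta(I)$ is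 the image of $\tau(I)$ under the isomorphisms $(\mathcal{O}_{GL(V)}\underset{bal}{\otimes}L\otimes\Lambda^{p_i}W)^H\cong H^0(\Omega^{p_i}(p_i+1),\mathbb{P}V)$, $i=1,\dots,n$, followed by the Künneth isomorphism. - $f_w(I)$ is the map induced by $h$ on $F_w^n=GL(V)^n/K_{LTW}^n$. - $f(I)$ and $f_s(I)$ are induced on $GL(V)^n/K_T^n$ and $GL(V)^n/\widetilde K_T^n$ by the rational map $g\mapsto[h(g)]$ (defined away from $h^{-1}(0)$), using the identification $\mathbb{P}(\bigotimes_iL\otimes\Lambda^{p_i}W)\cong\mathbb{P}(\bigotimes_i\Lambda^{p_i}T^{\vee})$, valid because the two tensor spaces differ by a one-dimensional tensor factor.
   Formalization: Invariance of η, τ and f_w is stated up to the same character χ as I (scalar matrices rule out strict invariance of nonzero ones); f and f_s are strictly invariant, and are asserted to be rational maps only for I ≠ 0. *)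

theory Defs
  imports Complex_Main "HOL-Library.FuncSet" "HOL-Library.Function_Algebras"
    "HOL-Combinatorics.Permutations"
begin

section \<open>Vector spaces with a carrier, and forms on them\<close>

text \<open>
  The ambient space V is a type with scalar multiplication \<open>scale\<close>, as in
  \<^locale>\<open>finite_dimensional_vector_space\<close>. The spaces derived from it (lines, quotients, Hom spaces,
  kernels) depend on terms, so they come with an explicit carrier. Functions on such spaces are
  normalised to be 0 off the carrier, so that equality of functions is equality of forms.
\<close>

record ('k, 'a) vsp =
  vcarrier :: "'a set"
  vadd :: "'a \<Rightarrow> 'a \<Rightarrow> 'a"
  vsmul :: "'k \<Rightarrow> 'a \<Rightarrow> 'a"

definition linear_forms :: "('k::field, 'a) vsp \<Rightarrow> ('a \<Rightarrow> 'k) set" where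
  "linear_forms E = {l.
     (\<forall>x. x \<notin> vcarrier E \<longrightarrow> l x = 0) \<and>
     (\<forall>x\<in>vcarrier E. \<forall>y\<in>vcarrier E. l (vadd E x y) = l x + l y) \<and>
     (\<forall>c. \<forall>x\<in>vcarrier E. l (vsmul E c x) = c * l x)}"

text \<open>The p-th exterior power of the dual of E, as alternating p-linear forms on E, that is as linear
  forms on the p-th exterior power of E.\<close>

definition alt_forms :: "('k::field, 'a) vsp \<Rightarrow> nat \<Rightarrow> ('a list \<Rightarrow> 'k) set" where
  "alt_forms E p = {w.
     (\<forall>xs. \<not> (length xs = p \<and> set xs \<subseteq> vcarrier E) \<longrightarrow> w xs = 0) \<and>
     (\<forall>xs. length xs = p \<and> set xs \<subseteq> vcarrier E \<longrightarrow>
        (\<forall>i<p. \<forall>x\<in>vcarrier E. \<forall>y\<in>vcarrier E.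
            w (xs[i := vadd E x y]) = w (xs[i := x]) + w (xs[i := y])) \<and>
        (\<forall>i<p. \<forall>c. \<forall>x\<in>vcarrier E. w (xs[i := vsmul E c x]) = c * w (xs[i := x])) \<and>
        (\<forall>i<p. \<forall>j<p. i \<noteq> j \<and> xs ! i = xs ! j \<longrightarrow> w xs = 0))}"


section \<open>Tensor products of function spaces\<close>

text \<open>
  All vector spaces that get tensored below are spaces of k-valued functions. Over a field the canonical
  map from the tensor product of function spaces to functions on the product set is injective, so
  the tensor product is the span of the products of functions in separate variables.
  Tuples are functions on \<^typ>\<open>nat\<close> of which only the entries with index \<open>i < n\<close> are used.
\<close>

definition fscale :: "'k::field \<Rightarrow> ('x \<Rightarrow> 'k) \<Rightarrow> ('x \<Rightarrow> 'k)" where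
  "fscale c f = (\<lambda>x. c * f x)"

definition pure_tensor :: "nat \<Rightarrow> (nat \<Rightarrow> 'x \<Rightarrow> 'k::field) \<Rightarrow> (nat \<Rightarrow> 'x) \<Rightarrow> 'k" where
  "pure_tensor n a = (\<lambda>x. \<Prod>i<n. a i (x i))"

definition tensor_prod :: "nat \<Rightarrow> (nat \<Rightarrow> ('x \<Rightarrow> 'k::field) set) \<Rightarrow> ((nat \<Rightarrow> 'x) \<Rightarrow> 'k) set" where
  "tensor_prod n A = module.span fscale {pure_tensor n a |a. \<forall>i<n. a i \<in> A i}"

definition tensor2 :: "('x \<Rightarrow> 'k::field) set \<Rightarrow> ('y \<Rightarrow> 'k) set \<Rightarrow> ('x \<times> 'y \<Rightarrow> 'k) set" where
  "tensor2 A B = module.span fscale {(\<lambda>(x, y). a x * b y) |a b. a \<in> A \<and> b \<in> B}"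

text \<open>The tensor product of linear maps \<open>f i\<close> defined on \<open>A i\<close>, evaluated at \<open>t\<close>.\<close>

definition tensor_map ::
  "nat \<Rightarrow> (nat \<Rightarrow> ('x \<Rightarrow> 'k::field) set) \<Rightarrow> (nat \<Rightarrow> ('x \<Rightarrow> 'k) \<Rightarrow> ('y \<Rightarrow> 'k))
     \<Rightarrow> ((nat \<Rightarrow> 'x) \<Rightarrow> 'k) \<Rightarrow> ((nat \<Rightarrow> 'y) \<Rightarrow> 'k)" where
  "tensor_map n A f t = (THE r. \<exists>(J::nat) c a.
      (\<forall>j<J. \<forall>i<n. a j i \<in> A i) \<and>
      t = (\<lambda>x. \<Sum>j<J. c j * pure_tensor n (a j) x) \<and>
      r = (\<lambda>y. \<Sum>j<J. c j * pure_tensor n (\<lambda>i. f i (a j i)) y))"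

definition proj_pt :: "('x \<Rightarrow> 'k::field) \<Rightarrow> ('x \<Rightarrow> 'k) set" where
  "proj_pt m = {fscale c m |c. c \<noteq> 0}"

definition proj_space :: "('x \<Rightarrow> 'k::field) set \<Rightarrow> ('x \<Rightarrow> 'k) set set" where
  "proj_space M = proj_pt ` (M - {0})"


section \<open>Regular functions\<close>

inductive_set generated_algebra :: "('x \<Rightarrow> 'k::field) set \<Rightarrow> ('x \<Rightarrow> 'k) set"
  for G :: "('x \<Rightarrow> 'k) set" where
    const: "(\<lambda>x. c) \<in> generated_algebra G"
  | gen: "f \<in> G \<Longrightarrow> f \<in> generated_algebra G"
  | add: "f \<in> generated_algebra G \<Longrightarrow> g \<in> generated_algebra G \<Longrightarrow> (\<lambda>x. f x + g x) \<in> generated_algebra G"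
  | mult: "f \<in> generated_algebra G \<Longrightarrow> g \<in> generated_algebra G \<Longrightarrow> (\<lambda>x. f x * g x) \<in> generated_algebra G"

definition regular_on :: "'x set \<Rightarrow> ('x \<Rightarrow> 'k::field) set \<Rightarrow> ('x \<Rightarrow> 'k) set" where
  "regular_on X G = {f. \<exists>q\<in>generated_algebra G. \<forall>x\<in>X. f x = q x}"

definition dual_space :: "('k::field \<Rightarrow> 'v::ab_group_add \<Rightarrow> 'v) \<Rightarrow> ('v \<Rightarrow> 'k) set" where
  "dual_space scale = {l. Vector_Spaces.linear scale (*) l}"

definition GL :: "('k::field \<Rightarrow> 'v::ab_group_add \<Rightarrow> 'v) \<Rightarrow> ('v \<Rightarrow> 'v) set" where
  "GL scale = {g. Vector_Spaces.linear scale scale g \<and> bij g}"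

abbreviation GLn :: "('k::field \<Rightarrow> 'v::ab_group_add \<Rightarrow> 'v) \<Rightarrow> nat \<Rightarrow> (nat \<Rightarrow> 'v \<Rightarrow> 'v) set" where
  "GLn scale n \<equiv> {..<n} \<rightarrow>\<^sub>E GL scale"

text \<open>
  The coordinate ring of GL(V) is generated by the matrix coefficients and by 1/det; equivalently
  by the matrix coefficients of g and of its inverse (Cramer's rule), which needs no basis.
\<close>

definition reg_GL :: "('k::field \<Rightarrow> 'v::ab_group_add \<Rightarrow> 'v) \<Rightarrow> (('v \<Rightarrow> 'v) \<Rightarrow> 'k) set" where
  "reg_GL scale = regular_on (GL scale)
     ({(\<lambda>g. l (g w)) |l w. l \<in> dual_space scale} \<union>
      {(\<lambda>g. l (inv g w)) |l w. l \<in> dual_space scale})"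

definition reg_GLn :: "('k::field \<Rightarrow> 'v::ab_group_add \<Rightarrow> 'v) \<Rightarrow> nat \<Rightarrow> ((nat \<Rightarrow> 'v \<Rightarrow> 'v) \<Rightarrow> 'k) set" where
  "reg_GLn scale n = regular_on (GLn scale n)
     ({(\<lambda>g. l (g i w)) |l i w. l \<in> dual_space scale \<and> i < n} \<union>
      {(\<lambda>g. l (inv (g i) w)) |l i w. l \<in> dual_space scale \<and> i < n})"

definition algebraic_character :: "('k::field \<Rightarrow> 'v::ab_group_add \<Rightarrow> 'v) \<Rightarrow> (('v \<Rightarrow> 'v) \<Rightarrow> 'k) \<Rightarrow> bool" where
  "algebraic_character scale \<chi> \<longleftrightarrow> \<chi> \<in> reg_GL scale \<and>
     (\<forall>g\<in>GL scale. \<chi> g \<noteq> 0) \<and>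
     (\<forall>g\<in>GL scale. \<forall>h\<in>GL scale. \<chi> (g \<circ> h) = \<chi> g * \<chi> h)"

text \<open>
  \<open>t\<close> is an invariant of (representation \<open>act\<close>) \<open>\<otimes>\<close> \<open>\<chi>\<close>. Invariance of the
  linear objects attached to a relative invariant is meant in this sense, with the same \<open>\<chi>\<close>: scalar matrices
  act nontrivially, so no nonzero one is strictly invariant (unless \<open>n = 0\<close>). Maps to projective spaces
  are strictly invariant.
\<close>

definition relative_invariant ::
  "('k::field \<Rightarrow> 'v::ab_group_add \<Rightarrow> 'v) \<Rightarrow> (('v \<Rightarrow> 'v) \<Rightarrow> 'k)
     \<Rightarrow> (('v \<Rightarrow> 'v) \<Rightarrow> ('x \<Rightarrow> 'k) \<Rightarrow> ('x \<Rightarrow> 'k)) \<Rightarrow> ('x \<Rightarrow> 'k) \<Rightarrow> bool" where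
  "relative_invariant scale \<chi> act t \<longleftrightarrow> (\<forall>g\<in>GL scale. fscale (\<chi> g) (act g t) = t)"


section \<open>The stabilizer and its representations\<close>

abbreviation full_space :: "('k::field \<Rightarrow> 'v::ab_group_add \<Rightarrow> 'v) \<Rightarrow> ('k, 'v) vsp" where
  "full_space scale \<equiv> \<lparr>vcarrier = UNIV, vadd = (+), vsmul = scale\<rparr>"

abbreviation line :: "('k::field \<Rightarrow> 'v::ab_group_add \<Rightarrow> 'v) \<Rightarrow> 'v \<Rightarrow> 'v set" where
  "line scale v \<equiv> module.span scale {v}"

abbreviation line_space :: "('k::field \<Rightarrow> 'v::ab_group_add \<Rightarrow> 'v) \<Rightarrow> 'v \<Rightarrow> ('k, 'v) vsp" where
  "line_space scale v \<equiv> \<lparr>vcarrier = line scale v, vadd = (+), vsmul = scale\<rparr>"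

definition coset :: "('k::field \<Rightarrow> 'v::ab_group_add \<Rightarrow> 'v) \<Rightarrow> 'v \<Rightarrow> 'v \<Rightarrow> 'v set" where
  "coset scale v0 y = {y + s |s. s \<in> line scale v0}"

definition quot_space :: "('k::field \<Rightarrow> 'v::ab_group_add \<Rightarrow> 'v) \<Rightarrow> 'v \<Rightarrow> ('k, 'v set) vsp" where
  "quot_space scale v0 =
     \<lparr>vcarrier = range (coset scale v0),
      vadd = (\<lambda>A B. {a + b |a b. a \<in> A \<and> b \<in> B}),
      vsmul = (\<lambda>c A. {scale c a + s |a s. a \<in> A \<and> s \<in> line scale v0})\<rparr>"

definition stab :: "('k::field \<Rightarrow> 'v::ab_group_add \<Rightarrow> 'v) \<Rightarrow> 'v \<Rightarrow> ('v \<Rightarrow> 'v) set" where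
  "stab scale v0 = {h \<in> GL scale. h ` line scale v0 = line scale v0}"

definition L_rep :: "('k::field \<Rightarrow> 'v::ab_group_add \<Rightarrow> 'v) \<Rightarrow> 'v \<Rightarrow> ('v \<Rightarrow> 'k) set" where
  "L_rep scale v0 = linear_forms (line_space scale v0)"

definition W_rep :: "('k::field \<Rightarrow> 'v::ab_group_add \<Rightarrow> 'v) \<Rightarrow> 'v \<Rightarrow> ('v set \<Rightarrow> 'k) set" where
  "W_rep scale v0 = linear_forms (quot_space scale v0)"

text \<open>The tensor product of L with the p-th exterior power of W.\<close>

definition LW :: "('k::field \<Rightarrow> 'v::ab_group_add \<Rightarrow> 'v) \<Rightarrow> 'v \<Rightarrow> nat \<Rightarrow> ('v \<times> 'v set list \<Rightarrow> 'k) set" where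
  "LW scale v0 p = tensor2 (L_rep scale v0) (alt_forms (quot_space scale v0) p)"

text \<open>T is L tensored with the dual of W, i.e. the space of linear maps from the line of \<open>v0\<close> to the quotient.\<close>

definition T_space :: "('k::field \<Rightarrow> 'v::ab_group_add \<Rightarrow> 'v) \<Rightarrow> 'v \<Rightarrow> ('k, 'v \<Rightarrow> 'v set) vsp" where
  "T_space scale v0 = (let Q = quot_space scale v0 in
     \<lparr>vcarrier = {t \<in> line scale v0 \<rightarrow>\<^sub>E vcarrier Q.
          (\<forall>x\<in>line scale v0. \<forall>y\<in>line scale v0. t (x + y) = vadd Q (t x) (t y)) \<and>
          (\<forall>c. \<forall>x\<in>line scale v0. t (scale c x) = vsmul Q c (t x))},
      vadd = (\<lambda>t u. \<lambda>x\<in>line scale v0. vadd Q (t x) (u x)),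
      vsmul = (\<lambda>c t. \<lambda>x\<in>line scale v0. vsmul Q c (t x))\<rparr>)"

definition T_act :: "('k::field \<Rightarrow> 'v::ab_group_add \<Rightarrow> 'v) \<Rightarrow> 'v
    \<Rightarrow> ('v \<Rightarrow> 'v) \<Rightarrow> ('v \<Rightarrow> 'v set) \<Rightarrow> ('v \<Rightarrow> 'v set)" where
  "T_act scale v0 h t = (\<lambda>x\<in>line scale v0. h ` t (inv h x))"

definition K_T :: "('k::field \<Rightarrow> 'v::ab_group_add \<Rightarrow> 'v) \<Rightarrow> 'v \<Rightarrow> ('v \<Rightarrow> 'v) set" where
  "K_T scale v0 = {h \<in> stab scale v0. \<forall>t\<in>vcarrier (T_space scale v0). T_act scale v0 h t = t}"

definition Ks_T :: "('k::field \<Rightarrow> 'v::ab_group_add \<Rightarrow> 'v) \<Rightarrow> 'v \<Rightarrow> ('v \<Rightarrow> 'v) set" where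
  "Ks_T scale v0 = {h \<in> stab scale v0. \<exists>c. \<forall>t\<in>vcarrier (T_space scale v0).
      T_act scale v0 h t = vsmul (T_space scale v0) c t}"

definition K_LTW :: "('k::field \<Rightarrow> 'v::ab_group_add \<Rightarrow> 'v) \<Rightarrow> 'v \<Rightarrow> ('v \<Rightarrow> 'v) set" where
  "K_LTW scale v0 = {h \<in> stab scale v0.
      (\<forall>l\<in>L_rep scale v0. (\<lambda>x. l (inv h x)) = l) \<and>
      (\<forall>t\<in>vcarrier (T_space scale v0). T_act scale v0 h t = t) \<and>
      (\<forall>w\<in>W_rep scale v0. (\<lambda>Y. w (inv h ` Y)) = w)}"

definition LW_act :: "('v \<Rightarrow> 'v) \<Rightarrow> ('v \<times> 'v set list \<Rightarrow> 'k) \<Rightarrow> ('v \<times> 'v set list \<Rightarrow> 'k)" where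
  "LW_act h m = (\<lambda>(s, ys). m (inv h s, map ((`) (inv h)) ys))"

definition LWn_act :: "(nat \<Rightarrow> 'v \<Rightarrow> 'v) \<Rightarrow> ((nat \<Rightarrow> 'v \<times> 'v set list) \<Rightarrow> 'k)
    \<Rightarrow> ((nat \<Rightarrow> 'v \<times> 'v set list) \<Rightarrow> 'k)" where
  "LWn_act h m = (\<lambda>x. m (\<lambda>i. case x i of (s, ys) \<Rightarrow> (inv (h i) s, map ((`) (inv (h i))) ys)))"

text \<open>
  Regular maps from GL(V) to a space M of functions on a set, uncurried. For finite-dimensional M
  the evaluations at points span the dual of M, so regularity can be tested on evaluations.
\<close>

definition O_bal :: "('k::field \<Rightarrow> 'v::ab_group_add \<Rightarrow> 'v) \<Rightarrow> ('x \<Rightarrow> 'k) set \<Rightarrow> (('v \<Rightarrow> 'v) \<times> 'x \<Rightarrow> 'k) set" where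
  "O_bal scale M = {\<phi>.
     (\<forall>g\<in>GL scale. (\<lambda>x. \<phi> (g, x)) \<in> M) \<and>
     (\<forall>x. (\<lambda>g. \<phi> (g, x)) \<in> reg_GL scale) \<and>
     (\<forall>g x. g \<notin> GL scale \<longrightarrow> \<phi> (g, x) = 0)}"

definition O_bal_inv :: "('k::field \<Rightarrow> 'v::ab_group_add \<Rightarrow> 'v) \<Rightarrow> 'v \<Rightarrow> nat
    \<Rightarrow> (('v \<Rightarrow> 'v) \<times> 'v \<times> 'v set list \<Rightarrow> 'k) set" where
  "O_bal_inv scale v0 p = {\<phi> \<in> O_bal scale (LW scale v0 p).
     \<forall>g\<in>GL scale. \<forall>h\<in>stab scale v0.
       (\<lambda>x. \<phi> (g \<circ> h, x)) = LW_act (inv h) (\<lambda>x. \<phi> (g, x))}"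

definition as_map :: "((nat \<Rightarrow> ('v \<Rightarrow> 'v) \<times> 'x) \<Rightarrow> 'k) \<Rightarrow> (nat \<Rightarrow> 'v \<Rightarrow> 'v) \<Rightarrow> ((nat \<Rightarrow> 'x) \<Rightarrow> 'k)" where
  "as_map t g = (\<lambda>x. t (\<lambda>i. (g i, x i)))"

definition O_bal_n_inv :: "('k::field \<Rightarrow> 'v::ab_group_add \<Rightarrow> 'v) \<Rightarrow> 'v \<Rightarrow> nat \<Rightarrow> (nat \<Rightarrow> nat)
    \<Rightarrow> ((nat \<Rightarrow> ('v \<Rightarrow> 'v) \<times> 'v \<times> 'v set list) \<Rightarrow> 'k) set" where
  "O_bal_n_inv scale v0 n p =
     {t \<in> tensor_prod n (\<lambda>i. O_bal scale (LW scale v0 (p i))).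
      \<forall>g\<in>GLn scale n. \<forall>h\<in>{..<n} \<rightarrow>\<^sub>E stab scale v0.
        as_map t (\<lambda>i. g i \<circ> h i) = LWn_act (\<lambda>i. inv (h i)) (as_map t g)}"


section \<open>Twisted differential forms on projective space and its powers\<close>

text \<open>
  For a nonzero linear form l, the affine open set of P(V) where l does not vanish is identified
  with the affine hyperplane \<open>l v = 1\<close>, whose tangent spaces are the kernel of l, and O(m) is
  trivialised on it by the m-th power of l. A global section of a sheaf of forms twisted by O(m) is a
  compatible family of polynomial forms on these charts. The transition from the chart of l to
  that of l' is \<open>v \<mapsto> v / l' v\<close>, and the coefficient of the section is multiplied by
  the m-th power of \<open>l' / l\<close>. (Testing polynomiality on these charts, rather than
  local regularity at k-points, is what gives the global sections also when k is not
  algebraically closed.)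
\<close>

definition nz_forms :: "('k::field \<Rightarrow> 'v::ab_group_add \<Rightarrow> 'v) \<Rightarrow> ('v \<Rightarrow> 'k) set" where
  "nz_forms scale = dual_space scale - {0}"

abbreviation ker_space :: "('k::field \<Rightarrow> 'v::ab_group_add \<Rightarrow> 'v) \<Rightarrow> ('v \<Rightarrow> 'k) \<Rightarrow> ('k, 'v) vsp" where
  "ker_space scale l \<equiv> \<lparr>vcarrier = {u. l u = 0}, vadd = (+), vsmul = scale\<rparr>"

definition prod_ker_space :: "('k::field \<Rightarrow> 'v::ab_group_add \<Rightarrow> 'v) \<Rightarrow> nat \<Rightarrow> (nat \<Rightarrow> 'v \<Rightarrow> 'k) \<Rightarrow> ('k, nat \<Rightarrow> 'v) vsp" where
  "prod_ker_space scale n l =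
     \<lparr>vcarrier = (\<Pi>\<^sub>E i\<in>{..<n}. {u. l i u = 0}),
      vadd = (\<lambda>x y. \<lambda>i\<in>{..<n}. x i + y i),
      vsmul = (\<lambda>c x. \<lambda>i\<in>{..<n}. scale c (x i))\<rparr>"

definition affine_pts :: "nat \<Rightarrow> (nat \<Rightarrow> 'v \<Rightarrow> 'k::field) \<Rightarrow> (nat \<Rightarrow> 'v) set" where
  "affine_pts n l = (\<Pi>\<^sub>E i\<in>{..<n}. {v. l i v = 1})"

definition reg_affine :: "('k::field \<Rightarrow> 'v::ab_group_add \<Rightarrow> 'v) \<Rightarrow> nat \<Rightarrow> (nat \<Rightarrow> 'v \<Rightarrow> 'k) \<Rightarrow> ((nat \<Rightarrow> 'v) \<Rightarrow> 'k) set" where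
  "reg_affine scale n l = regular_on (affine_pts n l) {(\<lambda>v. m (v i)) |m i. m \<in> dual_space scale \<and> i < n}"

definition chart_trans :: "('k::field \<Rightarrow> 'v::ab_group_add \<Rightarrow> 'v) \<Rightarrow> ('v \<Rightarrow> 'k) \<Rightarrow> 'v \<Rightarrow> 'v" where
  "chart_trans scale l' v = scale (1 / l' v) v"

text \<open>The derivative of \<open>chart_trans scale l'\<close> at v in the direction u.\<close>

definition chart_dtrans :: "('k::field \<Rightarrow> 'v::ab_group_add \<Rightarrow> 'v) \<Rightarrow> ('v \<Rightarrow> 'k) \<Rightarrow> 'v \<Rightarrow> 'v \<Rightarrow> 'v" where
  "chart_dtrans scale l' v u = scale (1 / l' v) u - scale (l' u / (l' v)\<^sup>2) v"

text \<open>
  Global sections over the n-th power of P(V) of the external tensor product of the sheaves of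
  \<open>p i\<close>-forms, twisted by \<open>m\<close>; an argument \<open>x i = (l, v, us)\<close> consists of a chart, a
  point in it, and tangent vectors at that point.
\<close>

definition H0_box :: "('k::field \<Rightarrow> 'v::ab_group_add \<Rightarrow> 'v) \<Rightarrow> nat \<Rightarrow> (nat \<Rightarrow> nat) \<Rightarrow> (nat \<Rightarrow> nat)
    \<Rightarrow> ((nat \<Rightarrow> ('v \<Rightarrow> 'k) \<times> 'v \<times> 'v list) \<Rightarrow> 'k) set" where
  "H0_box scale n p m = {s.
     (\<forall>x y. (\<forall>i<n. x i = y i) \<longrightarrow> s x = s y) \<and>
     (\<forall>l v us. \<not> (\<forall>i<n. l i \<in> nz_forms scale \<and> l i (v i) = 1) \<longrightarrow> s (\<lambda>i. (l i, v i, us i)) = 0) \<and>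
     (\<forall>l v. (\<forall>i<n. l i \<in> nz_forms scale \<and> l i (v i) = 1) \<longrightarrow>
        (\<lambda>us. s (\<lambda>i. (l i, v i, us i))) \<in> tensor_prod n (\<lambda>i. alt_forms (ker_space scale (l i)) (p i))) \<and>
     (\<forall>l us. (\<forall>i<n. l i \<in> nz_forms scale) \<longrightarrow>
        (\<lambda>v. s (\<lambda>i. (l i, v i, us i))) \<in> reg_affine scale n l) \<and>
     (\<forall>l l' v us. (\<forall>i<n. l i \<in> nz_forms scale \<and> l' i \<in> nz_forms scale \<and>
           l i (v i) = 1 \<and> l' i (v i) \<noteq> 0 \<and> length (us i) = p i \<and> set (us i) \<subseteq> {u. l i u = 0}) \<longrightarrow>
        s (\<lambda>i. (l i, v i, us i)) =
          (\<Prod>i<n. (l' i (v i)) ^ m i) *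
          s (\<lambda>i. (l' i, chart_trans scale (l' i) (v i), map (chart_dtrans scale (l' i) (v i)) (us i))))}"

text \<open>Global sections over the n-th power of P(V) of the sheaf of q-forms twisted by \<open>m\<close>.\<close>

definition H0_forms :: "('k::field \<Rightarrow> 'v::ab_group_add \<Rightarrow> 'v) \<Rightarrow> nat \<Rightarrow> nat \<Rightarrow> (nat \<Rightarrow> nat)
    \<Rightarrow> ((nat \<Rightarrow> 'v \<Rightarrow> 'k) \<times> (nat \<Rightarrow> 'v) \<times> (nat \<Rightarrow> 'v) list \<Rightarrow> 'k) set" where
  "H0_forms scale n q m = {s.
     (\<forall>l v us. \<not> (l \<in> {..<n} \<rightarrow>\<^sub>E nz_forms scale \<and> v \<in> affine_pts n l) \<longrightarrow> s (l, v, us) = 0) \<and>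
     (\<forall>l\<in>{..<n} \<rightarrow>\<^sub>E nz_forms scale. \<forall>v\<in>affine_pts n l.
        (\<lambda>us. s (l, v, us)) \<in> alt_forms (prod_ker_space scale n l) q) \<and>
     (\<forall>l\<in>{..<n} \<rightarrow>\<^sub>E nz_forms scale. \<forall>us. (\<lambda>v. s (l, v, us)) \<in> reg_affine scale n l) \<and>
     (\<forall>l\<in>{..<n} \<rightarrow>\<^sub>E nz_forms scale. \<forall>l'\<in>{..<n} \<rightarrow>\<^sub>E nz_forms scale. \<forall>v\<in>affine_pts n l. \<forall>us.
        (\<forall>i<n. l' i (v i) \<noteq> 0) \<and> length us = q \<and> set us \<subseteq> vcarrier (prod_ker_space scale n l) \<longrightarrow>
        s (l, v, us) =
          (\<Prod>i<n. (l' i (v i)) ^ m i) *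
          s (l', (\<lambda>i\<in>{..<n}. chart_trans scale (l' i) (v i)),
             map (\<lambda>u. \<lambda>i\<in>{..<n}. chart_dtrans scale (l' i) (v i) (u i)) us))}"

text \<open>
  The inclusion of the external tensor product into forms on the product, sending a pure tensor to
  the wedge product of the pullbacks of its factors under the projections.
\<close>

definition wedge_incl :: "('k::field_char_0 \<Rightarrow> 'v::ab_group_add \<Rightarrow> 'v) \<Rightarrow> nat \<Rightarrow> (nat \<Rightarrow> nat)
    \<Rightarrow> ((nat \<Rightarrow> ('v \<Rightarrow> 'k) \<times> 'v \<times> 'v list) \<Rightarrow> 'k)
    \<Rightarrow> ((nat \<Rightarrow> 'v \<Rightarrow> 'k) \<times> (nat \<Rightarrow> 'v) \<times> (nat \<Rightarrow> 'v) list \<Rightarrow> 'k)" where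
  "wedge_incl scale n p s = (\<lambda>(l, v, us).
     if l \<in> {..<n} \<rightarrow>\<^sub>E nz_forms scale \<and> v \<in> affine_pts n l \<and>
        length us = (\<Sum>i<n. p i) \<and> set us \<subseteq> vcarrier (prod_ker_space scale n l)
     then (\<Sum>\<sigma> | \<sigma> permutes {..<\<Sum>i<n. p i}.
             of_int (sign \<sigma>) *
             s (\<lambda>i. (l i, v i, map (\<lambda>j. (us ! \<sigma> ((\<Sum>r<i. p r) + j)) i) [0..<p i])))
          / (\<Prod>i<n. fact (p i))
     else 0)"


section \<open>Actions of GL(V)\<close>

definition act_I :: "('v \<Rightarrow> 'v) \<Rightarrow> ((nat \<Rightarrow> 'v list) \<Rightarrow> 'k) \<Rightarrow> ((nat \<Rightarrow> 'v list) \<Rightarrow> 'k)" where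
  "act_I g t = (\<lambda>x. t (\<lambda>i. map (inv g) (x i)))"

definition act_tau :: "('v \<Rightarrow> 'v) \<Rightarrow> ((nat \<Rightarrow> ('v \<Rightarrow> 'v) \<times> 'x) \<Rightarrow> 'k) \<Rightarrow> ((nat \<Rightarrow> ('v \<Rightarrow> 'v) \<times> 'x) \<Rightarrow> 'k)" where
  "act_tau g t = (\<lambda>x. t (\<lambda>i. (inv g \<circ> fst (x i), snd (x i))))"

text \<open>g carries the chart of \<open>l \<circ> g\<close> to the chart of l, compatibly with the trivialisations of O(m).\<close>

definition act_box :: "('v \<Rightarrow> 'v) \<Rightarrow> ((nat \<Rightarrow> ('v \<Rightarrow> 'k) \<times> 'v \<times> 'v list) \<Rightarrow> 'k)
    \<Rightarrow> ((nat \<Rightarrow> ('v \<Rightarrow> 'k) \<times> 'v \<times> 'v list) \<Rightarrow> 'k)" where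
  "act_box g s = (\<lambda>x. s (\<lambda>i. case x i of (l, v, us) \<Rightarrow> (l \<circ> g, inv g v, map (inv g) us)))"

definition act_forms :: "nat \<Rightarrow> ('v \<Rightarrow> 'v)
    \<Rightarrow> ((nat \<Rightarrow> 'v \<Rightarrow> 'k::field) \<times> (nat \<Rightarrow> 'v) \<times> (nat \<Rightarrow> 'v) list \<Rightarrow> 'k)
    \<Rightarrow> ((nat \<Rightarrow> 'v \<Rightarrow> 'k) \<times> (nat \<Rightarrow> 'v) \<times> (nat \<Rightarrow> 'v) list \<Rightarrow> 'k)" where
  "act_forms n g s = (\<lambda>(l, v, us).
     if l \<in> extensional {..<n} \<and> v \<in> extensional {..<n} \<and> set us \<subseteq> extensional {..<n}
     then s (\<lambda>i\<in>{..<n}. l i \<circ> g, \<lambda>i\<in>{..<n}. inv g (v i), map (\<lambda>u. \<lambda>i\<in>{..<n}. inv g (u i)) us)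
     else 0)"

definition act_cosets :: "nat \<Rightarrow> ('v \<Rightarrow> 'v) \<Rightarrow> (nat \<Rightarrow> ('v \<Rightarrow> 'v) set) \<Rightarrow> (nat \<Rightarrow> ('v \<Rightarrow> 'v) set)" where
  "act_cosets n g c = (\<lambda>i\<in>{..<n}. (\<lambda>a. g \<circ> a) ` c i)"


section \<open>Maps on quotients of GL(V)\<close>

text \<open>
  The n-th power of GL(V)/K, as tuples of left cosets. Being regular (on the quotient, or on an open subset of it)
  is tested after pullback to GL(V), by the universal property of the quotient by a closed subgroup.
\<close>

definition quot_proj :: "nat \<Rightarrow> ('v \<Rightarrow> 'v) set \<Rightarrow> (nat \<Rightarrow> 'v \<Rightarrow> 'v) \<Rightarrow> (nat \<Rightarrow> ('v \<Rightarrow> 'v) set)" where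
  "quot_proj n K g = (\<lambda>i\<in>{..<n}. (\<lambda>k. g i \<circ> k) ` K)"

definition quot_n :: "('k::field \<Rightarrow> 'v::ab_group_add \<Rightarrow> 'v) \<Rightarrow> nat \<Rightarrow> ('v \<Rightarrow> 'v) set \<Rightarrow> (nat \<Rightarrow> ('v \<Rightarrow> 'v) set) set" where
  "quot_n scale n K = quot_proj n K ` GLn scale n"

definition quot_rep :: "nat \<Rightarrow> (nat \<Rightarrow> ('v \<Rightarrow> 'v) set) \<Rightarrow> (nat \<Rightarrow> 'v \<Rightarrow> 'v)" where
  "quot_rep n c = (\<lambda>i\<in>{..<n}. SOME g. g \<in> c i)"

definition regular_maps :: "('k::field \<Rightarrow> 'v::ab_group_add \<Rightarrow> 'v) \<Rightarrow> nat \<Rightarrow> ('x \<Rightarrow> 'k) set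
    \<Rightarrow> ((nat \<Rightarrow> 'v \<Rightarrow> 'v) \<Rightarrow> 'x \<Rightarrow> 'k) set" where
  "regular_maps scale n M = {\<phi>. (\<forall>g\<in>GLn scale n. \<phi> g \<in> M) \<and> (\<forall>x. (\<lambda>g. \<phi> g x) \<in> reg_GLn scale n)}"

definition regular_on_quot :: "('k::field \<Rightarrow> 'v::ab_group_add \<Rightarrow> 'v) \<Rightarrow> nat \<Rightarrow> ('v \<Rightarrow> 'v) set
    \<Rightarrow> ('x \<Rightarrow> 'k) set \<Rightarrow> ((nat \<Rightarrow> ('v \<Rightarrow> 'v) set) \<Rightarrow> 'x \<Rightarrow> 'k) \<Rightarrow> bool" where
  "regular_on_quot scale n K M f \<longleftrightarrow> (\<lambda>g. f (quot_proj n K g)) \<in> regular_maps scale n M"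

definition zariski_open :: "('k::field \<Rightarrow> 'v::ab_group_add \<Rightarrow> 'v) \<Rightarrow> nat \<Rightarrow> (nat \<Rightarrow> 'v \<Rightarrow> 'v) set \<Rightarrow> bool" where
  "zariski_open scale n U \<longleftrightarrow> (\<exists>S\<subseteq>reg_GLn scale n. U = {g \<in> GLn scale n. \<exists>q\<in>S. q g \<noteq> 0})"

text \<open>
  A rational map from the n-th power of GL(V)/K (an irreducible variety) to P(M): a partial map whose domain is a
  nonempty open set and which is locally of the form \<open>g \<mapsto> [\<phi> g]\<close> with \<open>\<phi>\<close> regular
  (denominators of local representatives can be cleared).
\<close>

definition rational_on_quot :: "('k::field \<Rightarrow> 'v::ab_group_add \<Rightarrow> 'v) \<Rightarrow> nat \<Rightarrow> ('v \<Rightarrow> 'v) set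
    \<Rightarrow> ('x \<Rightarrow> 'k) set \<Rightarrow> ((nat \<Rightarrow> ('v \<Rightarrow> 'v) set) \<Rightarrow> ('x \<Rightarrow> 'k) set option) \<Rightarrow> bool" where
  "rational_on_quot scale n K M f \<longleftrightarrow>
     dom f \<subseteq> quot_n scale n K \<and> dom f \<noteq> {} \<and> ran f \<subseteq> proj_space M \<and>
     zariski_open scale n {g \<in> GLn scale n. quot_proj n K g \<in> dom f} \<and>
     (\<forall>g0\<in>GLn scale n. quot_proj n K g0 \<in> dom f \<longrightarrow>
        (\<exists>\<phi>\<in>regular_maps scale n M. \<phi> g0 \<noteq> 0 \<and>
           (\<forall>g\<in>GLn scale n. quot_proj n K g \<in> dom f \<and> \<phi> g \<noteq> 0 \<longrightarrow>
              f (quot_proj n K g) = Some (proj_pt (\<phi> g)))))"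


section \<open>The constructions\<close>

abbreviation inv_space :: "('k::field \<Rightarrow> 'v::ab_group_add \<Rightarrow> 'v) \<Rightarrow> nat \<Rightarrow> (nat \<Rightarrow> nat) \<Rightarrow> ((nat \<Rightarrow> 'v list) \<Rightarrow> 'k) set" where
  "inv_space scale n p \<equiv> tensor_prod n (\<lambda>i. alt_forms (full_space scale) (p i + 1))"

abbreviation LWn :: "('k::field \<Rightarrow> 'v::ab_group_add \<Rightarrow> 'v) \<Rightarrow> 'v \<Rightarrow> nat \<Rightarrow> (nat \<Rightarrow> nat)
    \<Rightarrow> ((nat \<Rightarrow> 'v \<times> 'v set list) \<Rightarrow> 'k) set" where
  "LWn scale v0 n p \<equiv> tensor_prod n (\<lambda>i. LW scale v0 (p i))"

abbreviation Tn :: "('k::field \<Rightarrow> 'v::ab_group_add \<Rightarrow> 'v) \<Rightarrow> 'v \<Rightarrow> nat \<Rightarrow> (nat \<Rightarrow> nat)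
    \<Rightarrow> ((nat \<Rightarrow> ('v \<Rightarrow> 'v set) list) \<Rightarrow> 'k) set" where
  "Tn scale v0 n p \<equiv> tensor_prod n (\<lambda>i. alt_forms (T_space scale v0) (p i))"

definition psi :: "('k::field \<Rightarrow> 'v::ab_group_add \<Rightarrow> 'v) \<Rightarrow> 'v \<Rightarrow> nat \<Rightarrow> ('v list \<Rightarrow> 'k)
    \<Rightarrow> (('v \<Rightarrow> 'v) \<times> 'v \<times> 'v set list \<Rightarrow> 'k)" where
  "psi scale v0 p \<xi> = (\<lambda>(g, s, ys).
     if g \<in> GL scale \<and> s \<in> line scale v0 \<and> length ys = p \<and> set ys \<subseteq> vcarrier (quot_space scale v0)
     then \<xi> (map g (s # map (\<lambda>Y. SOME y. y \<in> Y) ys))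
     else 0)"

definition tau :: "('k::field \<Rightarrow> 'v::ab_group_add \<Rightarrow> 'v) \<Rightarrow> 'v \<Rightarrow> nat \<Rightarrow> (nat \<Rightarrow> nat) \<Rightarrow> ((nat \<Rightarrow> 'v list) \<Rightarrow> 'k)
    \<Rightarrow> ((nat \<Rightarrow> ('v \<Rightarrow> 'v) \<times> 'v \<times> 'v set list) \<Rightarrow> 'k)" where
  "tau scale v0 n p =
     tensor_map n (\<lambda>i. alt_forms (full_space scale) (p i + 1)) (\<lambda>i. psi scale v0 (p i))"

text \<open>
  The isomorphism from H-equivariant regular maps to sections of the sheaf of p-forms twisted by \<open>p + 1\<close>. The map
  \<open>\<phi>\<close> gives the section of the homogeneous bundle with value \<open>[g, \<phi> g]\<close> at \<open>g [v0]\<close>,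
  which is the linear form \<open>\<phi> g \<circ> g\<^sup>-\<^sup>1\<close> on \<open>[v] \<otimes> \<Lambda>\<^sup>p (V/[v])\<close>
  where \<open>[v] = g [v0]\<close>. In the chart of l, a tangent vector u at v is the homomorphism from \<open>[v]\<close> to
  \<open>V/[v]\<close> sending v to the class of u, and the trivialisation of \<open>O(p+1)\<close> is
  evaluation at \<open>v\<close>, since \<open>l v = 1\<close>.
\<close>

definition to_section :: "('k::field \<Rightarrow> 'v::ab_group_add \<Rightarrow> 'v) \<Rightarrow> 'v \<Rightarrow> nat
    \<Rightarrow> (('v \<Rightarrow> 'v) \<times> 'v \<times> 'v set list \<Rightarrow> 'k) \<Rightarrow> (('v \<Rightarrow> 'k) \<times> 'v \<times> 'v list \<Rightarrow> 'k)" where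
  "to_section scale v0 p \<phi> = (\<lambda>(l, v, us).
     if l \<in> nz_forms scale \<and> l v = 1 \<and> length us = p \<and> set us \<subseteq> {u. l u = 0}
     then let g = (SOME g. g \<in> GL scale \<and> g ` line scale v0 = line scale v)
          in \<phi> (g, inv g v, map (\<lambda>u. coset scale v0 (inv g u)) us)
     else 0)"

text \<open>The Kuenneth isomorphism is the identity in this representation: both sides consist of functions
  on tuples of triples (chart, point, tangent vectors).\<close>

definition eta :: "('k::field \<Rightarrow> 'v::ab_group_add \<Rightarrow> 'v) \<Rightarrow> 'v \<Rightarrow> nat \<Rightarrow> (nat \<Rightarrow> nat) \<Rightarrow> ((nat \<Rightarrow> 'v list) \<Rightarrow> 'k)
    \<Rightarrow> ((nat \<Rightarrow> ('v \<Rightarrow> 'k) \<times> 'v \<times> 'v list) \<Rightarrow> 'k)" where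
  "eta scale v0 n p I =
     tensor_map n (\<lambda>i. O_bal_inv scale v0 (p i)) (\<lambda>i. to_section scale v0 (p i)) (tau scale v0 n p I)"

definition f_w :: "('k::field \<Rightarrow> 'v::ab_group_add \<Rightarrow> 'v) \<Rightarrow> 'v \<Rightarrow> nat \<Rightarrow> (nat \<Rightarrow> nat) \<Rightarrow> ((nat \<Rightarrow> 'v list) \<Rightarrow> 'k)
    \<Rightarrow> (nat \<Rightarrow> ('v \<Rightarrow> 'v) set) \<Rightarrow> ((nat \<Rightarrow> 'v \<times> 'v set list) \<Rightarrow> 'k)" where
  "f_w scale v0 n p I c = as_map (tau scale v0 n p I) (quot_rep n c)"

text \<open>
  The isomorphism from \<open>L \<otimes> \<Lambda>\<^sup>p W\<close> to \<open>\<Lambda>\<^sup>p T\<^sup>\<or>\<close> given by the basis \<open>v0\<close> of the line; another basis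
  changes it by a scalar factor only, hence not the induced map of projective spaces.
\<close>

definition to_T :: "('k::field \<Rightarrow> 'v::ab_group_add \<Rightarrow> 'v) \<Rightarrow> 'v \<Rightarrow> nat \<Rightarrow> ('v \<times> 'v set list \<Rightarrow> 'k)
    \<Rightarrow> (('v \<Rightarrow> 'v set) list \<Rightarrow> 'k)" where
  "to_T scale v0 p m = (\<lambda>ts.
     if length ts = p \<and> set ts \<subseteq> vcarrier (T_space scale v0) then m (v0, map (\<lambda>t. t v0) ts) else 0)"

definition proj_ident :: "('k::field \<Rightarrow> 'v::ab_group_add \<Rightarrow> 'v) \<Rightarrow> 'v \<Rightarrow> nat \<Rightarrow> (nat \<Rightarrow> nat)
    \<Rightarrow> ((nat \<Rightarrow> 'v \<times> 'v set list) \<Rightarrow> 'k) set \<Rightarrow> ((nat \<Rightarrow> ('v \<Rightarrow> 'v set) list) \<Rightarrow> 'k) set" where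
  "proj_ident scale v0 n p P =
     tensor_map n (\<lambda>i. LW scale v0 (p i)) (\<lambda>i. to_T scale v0 (p i)) ` P"

definition h_proj :: "('k::field \<Rightarrow> 'v::ab_group_add \<Rightarrow> 'v) \<Rightarrow> 'v \<Rightarrow> nat \<Rightarrow> (nat \<Rightarrow> nat) \<Rightarrow> ((nat \<Rightarrow> 'v list) \<Rightarrow> 'k)
    \<Rightarrow> (nat \<Rightarrow> 'v \<Rightarrow> 'v) \<Rightarrow> ((nat \<Rightarrow> ('v \<Rightarrow> 'v set) list) \<Rightarrow> 'k) set option" where
  "h_proj scale v0 n p I g = (let m = as_map (tau scale v0 n p I) g in
     if m = 0 then None else Some (proj_ident scale v0 n p (proj_pt m)))"

definition f_frames :: "('k::field \<Rightarrow> 'v::ab_group_add \<Rightarrow> 'v) \<Rightarrow> 'v \<Rightarrow> nat \<Rightarrow> (nat \<Rightarrow> nat) \<Rightarrow> ((nat \<Rightarrow> 'v list) \<Rightarrow> 'k)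
    \<Rightarrow> (nat \<Rightarrow> ('v \<Rightarrow> 'v) set) \<Rightarrow> ((nat \<Rightarrow> ('v \<Rightarrow> 'v set) list) \<Rightarrow> 'k) set option" where
  "f_frames scale v0 n p I c =
     (if c \<in> quot_n scale n (K_T scale v0) then h_proj scale v0 n p I (quot_rep n c) else None)"

definition f_scaled :: "('k::field \<Rightarrow> 'v::ab_group_add \<Rightarrow> 'v) \<Rightarrow> 'v \<Rightarrow> nat \<Rightarrow> (nat \<Rightarrow> nat) \<Rightarrow> ((nat \<Rightarrow> 'v list) \<Rightarrow> 'k)
    \<Rightarrow> (nat \<Rightarrow> ('v \<Rightarrow> 'v) set) \<Rightarrow> ((nat \<Rightarrow> ('v \<Rightarrow> 'v set) list) \<Rightarrow> 'k) set option" where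
  "f_scaled scale v0 n p I c =
     (if c \<in> quot_n scale n (Ks_T scale v0) then h_proj scale v0 n p I (quot_rep n c) else None)"

end

theory Submission
  imports Defs
begin

text \<open>
  The maps \<open>\<psi>\<close>, \<open>to_section\<close> and \<open>to_T\<close> are all of the form
  \<open>a \<mapsto> (\<lambda>y. w y \<cdot> a (e y))\<close> for a change of arguments \<open>e\<close> and a weight
  \<open>w\<close> that is 0 or 1. Hence their tensor products are again changes of arguments, and no independence
  argument is needed to see that \<open>tensor_map\<close> is well defined on them. In this way \<open>\<tau>\<close> at
  \<open>(g, s, y)\<close> is \<open>I (g (s \<and> y))\<close> and \<open>\<eta>\<close> at a point \<open>v\<close> with tangent vectors
  \<open>us\<close> is \<open>I (v \<and> us)\<close>; regularity, equivariance, the transition rules and the relative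
  invariance can be read off from these formulas. The maps on frames descend because an element acting on
  \<open>T\<close> by a scalar acts by scalars on the line and on the quotient, and so multiplies \<open>\<tau>\<close> by a
  nonzero constant.
\<close>

text \<open>The definitions bury three choices: a representative of each coset in V/[v0], a frame at
  each point of P(V), and a representative of each class in GL(V)/K. The first drops out because an
  alternating form at \<open>s # ys\<close> does not change when multiples of \<open>s\<close> are
  added to entries of \<open>ys\<close>; after that a frame at a point meets its own inverse and
  cancels; the third costs a scalar, which is 1 for \<open>K_LTW\<close>. Functions are cut off by 0
  outside their carriers, while invariance is an equality of functions everywhere. Hence the many
  equivalences saying that an argument is admissible exactly when its translate is. The inclusion
  into forms on the product needs multilinear algebra of its own: at a point, a tensor of forms
  alternates only within the block of positions of each factor, and the sum over all permutations
  makes it alternate across blocks. Injectivity is tested on tangent vectors that each lie in a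
  single factor, and the integer that appears is cancelled in characteristic zero. That the rational
  maps are defined somewhere rests on the transitivity of GL(V) on nonzero vectors.\<close>

lemma vector_space_fscale: "vector_space (fscale :: 'k::field \<Rightarrow> ('x \<Rightarrow> 'k) \<Rightarrow> _)"
  by unfold_locales (auto simp: fscale_def fun_eq_iff algebra_simps)

interpretation fs: vector_space fscale
  by (rule vector_space_fscale)

lemma fscale_apply: "fscale c f x = c * f x"
  by (simp add: fscale_def)

section \<open>Tensor products\<close>

text \<open>Peels off one scaled pure tensor at a time, so that scaling and addition are treated in
  a single step.\<close>

lemma tensor_prod_induct [consumes 1, case_names zero step]:
  assumes "t \<in> tensor_prod n A" and "P (\<lambda>_. 0)"
    and "\<And>c a s. \<forall>i<n. a i \<in> A i \<Longrightarrow> P s \<Longrightarrow> P (\<lambda>x. c * pure_tensor n a x + s x)"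
  shows "P t"
  using assms(1) unfolding tensor_prod_def
proof (induction rule: fs.span_induct_alt)
  case base
  then show ?case using assms(2) by (simp add: zero_fun_def)
next
  case (step c x y)
  then obtain a where "x = pure_tensor n a" "\<forall>i<n. a i \<in> A i" by blast
  then show ?case using assms(3)[of a y c] step by (simp add: plus_fun_def fscale_def)
qed

lemma tensor_prod_zero: "(\<lambda>_. 0) \<in> tensor_prod n A"
  using fs.span_zero unfolding tensor_prod_def zero_fun_def by blast

lemma tensor_prod_step:
  assumes "\<forall>i<n. a i \<in> A i" "s \<in> tensor_prod n A"
  shows "(\<lambda>x. c * pure_tensor n a x + s x) \<in> tensor_prod n A"
proof -
  have "fscale c (pure_tensor n a) + s \<in> tensor_prod n A"
    using assms unfolding tensor_prod_def by (intro fs.span_add fs.span_scale) (auto intro: fs.span_base)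
  then show ?thesis by (simp add: plus_fun_def fscale_def)
qed

lemma tensor_prod_rep:
  assumes "t \<in> tensor_prod n A"
  shows "\<exists>(J::nat) c a. (\<forall>j<J. \<forall>i<n. a j i \<in> A i) \<and> t = (\<lambda>x. \<Sum>j<J. c j * pure_tensor n (a j) x)"
  using assms
proof (induction rule: tensor_prod_induct)
  case zero
  show ?case by (rule exI[of _ 0]) simp
next
  case (step c a s)
  then obtain J :: nat and c' a' where *: "\<forall>j<J. \<forall>i<n. a' j i \<in> A i"
    "s = (\<lambda>x. \<Sum>j<J. c' j * pure_tensor n (a' j) x)" by blast
  show ?case
  proof (intro exI conjI)
    show "\<forall>j<Suc J. \<forall>i<n. (a'(J := a)) j i \<in> A i" using * step by (auto simp: less_Suc_eq)
    show "(\<lambda>x. c * pure_tensor n a x + s x) =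
        (\<lambda>x. \<Sum>j<Suc J. (c'(J := c)) j * pure_tensor n ((a'(J := a)) j) x)"
      by (simp add: * add.commute)
  qed
qed

lemma tensor_prod_mono: "(\<And>i. i < n \<Longrightarrow> A i \<subseteq> B i) \<Longrightarrow> tensor_prod n A \<subseteq> tensor_prod n B"
  unfolding tensor_prod_def by (rule fs.span_mono) blast

text \<open>A pure tensor reads only the entries below \<open>n\<close>. This allows tuples to be
  passed with or without \<open>restrict\<close>.\<close>

lemma tensor_prod_cong:
  assumes "t \<in> tensor_prod n A" "\<And>i. i < n \<Longrightarrow> x i = y i"
  shows "t x = t y"
  using assms(1) by (induction rule: tensor_prod_induct) (auto simp: pure_tensor_def assms(2))

text \<open>In a pure tensor the factors \<open>c i\<close> multiply up, and the resulting identity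
  is linear in \<open>t\<close>. It reduces a claim about \<open>I\<close> or \<open>\<tau>\<close>
  to a claim about a single form in each slot.\<close>

lemma tensor_prod_scale_eval:
  assumes "t \<in> tensor_prod n A" "\<And>i a. i < n \<Longrightarrow> a \<in> A i \<Longrightarrow> a (y i) = c i * a (x i)"
  shows "t y = (\<Prod>i<n. c i) * t x"
  using assms(1)
proof (induction rule: tensor_prod_induct)
  case (step d a s)
  then have "pure_tensor n a y = (\<Prod>i<n. c i) * pure_tensor n a x"
    by (simp add: pure_tensor_def assms(2) flip: prod.distrib)
  then show ?case using step by (simp add: algebra_simps)
qed simp

text \<open>The operation is linear in \<open>t\<close> and maps the pure tensor of the
  \<open>a i\<close> to the pure tensor of the weighted pullbacks of the \<open>a i\<close>.\<close>

lemma tensor_prod_pullback: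
  assumes "t \<in> tensor_prod n A" "\<And>i a. i < n \<Longrightarrow> a \<in> A i \<Longrightarrow> (\<lambda>y. w i y * a (e i y)) \<in> B i"
  shows "(\<lambda>y. (\<Prod>i<n. w i (y i)) * t (\<lambda>i. e i (y i))) \<in> tensor_prod n B"
  using assms(1)
proof (induction rule: tensor_prod_induct)
  case zero
  then show ?case by (simp add: tensor_prod_zero)
next
  case (step c a s)
  have "(\<lambda>y. c * pure_tensor n (\<lambda>i y. w i y * a i (e i y)) y + (\<Prod>i<n. w i (y i)) * s (\<lambda>i. e i (y i)))
      \<in> tensor_prod n B"
    using step assms(2) by (intro tensor_prod_step) auto
  then show ?case by (simp add: pure_tensor_def prod.distrib algebra_simps)
qed

lemma tensor_map_pullback:
  assumes "t \<in> tensor_prod n A" "\<And>i a. i < n \<Longrightarrow> a \<in> A i \<Longrightarrow> f i a = (\<lambda>y. w i y * a (e i y))"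
  shows "tensor_map n A f t = (\<lambda>y. (\<Prod>i<n. w i (y i)) * t (\<lambda>i. e i (y i)))"
proof -
  have *: "(\<lambda>y. \<Sum>j<J. c j * pure_tensor n (\<lambda>i. f i (a j i)) y) =
      (\<lambda>y. (\<Prod>i<n. w i (y i)) * (\<Sum>j<J. c j * pure_tensor n (a j) (\<lambda>i. e i (y i))))"
    if "\<forall>j<J. \<forall>i<n. a j i \<in> A i" for J :: nat and c a
  proof
    fix y
    have "pure_tensor n (\<lambda>i. f i (a j i)) y =
        (\<Prod>i<n. w i (y i)) * pure_tensor n (a j) (\<lambda>i. e i (y i))" if "j < J" for j
      using \<open>\<forall>j<J. \<forall>i<n. a j i \<in> A i\<close> that assms(2) by (simp add: pure_tensor_def prod.distrib)
    then show "(\<Sum>j<J. c j * pure_tensor n (\<lambda>i. f i (a j i)) y) =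
      (\<Prod>i<n. w i (y i)) * (\<Sum>j<J. c j * pure_tensor n (a j) (\<lambda>i. e i (y i)))"
      by (simp add: sum_distrib_left mult_ac)
  qed
  obtain J c a where J: "\<forall>j<(J::nat). \<forall>i<n. a j i \<in> A i"
    "t = (\<lambda>x. \<Sum>j<J. c j * pure_tensor n (a j) x)"
    using tensor_prod_rep[OF assms(1)] by blast
  show ?thesis unfolding tensor_map_def
  proof (rule the_equality, goal_cases)
    case 1
    show ?case using J *[of J a c] by (intro exI[of _ J] exI[of _ c] exI[of _ a]) simp
  next
    case (2 r)
    then show ?case using * by force
  qed
qed

text \<open>Freezing all slots but \<open>i\<close> turns a pure tensor into a multiple of its
  \<open>i\<close>-th factor, and a subspace contains sums of these. Properties of the factors
  thereby pass to arbitrary tensors, one slot at a time.\<close>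

lemma tensor_prod_slot:
  assumes "t \<in> tensor_prod n A" "i < n" "fs.subspace (A i)"
  shows "(\<lambda>w. t (x(i := w))) \<in> A i"
  using assms(1)
proof (induction rule: tensor_prod_induct)
  case zero
  then show ?case using fs.subspace_0[OF assms(3)] by (simp add: zero_fun_def)
next
  case (step c a s)
  define d where "d = c * (\<Prod>j\<in>{..<n}-{i}. a j (x j))"
  have "c * pure_tensor n a (x(i := w)) = d * a i w" for w
  proof -
    have "pure_tensor n a (x(i := w)) = a i w * (\<Prod>j\<in>{..<n}-{i}. a j ((x(i := w)) j))"
      unfolding pure_tensor_def using assms(2) by (subst prod.remove[of _ i]) auto
    also have "(\<Prod>j\<in>{..<n}-{i}. a j ((x(i := w)) j)) = (\<Prod>j\<in>{..<n}-{i}. a j (x j))"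
      by (intro prod.cong) auto
    finally show ?thesis unfolding d_def by (metis mult.assoc mult.commute)
  qed
  then have "(\<lambda>w. c * pure_tensor n a (x(i := w)) + s (x(i := w))) = fscale d (a i) + (\<lambda>w. s (x(i := w)))"
    unfolding plus_fun_def fscale_def by presburger
  moreover have "fscale d (a i) \<in> A i"
    using step(1) assms by (intro fs.subspace_scale) auto
  then have "fscale d (a i) + (\<lambda>w. s (x(i := w))) \<in> A i"
    by (rule fs.subspace_add[OF assms(3) _ step(2)])
  ultimately show ?case by (simp only:)
qed

section \<open>Regular functions\<close>

lemma regular_on_const: "(\<lambda>_. c) \<in> regular_on X G"
  unfolding regular_on_def by (auto intro: generated_algebra.const)

lemma regular_on_gen: "f \<in> G \<Longrightarrow> f \<in> regular_on X G"
  unfolding regular_on_def by (auto intro: generated_algebra.gen)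

lemma regular_on_add:
  assumes "f \<in> regular_on X G" "g \<in> regular_on X G"
  shows "(\<lambda>x. f x + g x) \<in> regular_on X G"
  using assms unfolding regular_on_def by (fastforce intro: generated_algebra.add)

lemma regular_on_mult:
  assumes "f \<in> regular_on X G" "g \<in> regular_on X G"
  shows "(\<lambda>x. f x * g x) \<in> regular_on X G"
  using assms unfolding regular_on_def by (fastforce intro: generated_algebra.mult)

lemma regular_on_sum:
  "(\<And>i. i \<in> S \<Longrightarrow> f i \<in> regular_on X G) \<Longrightarrow> (\<lambda>x. \<Sum>i\<in>S. f i x) \<in> regular_on X G"
  by (induction S rule: infinite_finite_induct) (auto intro: regular_on_const regular_on_add)

lemma regular_on_prod:
  "(\<And>i. i \<in> S \<Longrightarrow> f i \<in> regular_on X G) \<Longrightarrow> (\<lambda>x. \<Prod>i\<in>S. f i x) \<in> regular_on X G"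
  by (induction S rule: infinite_finite_induct) (auto intro: regular_on_const regular_on_mult)

lemma regular_on_cong:
  "f \<in> regular_on X G \<Longrightarrow> (\<And>x. x \<in> X \<Longrightarrow> f x = g x) \<Longrightarrow> g \<in> regular_on X G"
  unfolding regular_on_def by auto

text \<open>Composition with \<open>e\<close> respects sums and products, so only generators have to
  be checked. The map \<open>e\<close> must land in \<open>X\<close> because \<open>f\<close> agrees
  with its representative only there.\<close>

lemma regular_on_pullback:
  assumes "f \<in> regular_on X G" "\<And>y. y \<in> Y \<Longrightarrow> e y \<in> X"
    "\<And>g. g \<in> G \<Longrightarrow> (\<lambda>y. g (e y)) \<in> regular_on Y G'"
  shows "(\<lambda>y. f (e y)) \<in> regular_on Y G'"
proof -
  obtain q where q: "q \<in> generated_algebra G" "\<forall>x\<in>X. f x = q x"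
    using assms(1) unfolding regular_on_def by auto
  from q(1) have "(\<lambda>y. q (e y)) \<in> regular_on Y G'"
    by induction (auto intro: regular_on_const regular_on_add regular_on_mult assms)
  then show ?thesis by (rule regular_on_cong) (use q assms in auto)
qed

lemma tensor_prod_regular:
  assumes "t \<in> tensor_prod n A"
    and "\<And>i a. i < n \<Longrightarrow> a \<in> A i \<Longrightarrow> (\<lambda>z. a (e i z)) \<in> regular_on X G"
  shows "(\<lambda>z. t (\<lambda>i. e i z)) \<in> regular_on X G"
  using assms(1)
proof (induction rule: tensor_prod_induct)
  case (step c a s)
  then show ?case unfolding pure_tensor_def
    by (intro regular_on_add regular_on_mult regular_on_const regular_on_prod assms(2)) auto
qed (simp add: regular_on_const)

section \<open>Alternating forms\<close>

lemma alt_forms_outside: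
  "w \<in> alt_forms E p \<Longrightarrow> \<not> (length xs = p \<and> set xs \<subseteq> vcarrier E) \<Longrightarrow> w xs = 0"
  unfolding alt_forms_def by auto

lemma alt_forms_add:
  "w \<in> alt_forms E p \<Longrightarrow> length xs = p \<Longrightarrow> set xs \<subseteq> vcarrier E \<Longrightarrow> i < p \<Longrightarrow>
   x \<in> vcarrier E \<Longrightarrow> y \<in> vcarrier E \<Longrightarrow> w (xs[i := vadd E x y]) = w (xs[i := x]) + w (xs[i := y])"
  unfolding alt_forms_def by auto

lemma alt_forms_smul:
  "w \<in> alt_forms E p \<Longrightarrow> length xs = p \<Longrightarrow> set xs \<subseteq> vcarrier E \<Longrightarrow> i < p \<Longrightarrow>
   x \<in> vcarrier E \<Longrightarrow> w (xs[i := vsmul E c x]) = c * w (xs[i := x])"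
  unfolding alt_forms_def by auto

lemma alt_forms_alt:
  assumes "w \<in> alt_forms E p" "length xs = p" "i < p" "j < p" "i \<noteq> j" "xs ! i = xs ! j"
  shows "w xs = 0"
  using assms unfolding alt_forms_def by (cases "set xs \<subseteq> vcarrier E") auto

lemma alt_formsI:
  assumes "\<And>xs. \<not> (length xs = p \<and> set xs \<subseteq> vcarrier E) \<Longrightarrow> w xs = 0"
    and "\<And>xs i x y. length xs = p \<Longrightarrow> set xs \<subseteq> vcarrier E \<Longrightarrow> i < p \<Longrightarrow> x \<in> vcarrier E \<Longrightarrow>
      y \<in> vcarrier E \<Longrightarrow> w (xs[i := vadd E x y]) = w (xs[i := x]) + w (xs[i := y])"
    and "\<And>xs i x c. length xs = p \<Longrightarrow> set xs \<subseteq> vcarrier E \<Longrightarrow> i < p \<Longrightarrow> x \<in> vcarrier E \<Longrightarrow>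
      w (xs[i := vsmul E c x]) = c * w (xs[i := x])"
    and "\<And>xs i j. length xs = p \<Longrightarrow> set xs \<subseteq> vcarrier E \<Longrightarrow> i < p \<Longrightarrow> j < p \<Longrightarrow> i \<noteq> j \<Longrightarrow>
      xs ! i = xs ! j \<Longrightarrow> w xs = 0"
  shows "w \<in> alt_forms E p"
  using assms unfolding alt_forms_def by blast

lemma subspace_alt_forms: "fs.subspace (alt_forms E p)"
proof (rule fs.subspaceI)
  show "0 \<in> alt_forms E p" by (rule alt_formsI) auto
next
  fix v w assume *: "v \<in> alt_forms E p" "w \<in> alt_forms E p"
  show "v + w \<in> alt_forms E p"
    by (rule alt_formsI) (simp_all add: alt_forms_outside[OF *(1)] alt_forms_outside[OF *(2)]
        alt_forms_add[OF *(1)] alt_forms_add[OF *(2)] alt_forms_smul[OF *(1)] alt_forms_smul[OF *(2)]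
        alt_forms_alt[OF *(1)] alt_forms_alt[OF *(2)] algebra_simps)
next
  fix c w assume *: "w \<in> alt_forms E p"
  show "fscale c w \<in> alt_forms E p"
    by (rule alt_formsI) (simp_all add: alt_forms_outside[OF *] alt_forms_add[OF *]
        alt_forms_smul[OF *] alt_forms_alt[OF *] fscale_def algebra_simps)
qed

text \<open>Pullback along a map that is linear on the carrier. The cut-off restores the
  normalisation to 0, and closure of the carrier keeps updated lists inside it.\<close>

lemma alt_forms_pullback:
  assumes "w \<in> alt_forms E' p"
    and "\<And>x. x \<in> vcarrier E \<Longrightarrow> f x \<in> vcarrier E'"
    and "\<And>x y. x \<in> vcarrier E \<Longrightarrow> y \<in> vcarrier E \<Longrightarrow> vadd E x y \<in> vcarrier E \<and> f (vadd E x y) = vadd E' (f x) (f y)"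
    and "\<And>c x. x \<in> vcarrier E \<Longrightarrow> vsmul E c x \<in> vcarrier E \<and> f (vsmul E c x) = vsmul E' c (f x)"
  shows "(\<lambda>xs. if length xs = p \<and> set xs \<subseteq> vcarrier E then w (map f xs) else 0) \<in> alt_forms E p"
proof (rule alt_formsI, goal_cases)
  case (2 xs i x y)
  then have "set (xs[i := z]) \<subseteq> vcarrier E" if "z \<in> {x, y, vadd E x y}" for z
    using that assms(3)[of x y] by (intro set_update_subsetI) auto
  moreover have "set (map f xs) \<subseteq> vcarrier E'" using 2 assms(2) by auto
  ultimately show ?case
    using 2 assms(2) assms(3)[of x y] alt_forms_add[OF assms(1), of "map f xs" i "f x" "f y"]
    by (simp add: map_update)
next
  case (3 xs i x c)
  then have "set (xs[i := z]) \<subseteq> vcarrier E" if "z \<in> {x, vsmul E c x}" for z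
    using that assms(4)[of x c] by (intro set_update_subsetI) auto
  moreover have "set (map f xs) \<subseteq> vcarrier E'" using 3 assms(2) by auto
  ultimately show ?case
    using 3 assms(2) assms(4)[of x c] alt_forms_smul[OF assms(1), of "map f xs" i "f x" c]
    by (simp add: map_update)
next
  case (4 xs i j)
  then show ?case using assms(1) alt_forms_alt[of w E' p "map f xs" i j] by simp
qed auto

text \<open>Slot \<open>i\<close> of the contracted form is slot \<open>Suc i\<close> of
  \<open>w\<close>.\<close>

lemma alt_forms_contract:
  assumes "w \<in> alt_forms E (Suc p)" "v \<in> vcarrier E"
  shows "(\<lambda>xs. w (v # xs)) \<in> alt_forms E p"
proof (rule alt_formsI, goal_cases)
  case (1 xs)
  then show ?case using assms by (intro alt_forms_outside[OF assms(1)]) auto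
next
  case (2 xs i x y)
  then show ?case using alt_forms_add[OF assms(1), of "v # xs" "Suc i" x y] assms(2) by auto
next
  case (3 xs i x c)
  then show ?case using alt_forms_smul[OF assms(1), of "v # xs" "Suc i" x c] assms(2) by auto
next
  case (4 xs i j)
  then show ?case using alt_forms_alt[OF assms(1), of "v # xs" "Suc i" "Suc j"] by auto
qed

section \<open>Linear forms and coordinates on a pointed finite-dimensional space\<close>

locale pointed_space = finite_dimensional_vector_space scale Basis
  for scale :: "'k::field_char_0 \<Rightarrow> 'v::ab_group_add \<Rightarrow> 'v" and Basis :: "'v set" +
  fixes v0 :: 'v
  assumes v0_nonzero: "v0 \<noteq> 0"
begin

lemma dual_space_iff:
  "l \<in> dual_space scale \<longleftrightarrow> (\<forall>x y. l (x + y) = l x + l y) \<and> (\<forall>c x. l (scale c x) = c * l x)"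
proof -
  have "vector_space ((*) :: 'k \<Rightarrow> 'k \<Rightarrow> 'k)"
    by unfold_locales (auto simp: algebra_simps)
  then show ?thesis
    using vector_space_axioms by (auto simp: dual_space_def Vector_Spaces.linear_iff)
qed

lemma dual_add: "l \<in> dual_space scale \<Longrightarrow> l (x + y) = l x + l y"
  and dual_scale: "l \<in> dual_space scale \<Longrightarrow> l (scale c x) = c * l x"
  by (auto simp: dual_space_iff)

lemma dual_zero: "l \<in> dual_space scale \<Longrightarrow> l 0 = 0"
  using dual_scale[of l 0 0] by simp

lemma dual_diff: "l \<in> dual_space scale \<Longrightarrow> l (x - y) = l x - l y"
  using dual_add[of l "x - y" y] by simp

lemma coordinates:
  obtains co where "\<And>b. co b \<in> dual_space scale" "\<And>x. x = (\<Sum>b\<in>Basis. scale (co b x) b)"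
proof
  show "(\<lambda>v. representation Basis v b) \<in> dual_space scale" for b
    unfolding dual_space_def using linear_representation[OF independent_Basis span_Basis] by simp
  show "x = (\<Sum>b\<in>Basis. scale (representation Basis x b) b)" for x
    using sum_representation_eq[OF independent_Basis _ finite_Basis subset_refl] span_Basis by simp
qed

text \<open>Some coordinate of a nonzero vector is nonzero; dividing by its value normalises
  it.\<close>

lemma exists_form:
  assumes "v \<noteq> 0"
  obtains l where "l \<in> dual_space scale" "l v = 1"
proof -
  obtain co where co: "\<And>b. co b \<in> dual_space scale" "\<And>x. x = (\<Sum>b\<in>Basis. scale (co b x) b)"
    using coordinates by blast
  obtain b where b: "co b v \<noteq> 0"
    using assms co(2)[of v] by (metis (no_types, lifting) scale_zero_left sum.neutral)
  have "(\<lambda>x. co b x / co b v) \<in> dual_space scale"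
    using co(1)[of b] by (auto simp: dual_space_iff add_divide_distrib)
  then show ?thesis using that[of "\<lambda>x. co b x / co b v"] b by simp
qed

section \<open>The general linear group\<close>

lemma GL_add: "g \<in> GL scale \<Longrightarrow> g (x + y) = g x + g y"
  and GL_scale: "g \<in> GL scale \<Longrightarrow> g (scale c x) = scale c (g x)"
  and GL_bij: "g \<in> GL scale \<Longrightarrow> bij g"
  unfolding GL_def by (auto simp: Vector_Spaces.linear_iff)

lemma GL_I:
  "(\<And>x y. g (x + y) = g x + g y) \<Longrightarrow> (\<And>c x. g (scale c x) = scale c (g x)) \<Longrightarrow> bij g \<Longrightarrow> g \<in> GL scale"
  using vector_space_axioms unfolding GL_def by (auto simp: Vector_Spaces.linear_iff)

lemma GL_inv1: "g \<in> GL scale \<Longrightarrow> g (inv g x) = x"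
  and GL_inv2: "g \<in> GL scale \<Longrightarrow> inv g (g x) = x"
  and GL_inv_inv: "g \<in> GL scale \<Longrightarrow> inv (inv g) = g"
  by (auto dest!: GL_bij simp: bij_is_surj surj_f_inv_f bij_is_inj inv_inv_eq)

lemma GL_inv: "g \<in> GL scale \<Longrightarrow> inv g \<in> GL scale"
  by (rule GL_I) (metis GL_add GL_scale GL_inv1 GL_inv2 GL_bij bij_imp_bij_inv)+

lemma GL_comp: "g \<in> GL scale \<Longrightarrow> h \<in> GL scale \<Longrightarrow> g \<circ> h \<in> GL scale"
  by (rule GL_I) (auto simp: GL_add GL_scale GL_bij bij_comp)

lemma GL_id: "id \<in> GL scale"
  by (rule GL_I) auto

lemma GL_zero: "g \<in> GL scale \<Longrightarrow> g 0 = 0"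
  using GL_scale[of g 0 0] by simp

lemma GL_diff: "g \<in> GL scale \<Longrightarrow> g (x - y) = g x - g y"
  using GL_add[of g "x - y" y] by simp

lemma GL_eq_zero_iff: "g \<in> GL scale \<Longrightarrow> g x = 0 \<longleftrightarrow> x = 0"
  by (metis GL_zero GL_inv2)

text \<open>An equivalence, so that the cut-off of a function on GL(V) is the same before and after
  translation, also at arguments outside the group.\<close>

lemma inv_comp_GL_iff:
  assumes "a \<in> GL scale"
  shows "inv a \<circ> g \<in> GL scale \<longleftrightarrow> g \<in> GL scale"
proof -
  have "g = a \<circ> (inv a \<circ> g)" using assms by (auto simp: fun_eq_iff GL_inv1)
  then show ?thesis using GL_comp[OF assms] GL_comp[OF GL_inv[OF assms]] by metis
qed

lemma dual_comp_GL_iff: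
  assumes "g \<in> GL scale"
  shows "l \<circ> g \<in> dual_space scale \<longleftrightarrow> l \<in> dual_space scale"
proof
  assume *: "l \<circ> g \<in> dual_space scale"
  have "l (x + y) = l x + l y" for x y
    using dual_add[OF *, of "inv g x" "inv g y"] assms by (simp add: GL_add GL_inv1)
  moreover have "l (scale c x) = c * l x" for c x
    using dual_scale[OF *, of c "inv g x"] assms by (simp add: GL_scale GL_inv1)
  ultimately show "l \<in> dual_space scale" by (simp add: dual_space_iff)
qed (use assms in \<open>auto simp: dual_space_iff GL_add GL_scale\<close>)

text \<open>A single transvection-like map \<open>x \<mapsto> x + l x \<cdot> (w - v)\<close> with \<open>l v = 1\<close> is invertible
  as soon as \<open>l w \<noteq> 0\<close>, so no extension to bases is needed.\<close>

lemma GL_transitive: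
  assumes "v \<noteq> 0" "w \<noteq> 0"
  obtains g where "g \<in> GL scale" "g v = w"
proof -
  obtain l1 where l1: "l1 \<in> dual_space scale" "l1 v = 1" using exists_form[OF assms(1)] .
  obtain l2 where l2: "l2 \<in> dual_space scale" "l2 w = 1" using exists_form[OF assms(2)] .
  \<comment> \<open>The aim is one form that is nonzero at both vectors. If \<open>l1\<close> and
    \<open>l2\<close> each vanish at the other vector, their sum is 1 at both; otherwise one of them
    already works.\<close>
  obtain l where l: "l \<in> dual_space scale" "l v \<noteq> 0" "l w \<noteq> 0"
  proof (cases "l1 w = 0 \<and> l2 v = 0")
    case True
    have "(\<lambda>x. l1 x + l2 x) \<in> dual_space scale"
      using l1 l2 by (auto simp: dual_space_iff algebra_simps)
    then show ?thesis using that[of "\<lambda>x. l1 x + l2 x"] True l1 l2 by simp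
  next
    case False
    then show ?thesis using that l1 l2 by (metis zero_neq_one)
  qed
  define m where "m x = l x / l v" for x
  have m: "m (x + y) = m x + m y" "m (scale c x) = c * m x" "m (x - y) = m x - m y" for x y c
    using l by (auto simp: m_def dual_add dual_scale dual_diff add_divide_distrib diff_divide_distrib)
  have mv: "m v = 1" "m w \<noteq> 0" using l by (auto simp: m_def)
  define g where "g x = x + scale (m x) (w - v)" for x
  define g' where "g' x = x - scale (m x / m w) (w - v)" for x
  \<comment> \<open>The map \<open>g\<close> multiplies \<open>m\<close> by \<open>m w\<close>, so
    its inverse has to divide by \<open>m w\<close>.\<close>
  have mg: "m (g x) = m x * m w" "m (g' x) = m x / m w" for x
    using mv by (auto simp: g_def g'_def m field_simps)
  have "bij g"
  proof (rule o_bij)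
    show "g' \<circ> g = id" using mv by (auto simp: fun_eq_iff g'_def mg) (simp add: g_def)
    show "g \<circ> g' = id" using mv by (auto simp: fun_eq_iff g_def mg) (simp add: g'_def)
  qed
  then have "g \<in> GL scale"
    by (intro GL_I) (auto simp: g_def m scale_left_distrib scale_right_distrib)
  moreover have "g v = w" by (simp add: g_def mv)
  ultimately show ?thesis by (rule that)
qed

section \<open>The line, the quotient and the stabilizer\<close>

lemma line_iff: "x \<in> line scale v \<longleftrightarrow> (\<exists>c. x = scale c v)"
  by (auto simp: span_singleton)

lemma coset_eq_iff: "coset scale v0 x = coset scale v0 y \<longleftrightarrow> x - y \<in> line scale v0"
proof
  assume "coset scale v0 x = coset scale v0 y"
  moreover have "x \<in> coset scale v0 x" unfolding coset_def using span_zero by force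
  ultimately show "x - y \<in> line scale v0" by (auto simp: coset_def)
next
  assume *: "x - y \<in> line scale v0"
  have "coset scale v0 x \<subseteq> coset scale v0 y" if "x - y \<in> line scale v0" for x y
  proof
    fix z assume "z \<in> coset scale v0 x"
    then obtain s where "z = y + (s + (x - y))" "s \<in> line scale v0" by (auto simp: coset_def)
    then show "z \<in> coset scale v0 y" unfolding coset_def using that span_add by blast
  qed
  moreover have "y - x \<in> line scale v0" using span_neg[OF *] by simp
  ultimately show "coset scale v0 x = coset scale v0 y" using * by blast
qed

lemma vcarrier_quot: "vcarrier (quot_space scale v0) = range (coset scale v0)"
  by (simp add: quot_space_def)

lemma coset_in_quot: "coset scale v0 y \<in> vcarrier (quot_space scale v0)"
  by (simp add: vcarrier_quot)

lemma vadd_quot: "vadd (quot_space scale v0) (coset scale v0 x) (coset scale v0 y) = coset scale v0 (x + y)"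
proof -
  have "{a + b |a b. a \<in> coset scale v0 x \<and> b \<in> coset scale v0 y} = coset scale v0 (x + y)"
  proof (rule set_eqI, rule iffI)
    fix z assume "z \<in> {a + b |a b. a \<in> coset scale v0 x \<and> b \<in> coset scale v0 y}"
    then obtain s t where "z = (x + y) + (s + t)" "s \<in> line scale v0" "t \<in> line scale v0"
      unfolding coset_def by (auto simp: algebra_simps)
    then show "z \<in> coset scale v0 (x + y)" unfolding coset_def using span_add by blast
  next
    fix z assume "z \<in> coset scale v0 (x + y)"
    then obtain s where "z = x + (y + s)" "s \<in> line scale v0"
      unfolding coset_def by (auto simp: algebra_simps)
    moreover have "x \<in> coset scale v0 x" unfolding coset_def using span_zero by force
    ultimately show "z \<in> {a + b |a b. a \<in> coset scale v0 x \<and> b \<in> coset scale v0 y}"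
      unfolding coset_def by blast
  qed
  then show ?thesis by (simp add: quot_space_def)
qed

lemma vsmul_quot: "vsmul (quot_space scale v0) c (coset scale v0 x) = coset scale v0 (scale c x)"
proof -
  have "{scale c a + s |a s. a \<in> coset scale v0 x \<and> s \<in> line scale v0} = coset scale v0 (scale c x)"
  proof (rule set_eqI, rule iffI)
    fix z assume "z \<in> {scale c a + s |a s. a \<in> coset scale v0 x \<and> s \<in> line scale v0}"
    then obtain s t where "z = scale c x + (scale c s + t)" "s \<in> line scale v0" "t \<in> line scale v0"
      unfolding coset_def by (auto simp: algebra_simps)
    then show "z \<in> coset scale v0 (scale c x)" unfolding coset_def using span_add span_scale by blast
  next
    fix z assume "z \<in> coset scale v0 (scale c x)"
    moreover have "x \<in> coset scale v0 x" unfolding coset_def using span_zero by force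
    ultimately show "z \<in> {scale c a + s |a s. a \<in> coset scale v0 x \<and> s \<in> line scale v0}"
      unfolding coset_def by blast
  qed
  then show ?thesis by (simp add: quot_space_def)
qed

text \<open>The choice made inside \<open>psi\<close>, named so that independence of it can be
  stated.\<close>

definition coset_rep :: "'v set \<Rightarrow> 'v" where "coset_rep Y = (SOME y. y \<in> Y)"

lemma coset_of_rep: "Y \<in> vcarrier (quot_space scale v0) \<Longrightarrow> coset scale v0 (coset_rep Y) = Y"
proof -
  assume "Y \<in> vcarrier (quot_space scale v0)"
  then obtain y where y: "Y = coset scale v0 y" by (auto simp: vcarrier_quot)
  then have "y \<in> Y" unfolding coset_def using span_zero by force
  then have "coset_rep Y \<in> Y" unfolding coset_rep_def by (rule someI)
  then show ?thesis using y by (auto simp: coset_eq_iff) (auto simp: coset_def)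
qed

lemma stab_GL: "h \<in> stab scale v0 \<Longrightarrow> h \<in> GL scale"
  by (simp add: stab_def)

lemma stab_v0:
  assumes "h \<in> stab scale v0"
  obtains a where "h v0 = scale a v0" "a \<noteq> 0"
proof -
  have "h v0 \<in> line scale v0" using assms span_base[of v0 "{v0}"] by (auto simp: stab_def)
  then show ?thesis using that v0_nonzero assms GL_eq_zero_iff[OF stab_GL]
    by (metis line_iff scale_zero_left)
qed

lemma stab_line_iff:
  assumes "h \<in> stab scale v0"
  shows "h x \<in> line scale v0 \<longleftrightarrow> x \<in> line scale v0"
proof -
  have "h ` line scale v0 = line scale v0" using assms by (simp add: stab_def)
  then show ?thesis using inj_image_mem_iff[OF bij_is_inj[OF GL_bij[OF stab_GL[OF assms]]], of x "line scale v0"]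
    by simp
qed

lemma stab_coset:
  assumes "h \<in> stab scale v0"
  shows "h ` coset scale v0 y = coset scale v0 (h y)"
proof -
  have "h ` coset scale v0 y = (\<lambda>s. h y + s) ` h ` line scale v0"
    unfolding coset_def using GL_add[OF stab_GL[OF assms]] by (fastforce simp: image_iff)
  also have "h ` line scale v0 = line scale v0" using assms by (simp add: stab_def)
  finally show ?thesis by (auto simp: coset_def)
qed

lemma stab_inv:
  assumes "h \<in> stab scale v0"
  shows "inv h \<in> stab scale v0"
proof -
  have "inv h ` line scale v0 = inv h ` h ` line scale v0" using assms by (simp add: stab_def)
  then show ?thesis using assms GL_inv GL_inv2[OF stab_GL[OF assms]] by (auto simp: stab_def image_comp)
qed

text \<open>Both directions matter: \<open>psi\<close> is 0 when some argument is not a coset, and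
  its equivariance must hold there too.\<close>

lemma stab_image_quot_iff:
  assumes "h \<in> stab scale v0"
  shows "h ` Y \<in> vcarrier (quot_space scale v0) \<longleftrightarrow> Y \<in> vcarrier (quot_space scale v0)"
proof
  assume "h ` Y \<in> vcarrier (quot_space scale v0)"
  then obtain y where "h ` Y = coset scale v0 y" by (auto simp: vcarrier_quot)
  then have "inv h ` h ` Y = coset scale v0 (inv h y)" using stab_coset[OF stab_inv[OF assms]] by simp
  moreover have "inv h ` h ` Y = Y" using GL_inv2[OF stab_GL[OF assms]] by (auto simp: image_comp)
  ultimately show "Y \<in> vcarrier (quot_space scale v0)" by (simp add: coset_in_quot)
qed (auto simp: vcarrier_quot stab_coset[OF assms])

section \<open>Alternating forms on the ambient space\<close>

lemma full_add: "w \<in> alt_forms (full_space scale) p \<Longrightarrow> i < p \<Longrightarrow> length xs = p \<Longrightarrow>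
    w (xs[i := x + y]) = w (xs[i := x]) + w (xs[i := y])"
  using alt_forms_add[of w "full_space scale" p xs i x y] by simp

lemma full_scale: "w \<in> alt_forms (full_space scale) p \<Longrightarrow> i < p \<Longrightarrow> length xs = p \<Longrightarrow>
    w (xs[i := scale c x]) = c * w (xs[i := x])"
  using alt_forms_smul[of w "full_space scale" p xs i x c] by simp

lemma full_zero: "w \<in> alt_forms (full_space scale) p \<Longrightarrow> i < p \<Longrightarrow> length xs = p \<Longrightarrow> w (xs[i := 0]) = 0"
  using full_scale[of w p i xs 0 0] by simp

lemma full_sum: "w \<in> alt_forms (full_space scale) p \<Longrightarrow> i < p \<Longrightarrow> length xs = p \<Longrightarrow>
    w (xs[i := (\<Sum>b\<in>S. scale (c b) (e b))]) = (\<Sum>b\<in>S. c b * w (xs[i := e b]))"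
  by (induction S rule: infinite_finite_induct) (auto simp: full_zero full_add full_scale)

text \<open>Expanding the first varying vector in the basis gives a sum of coordinates times values
  of \<open>w\<close> with a basis vector in that slot. The list \<open>ps\<close> collects the
  slots that have already become constant.\<close>

lemma alt_full_regular:
  assumes "w \<in> alt_forms (full_space scale) p"
    and "\<And>f l. f \<in> set fs \<Longrightarrow> l \<in> dual_space scale \<Longrightarrow> (\<lambda>z. l (f z)) \<in> regular_on X G"
  shows "length ps + length fs = p \<Longrightarrow> (\<lambda>z. w (ps @ map (\<lambda>f. f z) fs)) \<in> regular_on X G"
  using assms(2)
proof (induction fs arbitrary: ps)
  case Nil
  then show ?case by (simp add: regular_on_const)
next
  case (Cons f fs)
  obtain co where co: "\<And>b. co b \<in> dual_space scale" "\<And>x. x = (\<Sum>b\<in>Basis. scale (co b x) b)"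
    using coordinates by blast
  have "w (ps @ map (\<lambda>f. f z) (f # fs)) =
      (\<Sum>b\<in>Basis. co b (f z) * w ((ps @ [b]) @ map (\<lambda>f. f z) fs))" for z
    using full_sum[OF assms(1), of "length ps" "ps @ map (\<lambda>f. f z) (f # fs)" "\<lambda>b. co b (f z)" "\<lambda>b. b" Basis]
      Cons.prems(1) by (simp flip: co(2))
  moreover have "(\<lambda>z. w ((ps @ [b]) @ map (\<lambda>f. f z) fs)) \<in> regular_on X G" for b
    using Cons.prems by (intro Cons.IH) auto
  then have "(\<lambda>z. \<Sum>b\<in>Basis. co b (f z) * w ((ps @ [b]) @ map (\<lambda>f. f z) fs)) \<in> regular_on X G"
    by (intro regular_on_sum regular_on_mult Cons.prems co) auto
  ultimately show ?case by simp
qed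

text \<open>Scalars come out one slot at a time. With \<open>a\<close> the scalar on the line and
  \<open>b\<close> the one on the quotient, this is the scalar on L tensored with the
  \<open>p\<close>-th exterior power of W, up to dualisation.\<close>

lemma alt_cons_scale:
  assumes "w \<in> alt_forms (full_space scale) (Suc p)" "length ys = p"
  shows "w (scale a s # map (scale b) ys) = a * b ^ p * w (s # ys)"
proof -
  have *: "w (ps @ map (scale b) zs) = b ^ length zs * w (ps @ zs)" if "length ps + length zs = Suc p" for ps zs
    using that
  proof (induction zs arbitrary: ps)
    case (Cons z zs)
    have "w (ps @ map (scale b) (z # zs)) = w ((ps @ [scale b z]) @ map (scale b) zs)" by simp
    also have "\<dots> = b ^ length zs * w ((ps @ z # zs)[length ps := scale b z])"
      using Cons.prems by (subst Cons.IH) auto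
    also have "\<dots> = b ^ length zs * (b * w (ps @ z # zs))"
      using Cons.prems by (subst full_scale[OF assms(1)]) auto
    finally show ?case by simp
  qed simp
  show ?thesis
    using *[of "[scale a s]" ys] full_scale[OF assms(1), of 0 "s # ys" a s] assms(2) by simp
qed

text \<open>Adding a multiple of \<open>s\<close> in a later slot contributes a term with
  \<open>s\<close> in two slots, which vanishes. This accounts both for coset representatives and
  for the correction term of \<open>chart_dtrans\<close>.\<close>

lemma alt_cons_shift:
  assumes "w \<in> alt_forms (full_space scale) (Suc p)" "length ys = p"
    and "list_all2 (\<lambda>y z. z - y \<in> line scale s) ys zs"
  shows "w (s # zs) = w (s # ys)"
proof -
  have "w (s # ps @ zs) = w (s # ps @ ys)" if "length ps + length ys = p" for ps
    using assms(3) that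
  proof (induction arbitrary: ps rule: list_all2_induct)
    case (Cons y ys z zs)
    then obtain c where c: "z = y + scale c s"
      by (metis add_diff_cancel_left' diff_add_cancel add.commute line_iff)
    have len: "length (s # ps @ y # zs) = Suc p" using Cons by (simp add: list_all2_lengthD)
    have "w (s # ps @ z # zs) = w ((s # ps @ y # zs)[Suc (length ps) := y + scale c s])"
      by (simp add: c)
    also have "\<dots> = w (s # ps @ y # zs) + c * w (s # ps @ s # zs)"
      using len by (subst full_add[OF assms(1)], simp, simp, subst full_scale[OF assms(1)]) simp_all
    also have "w (s # ps @ s # zs) = 0"
      using len by (intro alt_forms_alt[OF assms(1), of _ 0 "Suc (length ps)"]) auto
    also have "w (s # ps @ y # zs) = w (s # (ps @ [y]) @ zs)" by simp
    also have "\<dots> = w (s # (ps @ [y]) @ ys)" using Cons.prems by (intro Cons.IH) auto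
    finally show ?case by simp
  qed simp
  from this[of "[]"] show ?thesis using assms(2) by simp
qed

end

section \<open>The map psi on a single exterior power: values, regularity, equivariance\<close>

context pointed_space
begin

lemma map_coset_of_rep:
  "set ys \<subseteq> vcarrier (quot_space scale v0) \<Longrightarrow> map (coset scale v0) (map coset_rep ys) = ys"
  by (induction ys) (auto simp: coset_of_rep)

lemma psi_eq: "psi scale v0 p w (g, s, ys) =
    (if g \<in> GL scale \<and> s \<in> line scale v0 \<and> length ys = p \<and> set ys \<subseteq> vcarrier (quot_space scale v0)
     then w (map g (s # map coset_rep ys)) else 0)"
  unfolding psi_def coset_rep_def[abs_def] by simp

lemma alt_coset_cong:
  assumes "w \<in> alt_forms (full_space scale) (Suc p)" "g \<in> GL scale" "s \<in> line scale v0"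
    and "length ys = p" "map (coset scale v0) ys = map (coset scale v0) zs"
  shows "w (map g (s # zs)) = w (map g (s # ys))"
\<comment> \<open>For \<open>s = 0\<close> the line of \<open>g s\<close> is zero and cannot absorb
  a change of representative, but then both sides vanish by linearity in the first slot. For
  \<open>s = scale c v0\<close> with \<open>c \<noteq> 0\<close>, multiples of \<open>g v0\<close>
  are multiples of \<open>g s\<close>.\<close>
proof (cases "s = 0")
  case True
  have "w (0 # us) = 0" if "length us = p" for us
    using full_zero[OF assms(1), of 0 "0 # us"] that by simp
  moreover have "length zs = p" using assms(4) arg_cong[OF assms(5), of length] by simp
  ultimately show ?thesis using True assms(2,4) by (simp add: GL_zero)
next
  case False
  then obtain c where c: "s = scale c v0" "c \<noteq> 0" using assms(3) by (auto simp: line_iff)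
  have "g z - g y \<in> line scale (g s)" if "coset scale v0 y = coset scale v0 z" for y z
  proof -
    have "z - y \<in> line scale v0" using coset_eq_iff[of z y] that by simp
    then obtain d where "z - y = scale d v0" unfolding line_iff by blast
    then have "g z - g y = scale d (g v0)" using assms(2) by (simp flip: GL_diff GL_scale)
    also have "\<dots> = scale (d / c) (g s)" using c assms(2) by (simp add: GL_scale)
    finally show ?thesis by (auto simp: line_iff)
  qed
  moreover have len: "length ys = length zs" using arg_cong[OF assms(5), of length] by simp
  moreover have "coset scale v0 (ys ! i) = coset scale v0 (zs ! i)" if "i < length ys" for i
    using arg_cong[OF assms(5), of "\<lambda>l. l ! i"] that len by simp
  ultimately have "list_all2 (\<lambda>y z. z - y \<in> line scale (g s)) (map g ys) (map g zs)"
    by (simp add: list_all2_conv_all_nth)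
  then show ?thesis using alt_cons_shift[OF assms(1)] assms(4) by simp
qed

text \<open>The entries of \<open>ys\<close> and the representatives chosen by \<open>psi\<close>
  have the same cosets, so \<open>alt_coset_cong\<close> exchanges them.\<close>

lemma psi_coset:
  assumes "w \<in> alt_forms (full_space scale) (Suc p)" "g \<in> GL scale" "s \<in> line scale v0" "length ys = p"
  shows "psi scale v0 p w (g, s, map (coset scale v0) ys) = w (map g (s # ys))"
proof -
  have "map (coset scale v0) ys = map (coset scale v0) (map coset_rep (map (coset scale v0) ys))"
    by (subst map_coset_of_rep) (auto simp: coset_in_quot)
  from alt_coset_cong[OF assms this] show ?thesis using assms by (auto simp: psi_eq coset_in_quot)
qed

lemma alt_quot:
  assumes w: "w \<in> alt_forms (full_space scale) (Suc p)" and g: "g \<in> GL scale"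
  defines "b \<equiv> (\<lambda>ys. if length ys = p \<and> set ys \<subseteq> vcarrier (quot_space scale v0)
      then w (map g (v0 # map coset_rep ys)) else 0)"
  shows "b \<in> alt_forms (quot_space scale v0) p"
proof (rule alt_formsI, goal_cases)
  case (1 xs)
  then show ?case by (auto simp: b_def)
next
  have v0: "v0 \<in> line scale v0" by (simp add: span_base)
  have b: "b (map (coset scale v0) ys) = w (g v0 # map g ys)" if "length ys = p" for ys
    using psi_coset[OF w g v0 that] that g v0 by (auto simp: psi_eq b_def)
  {
    case (2 xs i x y)
    have "map (coset scale v0) (map coset_rep xs) = xs" using 2 by (simp only: map_coset_of_rep)
    \<comment> \<open>Updating by a coset is the image of updating the list of representatives.
      Multilinearity is then that of \<open>w\<close>, one slot further on because of the leading
      \<open>g v0\<close>.\<close>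
    then have u: "xs[i := coset scale v0 u] = map (coset scale v0) ((map coset_rep xs)[i := u])" for u
      by (simp add: map_update)
    obtain x' y' where "x = coset scale v0 x'" "y = coset scale v0 y'"
      using 2 by (auto simp: vcarrier_quot)
    moreover have "w (g v0 # map g ((map coset_rep xs)[i := x' + y'])) =
        w (g v0 # map g ((map coset_rep xs)[i := x'])) + w (g v0 # map g ((map coset_rep xs)[i := y']))"
      using full_add[OF w, of "Suc i" "g v0 # map g (map coset_rep xs)" "g x'" "g y'"] 2 g
      by (simp add: map_update GL_add)
    ultimately show ?case using 2 by (simp only: vadd_quot u b length_list_update length_map)
  next
    case (3 xs i x c)
    have "map (coset scale v0) (map coset_rep xs) = xs" using 3 by (simp only: map_coset_of_rep)
    then have u: "xs[i := coset scale v0 u] = map (coset scale v0) ((map coset_rep xs)[i := u])" for u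
      by (simp add: map_update)
    obtain x' where "x = coset scale v0 x'"
      using 3 by (auto simp: vcarrier_quot)
    moreover have "w (g v0 # map g ((map coset_rep xs)[i := scale c x'])) =
        c * w (g v0 # map g ((map coset_rep xs)[i := x']))"
      using full_scale[OF w, of "Suc i" "g v0 # map g (map coset_rep xs)" c "g x'"] 3 g
      by (simp add: map_update GL_scale)
    ultimately show ?case using 3 by (simp only: vsmul_quot u b length_list_update length_map)
  next
    case (4 xs i j)
    then show ?case using alt_forms_alt[OF w, of "map g (v0 # map coset_rep xs)" "Suc i" "Suc j"] by (simp add: b_def)
  }
qed

text \<open>The line is one-dimensional, so at \<open>g\<close> the map is a single product: the
  form on the line with value 1 at \<open>v0\<close>, times the contraction of \<open>w\<close> with
  \<open>g v0\<close>.\<close>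

lemma psi_in_LW:
  assumes w: "w \<in> alt_forms (full_space scale) (Suc p)" and g: "g \<in> GL scale"
  shows "(\<lambda>x. psi scale v0 p w (g, x)) \<in> LW scale v0 p"
proof -
  obtain l where l: "l \<in> dual_space scale" "l v0 = 1" using exists_form[OF v0_nonzero] .
  define a where "a s = (if s \<in> line scale v0 then l s else 0)" for s
  define b where "b ys = (if length ys = p \<and> set ys \<subseteq> vcarrier (quot_space scale v0)
      then w (map g (v0 # map coset_rep ys)) else 0)" for ys
  have "a \<in> L_rep scale v0"
    using l by (auto simp: L_rep_def linear_forms_def a_def dual_add dual_scale span_add span_scale)
  moreover have "b \<in> alt_forms (quot_space scale v0) p"
    using alt_quot[OF w g] unfolding b_def .
  moreover have "psi scale v0 p w (g, s, ys) = a s * b ys" for s ys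
  proof (cases "s \<in> line scale v0 \<and> length ys = p \<and> set ys \<subseteq> vcarrier (quot_space scale v0)")
    case True
    then obtain c where c: "s = scale c v0" by (auto simp: line_iff)
    then have "a s = c" using True l by (simp add: a_def dual_scale)
    moreover have "w (scale c (g v0) # map g (map coset_rep ys)) = c * w (g v0 # map g (map coset_rep ys))"
      using full_scale[OF w, of 0 "g v0 # map g (map coset_rep ys)" c "g v0"] True by simp
    ultimately show ?thesis using True g c by (simp add: psi_eq b_def GL_scale)
  qed (auto simp: psi_eq a_def b_def)
  ultimately show ?thesis unfolding LW_def tensor2_def
    by (intro fs.span_base) (auto simp: fun_eq_iff)
qed

lemma psi_regular:
  assumes w: "w \<in> alt_forms (full_space scale) (Suc p)"
  shows "(\<lambda>g. psi scale v0 p w (g, x)) \<in> reg_GL scale"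
proof (cases x)
  case (Pair s ys)
  show ?thesis
  proof (cases "s \<in> line scale v0 \<and> length ys = p \<and> set ys \<subseteq> vcarrier (quot_space scale v0)")
    case True
    let ?fs = "map (\<lambda>y (g :: 'v \<Rightarrow> 'v). g y) (s # map coset_rep ys)"
    have "(\<lambda>g. w ([] @ map (\<lambda>f. f g) ?fs)) \<in> reg_GL scale"
      unfolding reg_GL_def using True
      by (intro alt_full_regular[OF w]) (auto intro!: regular_on_gen)
    then show ?thesis unfolding reg_GL_def
      by (rule regular_on_cong) (use True in \<open>auto simp: psi_eq Pair comp_def\<close>)
  next
    case False
    then have "(\<lambda>g. psi scale v0 p w (g, x)) = (\<lambda>_. 0)" by (auto simp: psi_eq Pair fun_eq_iff)
    then show ?thesis by (simp add: reg_GL_def regular_on_const)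
  qed
qed

lemma psi_stab:
  assumes w: "w \<in> alt_forms (full_space scale) (Suc p)" and g: "g \<in> GL scale" and h: "h \<in> stab scale v0"
  shows "psi scale v0 p w (g \<circ> h, s, ys) = psi scale v0 p w (g, h s, map ((`) h) ys)"
proof (cases "s \<in> line scale v0 \<and> length ys = p \<and> set ys \<subseteq> vcarrier (quot_space scale v0)")
  case True
  then have ys: "ys = map (coset scale v0) (map coset_rep ys)" by (simp add: map_coset_of_rep del: map_map)
  have "psi scale v0 p w (g, h s, map (coset scale v0) (map h (map coset_rep ys))) = w (map g (h s # map h (map coset_rep ys)))"
    using True by (intro psi_coset w g) (auto simp: stab_line_iff[OF h])
  also have "map (coset scale v0) (map h (map coset_rep ys)) = map ((`) h) ys"
    by (subst (2) ys) (simp add: stab_coset[OF h])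
  finally show ?thesis using True GL_comp[OF g stab_GL[OF h]] by (simp add: psi_eq comp_assoc)
next
  case False
  moreover have "set (map ((`) h) ys) \<subseteq> vcarrier (quot_space scale v0) \<longleftrightarrow>
      set ys \<subseteq> vcarrier (quot_space scale v0)"
    using stab_image_quot_iff[OF h] by auto
  ultimately show ?thesis by (auto simp: psi_eq stab_line_iff[OF h] simp del: set_map)
qed

lemma psi_stab_scale:
  assumes w: "w \<in> alt_forms (full_space scale) (Suc p)" and g: "g \<in> GL scale" and h: "h \<in> stab scale v0"
    and a: "h v0 = scale a v0"
    and b: "\<And>Y. Y \<in> vcarrier (quot_space scale v0) \<Longrightarrow> h ` Y = vsmul (quot_space scale v0) b Y"
  shows "psi scale v0 p w (g \<circ> h, x) = a * b ^ p * psi scale v0 p w (g, x)"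
proof (cases x)
  case (Pair s ys)
  show ?thesis
  proof (cases "s \<in> line scale v0 \<and> length ys = p \<and> set ys \<subseteq> vcarrier (quot_space scale v0)")
    case True
    then have ys: "ys = map (coset scale v0) (map coset_rep ys)" by (simp add: map_coset_of_rep del: map_map)
    have "map ((`) h) ys = map (vsmul (quot_space scale v0) b) ys"
      using True b by auto
    also have "\<dots> = map (coset scale v0) (map (scale b) (map coset_rep ys))"
      by (subst ys) (simp add: vsmul_quot)
    finally have hys: "map ((`) h) ys = \<dots>" .
    have hs: "h s = scale a s" using True a stab_GL[OF h]
      by (auto simp: line_iff GL_scale mult.commute)
    have "psi scale v0 p w (g \<circ> h, s, ys) = w (map g (scale a s # map (scale b) (map coset_rep ys)))"
      unfolding psi_stab[OF w g h] hys hs using True by (intro psi_coset w g) (auto intro: span_scale)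
    also have "map g (scale a s # map (scale b) (map coset_rep ys)) = scale a (g s) # map (scale b) (map g (map coset_rep ys))"
      using g by (simp add: GL_scale)
    also have "w \<dots> = a * b ^ p * w (map g (s # map coset_rep ys))"
      using True by (subst alt_cons_scale[OF w]) auto
    also have "w (map g (s # map coset_rep ys)) = psi scale v0 p w (g, s, ys)"
      using True g by (simp add: psi_eq)
    finally show ?thesis by (simp only: Pair)
  next
    case False
    then show ?thesis unfolding Pair psi_eq by (simp only: if_False de_Morgan_conj) auto
  qed
qed

lemma psi_in_O_bal_inv:
  assumes w: "w \<in> alt_forms (full_space scale) (Suc p)"
  shows "psi scale v0 p w \<in> O_bal_inv scale v0 p"
proof -
  have "psi scale v0 p w \<in> O_bal scale (LW scale v0 p)"
    using psi_in_LW[OF w] psi_regular[OF w] by (auto simp: O_bal_def psi_eq)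
  moreover have "(\<lambda>x. psi scale v0 p w (g \<circ> h, x)) = LW_act (inv h) (\<lambda>x. psi scale v0 p w (g, x))"
    if "g \<in> GL scale" "h \<in> stab scale v0" for g h
    using that psi_stab[OF w that] by (auto simp: LW_act_def fun_eq_iff GL_inv_inv stab_GL)
  ultimately show ?thesis by (simp add: O_bal_inv_def)
qed

section \<open>The invariant tensor\<close>

text \<open>The weight of \<open>psi\<close>, kept apart from its change of arguments
  \<open>psi_arg\<close> in the form that \<open>tensor_map_pullback\<close> asks for.\<close>

definition psi_supp :: "nat \<Rightarrow> ('v \<Rightarrow> 'v) \<times> 'v \<times> 'v set list \<Rightarrow> 'k" where
  "psi_supp p = (\<lambda>(g, s, ys). of_bool (g \<in> GL scale \<and> s \<in> line scale v0 \<and> length ys = p \<and>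
      set ys \<subseteq> vcarrier (quot_space scale v0)))"

definition psi_arg :: "('v \<Rightarrow> 'v) \<times> 'v \<times> 'v set list \<Rightarrow> 'v list" where
  "psi_arg = (\<lambda>(g, s, ys). map g (s # map coset_rep ys))"

lemma psi_pullback: "psi scale v0 p w = (\<lambda>x. psi_supp p x * w (psi_arg x))"
  by (auto simp: fun_eq_iff psi_eq psi_supp_def psi_arg_def)

end

locale tensor_form = pointed_space scale Basis v0
  for scale :: "'k::field_char_0 \<Rightarrow> 'v::ab_group_add \<Rightarrow> 'v" and Basis :: "'v set" and v0 :: 'v +
  fixes n :: nat and p :: "nat \<Rightarrow> nat" and I :: "(nat \<Rightarrow> 'v list) \<Rightarrow> 'k"
  assumes I_in: "I \<in> inv_space scale n p"
begin

abbreviation "\<tau> \<equiv> tau scale v0 n p I"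

lemma tau_eq: "\<tau> x = (\<Prod>i<n. psi_supp (p i) (x i)) * I (\<lambda>i. psi_arg (x i))"
  unfolding tau_def
  by (subst tensor_map_pullback[OF I_in, where w = "\<lambda>i. psi_supp (p i)" and e = "\<lambda>i. psi_arg"])
    (auto simp: psi_pullback)

lemma tau_in: "\<tau> \<in> tensor_prod n (\<lambda>i. O_bal_inv scale v0 (p i))"
proof -
  have "(\<lambda>x. (\<Prod>i<n. psi_supp (p i) (x i)) * I (\<lambda>i. psi_arg (x i))) \<in> tensor_prod n (\<lambda>i. O_bal_inv scale v0 (p i))"
    by (rule tensor_prod_pullback[OF I_in]) (use psi_in_O_bal_inv in \<open>simp add: psi_pullback\<close>)
  then show ?thesis by (simp add: tau_eq[abs_def])
qed

lemma tau_cong: "(\<And>i. i < n \<Longrightarrow> x i = y i) \<Longrightarrow> \<tau> x = \<tau> y"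
  using tensor_prod_cong[OF tau_in] .

text \<open>The chosen representatives are removed slot by slot:
  \<open>tensor_prod_scale_eval\<close> with all factors equal to 1 reduces the exchange to
  \<open>psi_coset\<close>.\<close>

lemma tau_value:
  assumes "\<And>i. i < n \<Longrightarrow> g i \<in> GL scale" "\<And>i. i < n \<Longrightarrow> s i \<in> line scale v0" "\<And>i. i < n \<Longrightarrow> length (y i) = p i"
  shows "\<tau> (\<lambda>i. (g i, s i, map (coset scale v0) (y i))) = I (\<lambda>i. map (g i) (s i # y i))"
proof -
  have supp: "psi_supp (p i) (g i, s i, map (coset scale v0) (y i)) = 1" if "i < n" for i
    using that assms by (auto simp: psi_supp_def coset_in_quot)
  have "I (\<lambda>i. psi_arg (g i, s i, map (coset scale v0) (y i))) = (\<Prod>i<n. 1) * I (\<lambda>i. map (g i) (s i # y i))"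
  proof (rule tensor_prod_scale_eval[OF I_in])
    fix i a assume "i < n" "a \<in> alt_forms (full_space scale) (p i + 1)"
    then show "a (psi_arg (g i, s i, map (coset scale v0) (y i))) = 1 * a (map (g i) (s i # y i))"
      using psi_coset[of a "p i" "g i" "s i" "y i"] supp[of i] assms by (simp add: psi_pullback)
  qed
  then show ?thesis using supp by (simp add: tau_eq)
qed

lemma as_map_tau_in_LWn:
  assumes "\<And>i. i < n \<Longrightarrow> g i \<in> GL scale"
  shows "as_map \<tau> g \<in> LWn scale v0 n p"
proof -
  have "(\<lambda>x. (\<Prod>i<n. 1) * \<tau> (\<lambda>i. (g i, x i))) \<in> LWn scale v0 n p"
    by (rule tensor_prod_pullback[OF tau_in]) (use assms in \<open>auto simp: O_bal_inv_def O_bal_def\<close>)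
  then show ?thesis by (simp add: as_map_def)
qed

text \<open>Each factor is regular in its own group variable, and a generating function evaluated at
  \<open>g i\<close> is a generator for the power of the group.\<close>

lemma as_map_tau_regular: "(\<lambda>g. as_map \<tau> g x) \<in> reg_GLn scale n"
  unfolding as_map_def reg_GLn_def
proof (rule tensor_prod_regular[OF tau_in])
  fix i a assume i: "i < n" and "a \<in> O_bal_inv scale v0 (p i)"
  then have "(\<lambda>g. a (g, x i)) \<in> reg_GL scale" unfolding O_bal_inv_def O_bal_def by blast
  then show "(\<lambda>g. a (g i, x i)) \<in> regular_on (GLn scale n)
     ({(\<lambda>g. l (g i w)) |l i w. l \<in> dual_space scale \<and> i < n} \<union>
      {(\<lambda>g. l (inv (g i) w)) |l i w. l \<in> dual_space scale \<and> i < n})"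
    unfolding reg_GL_def
    by (rule regular_on_pullback[where e = "\<lambda>g. g i"]) (use i in \<open>auto, (intro regular_on_gen, blast)+\<close>)
qed

lemma tau_equivariant:
  assumes "\<And>i. i < n \<Longrightarrow> g i \<in> GL scale" "\<And>i. i < n \<Longrightarrow> h i \<in> stab scale v0"
  shows "as_map \<tau> (\<lambda>i. g i \<circ> h i) = LWn_act (\<lambda>i. inv (h i)) (as_map \<tau> g)"
proof
  fix x
  have "\<tau> (\<lambda>i. (g i \<circ> h i, x i)) = (\<Prod>i<n. 1) * \<tau> (\<lambda>i. (g i, case x i of (s, ys) \<Rightarrow>
      (inv (inv (h i)) s, map ((`) (inv (inv (h i)))) ys)))"
  proof (rule tensor_prod_scale_eval[OF tau_in])
    fix i a assume "i < n" "a \<in> O_bal_inv scale v0 (p i)"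
    then have "(\<lambda>x. a (g i \<circ> h i, x)) = LW_act (inv (h i)) (\<lambda>x. a (g i, x))"
      using assms by (simp add: O_bal_inv_def)
    from fun_cong[OF this, of "x i"]
    show "a (g i \<circ> h i, x i) = 1 * a (g i, case x i of (s, ys) \<Rightarrow>
      (inv (inv (h i)) s, map ((`) (inv (inv (h i)))) ys))"
      by (simp add: LW_act_def split: prod.splits)
  qed
  then show "as_map \<tau> (\<lambda>i. g i \<circ> h i) x = LWn_act (\<lambda>i. inv (h i)) (as_map \<tau> g) x"
    by (simp add: as_map_def LWn_act_def)
qed

lemma tau_in_O_bal_n_inv: "\<tau> \<in> O_bal_n_inv scale v0 n p"
proof -
  have "tensor_prod n (\<lambda>i. O_bal_inv scale v0 (p i)) \<subseteq> tensor_prod n (\<lambda>i. O_bal scale (LW scale v0 (p i)))"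
    by (rule tensor_prod_mono) (auto simp: O_bal_inv_def)
  then show ?thesis unfolding O_bal_n_inv_def using tau_in tau_equivariant by (fastforce simp: PiE_iff)
qed

lemma tau_stab_scale:
  assumes "\<And>i. i < n \<Longrightarrow> g i \<in> GL scale" "\<And>i. i < n \<Longrightarrow> h i \<in> stab scale v0"
    and "\<And>i. i < n \<Longrightarrow> h i v0 = scale (a i) v0"
    and "\<And>i Y. i < n \<Longrightarrow> Y \<in> vcarrier (quot_space scale v0) \<Longrightarrow> h i ` Y = vsmul (quot_space scale v0) (b i) Y"
  shows "as_map \<tau> (\<lambda>i. g i \<circ> h i) = fscale (\<Prod>i<n. a i * b i ^ p i) (as_map \<tau> g)"
proof
  fix x
  have "psi_supp (p i) (g i \<circ> h i, x i) = psi_supp (p i) (g i, x i)" if "i < n" for i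
    using that assms GL_comp stab_GL by (auto simp: psi_supp_def split: prod.splits)
  moreover have "(\<Prod>i<n. psi_supp (p i) (g i, x i)) * I (\<lambda>i. psi_arg (g i \<circ> h i, x i)) =
      (\<Prod>i<n. psi_supp (p i) (g i, x i)) * ((\<Prod>i<n. a i * b i ^ p i) * I (\<lambda>i. psi_arg (g i, x i)))"
  \<comment> \<open>The scaling rule is known for \<open>psi\<close>, and it says something about
    \<open>psi_arg\<close> only where the weight is 1. At all other arguments both sides are
    0.\<close>
  proof (cases "\<exists>i<n. psi_supp (p i) (g i, x i) = 0")
    case False
    have "I (\<lambda>i. psi_arg (g i \<circ> h i, x i)) = (\<Prod>i<n. a i * b i ^ p i) * I (\<lambda>i. psi_arg (g i, x i))"
    proof (rule tensor_prod_scale_eval[OF I_in])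
      fix i c assume i: "i < n" and c: "c \<in> alt_forms (full_space scale) (p i + 1)"
      have s: "psi_supp (p i) (g i, x i) = 1" using i False by (auto simp: psi_supp_def split: prod.splits)
      moreover from i s have "psi_supp (p i) (g i \<circ> h i, x i) = 1"
        using \<open>\<And>i. i < n \<Longrightarrow> psi_supp (p i) (g i \<circ> h i, x i) = psi_supp (p i) (g i, x i)\<close> by simp
      moreover have "psi scale v0 (p i) c (g i \<circ> h i, x i) = a i * b i ^ p i * psi scale v0 (p i) c (g i, x i)"
        using i c assms by (intro psi_stab_scale) auto
      ultimately show "c (psi_arg (g i \<circ> h i, x i)) = a i * b i ^ p i * c (psi_arg (g i, x i))"
        by (simp add: psi_pullback)
    qed
    then show ?thesis by simp
  qed (auto simp: prod_zero_iff)
  ultimately show "as_map \<tau> (\<lambda>i. g i \<circ> h i) x = fscale (\<Prod>i<n. a i * b i ^ p i) (as_map \<tau> g) x"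
    by (simp add: as_map_def tau_eq fscale_def)
qed

end

context pointed_space
begin

section \<open>The tangent representation and its kernels\<close>

lemma vcarrier_T: "vcarrier (T_space scale v0) =
    {t \<in> line scale v0 \<rightarrow>\<^sub>E vcarrier (quot_space scale v0).
      (\<forall>x\<in>line scale v0. \<forall>y\<in>line scale v0. t (x + y) = vadd (quot_space scale v0) (t x) (t y)) \<and>
      (\<forall>c. \<forall>x\<in>line scale v0. t (scale c x) = vsmul (quot_space scale v0) c (t x))}"
  and vadd_T: "vadd (T_space scale v0) t u = (\<lambda>x\<in>line scale v0. vadd (quot_space scale v0) (t x) (u x))"
  and vsmul_T: "vsmul (T_space scale v0) c t = (\<lambda>x\<in>line scale v0. vsmul (quot_space scale v0) c (t x))"
  by (simp_all add: T_space_def Let_def)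

lemma T_outside: "t \<in> vcarrier (T_space scale v0) \<Longrightarrow> x \<notin> line scale v0 \<Longrightarrow> t x = undefined"
  unfolding vcarrier_T by (blast intro: PiE_arb)

lemma v0_in_line: "v0 \<in> line scale v0"
  by (simp add: span_base)

text \<open>A homomorphism from the line to the quotient may take any value at \<open>v0\<close>; a
  linear form that is 1 at \<open>v0\<close> produces one.\<close>

lemma T_elem:
  assumes "Y \<in> vcarrier (quot_space scale v0)"
  obtains t where "t \<in> vcarrier (T_space scale v0)" "t v0 = Y"
proof -
  obtain l where l: "l \<in> dual_space scale" "l v0 = 1" using exists_form[OF v0_nonzero] .
  obtain y where y: "Y = coset scale v0 y" using assms by (auto simp: vcarrier_quot)
  let ?t = "\<lambda>x\<in>line scale v0. coset scale v0 (scale (l x) y)"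
  have "?t \<in> vcarrier (T_space scale v0)"
    using l by (auto simp: vcarrier_T coset_in_quot span_add span_scale vadd_quot vsmul_quot dual_add
        dual_scale scale_left_distrib)
  moreover have "?t v0 = Y" using v0_in_line l y by simp
  ultimately show ?thesis by (rule that)
qed

lemma quot_closed:
  "A \<in> vcarrier (quot_space scale v0) \<Longrightarrow> B \<in> vcarrier (quot_space scale v0) \<Longrightarrow>
    vadd (quot_space scale v0) A B \<in> vcarrier (quot_space scale v0)"
  "A \<in> vcarrier (quot_space scale v0) \<Longrightarrow> vsmul (quot_space scale v0) c A \<in> vcarrier (quot_space scale v0)"
  by (auto simp: vcarrier_quot vadd_quot vsmul_quot)

lemma T_space_closed:
  assumes "t \<in> vcarrier (T_space scale v0)" "u \<in> vcarrier (T_space scale v0)"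
  shows "vadd (T_space scale v0) t u \<in> vcarrier (T_space scale v0)"
    and "vsmul (T_space scale v0) c t \<in> vcarrier (T_space scale v0)"
proof -
  have *: "t x \<in> vcarrier (quot_space scale v0)" "u x \<in> vcarrier (quot_space scale v0)"
    if "x \<in> line scale v0" for x using assms that by (auto simp: vcarrier_T)
  have q1: "vadd (quot_space scale v0) (vadd (quot_space scale v0) A B) (vadd (quot_space scale v0) C D) =
      vadd (quot_space scale v0) (vadd (quot_space scale v0) A C) (vadd (quot_space scale v0) B D)"
    if "A \<in> vcarrier (quot_space scale v0)" "B \<in> vcarrier (quot_space scale v0)"
      "C \<in> vcarrier (quot_space scale v0)" "D \<in> vcarrier (quot_space scale v0)" for A B C D
    using that by (auto simp only: vcarrier_quot vadd_quot vsmul_quot image_iff ac_simps)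
  have q2: "vadd (quot_space scale v0) (vsmul (quot_space scale v0) c A) (vsmul (quot_space scale v0) c B) =
      vsmul (quot_space scale v0) c (vadd (quot_space scale v0) A B)"
    if "A \<in> vcarrier (quot_space scale v0)" "B \<in> vcarrier (quot_space scale v0)" for A B c
    using that by (auto simp only: vcarrier_quot vadd_quot vsmul_quot image_iff scale_right_distrib)
  have q3: "vsmul (quot_space scale v0) c (vsmul (quot_space scale v0) d A) =
      vsmul (quot_space scale v0) d (vsmul (quot_space scale v0) c A)"
    if "A \<in> vcarrier (quot_space scale v0)" for A c d
    using that by (auto simp only: vcarrier_quot vsmul_quot image_iff scale_scale mult.commute)
  have t: "t (x + y) = vadd (quot_space scale v0) (t x) (t y)" "u (x + y) = vadd (quot_space scale v0) (u x) (u y)"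
    "t (scale d x) = vsmul (quot_space scale v0) d (t x)" "u (scale d x) = vsmul (quot_space scale v0) d (u x)"
    if "x \<in> line scale v0" "y \<in> line scale v0" for x y d
    using assms that by (simp_all add: vcarrier_T)
  note t = t(1,2) t(3,4)[OF _ v0_in_line]
  show "vadd (T_space scale v0) t u \<in> vcarrier (T_space scale v0)"
    unfolding vadd_T vcarrier_T
    by (intro CollectI conjI ballI allI restrict_PiE_iff[THEN iffD2])
      (simp_all add: quot_closed * t span_add span_scale, simp_all add: q1 q2 *)
  show "vsmul (T_space scale v0) c t \<in> vcarrier (T_space scale v0)"
    unfolding vsmul_T vcarrier_T
    by (intro CollectI conjI ballI allI restrict_PiE_iff[THEN iffD2])
      (simp_all add: quot_closed * t span_add span_scale, simp_all add: q2 q3[of _ _ c] *)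
qed

lemma T_smul_closed:
  "t \<in> vcarrier (T_space scale v0) \<Longrightarrow> vsmul (T_space scale v0) c t \<in> vcarrier (T_space scale v0)"
  by (rule T_space_closed(2))

lemma stab_image_scalar:
  assumes "h \<in> stab scale v0" "\<And>y. coset scale v0 (h y) = coset scale v0 (scale b y)"
    and "Y \<in> vcarrier (quot_space scale v0)"
  shows "h ` Y = vsmul (quot_space scale v0) b Y"
proof -
  obtain y where "Y = coset scale v0 y" using assms(3) by (auto simp: vcarrier_quot)
  then show ?thesis by (simp only: stab_coset[OF assms(1)] vsmul_quot assms(2))
qed

text \<open>The action sends \<open>t\<close> to \<open>h\<close> after \<open>t\<close> after
  \<open>inv h\<close>, and \<open>inv h v0\<close> is \<open>v0\<close> divided by
  \<open>a\<close>. At \<open>v0\<close> it is therefore \<open>1 / a\<close> times the action of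
  \<open>h\<close> on the quotient; if it is also \<open>c\<close>, then \<open>h\<close> acts on
  the quotient by \<open>a * c\<close>. Every coset occurs as a value \<open>t v0\<close>.\<close>

lemma T_act_scalar:
  assumes h: "h \<in> stab scale v0" and a: "h v0 = scale a v0"
    and c: "\<And>t. t \<in> vcarrier (T_space scale v0) \<Longrightarrow> T_act scale v0 h t = vsmul (T_space scale v0) c t"
  shows "coset scale v0 (h y) = coset scale v0 (scale (a * c) y)"
proof -
  have GL: "h \<in> GL scale" using h by (rule stab_GL)
  have "h v0 \<noteq> 0" using GL_eq_zero_iff[OF GL, of v0] v0_nonzero by simp
  then have a0: "a \<noteq> 0" unfolding a by auto
  have "h (scale (1 / a) v0) = v0" using a a0 GL by (simp add: GL_scale)
  then have inv: "inv h v0 = scale (1 / a) v0" using GL_inv2[OF GL] by metis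
  obtain t where t: "t \<in> vcarrier (T_space scale v0)" "t v0 = coset scale v0 y"
    using T_elem[OF coset_in_quot] .
  have "T_act scale v0 h t v0 = h ` coset scale v0 (scale (1 / a) y)"
    using t v0_in_line by (simp add: T_act_def inv vcarrier_T vsmul_quot)
  moreover have "T_act scale v0 h t v0 = coset scale v0 (scale c y)"
    using t v0_in_line by (simp add: c vsmul_T vsmul_quot)
  ultimately have "coset scale v0 (scale (1 / a) (h y)) = coset scale v0 (scale c y)"
    using GL by (simp add: stab_coset[OF h] GL_scale)
  then have "vsmul (quot_space scale v0) a (coset scale v0 (scale (1 / a) (h y))) =
      vsmul (quot_space scale v0) a (coset scale v0 (scale c y))" by simp
  then show ?thesis using a0 by (simp add: vsmul_quot)
qed

lemma vsmul_T_one: "t \<in> vcarrier (T_space scale v0) \<Longrightarrow> vsmul (T_space scale v0) 1 t = t"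
proof (rule ext)
  fix x assume t: "t \<in> vcarrier (T_space scale v0)"
  show "vsmul (T_space scale v0) 1 t x = t x"
  proof (cases "x \<in> line scale v0")
    case True
    then have "t x \<in> vcarrier (quot_space scale v0)" using t by (auto simp: vcarrier_T)
    then obtain y where "t x = coset scale v0 y" by (auto simp: vcarrier_quot)
    then show ?thesis using True by (simp add: vsmul_T vsmul_quot)
  next
    case False
    then show ?thesis using T_outside[OF t] by (simp add: vsmul_T)
  qed
qed

lemma K_T_subset: "K_T scale v0 \<subseteq> Ks_T scale v0"
proof
  fix h assume h: "h \<in> K_T scale v0"
  then have "\<forall>t\<in>vcarrier (T_space scale v0). T_act scale v0 h t = vsmul (T_space scale v0) 1 t"
    by (simp add: K_T_def vsmul_T_one)
  then show "h \<in> Ks_T scale v0" using h unfolding K_T_def Ks_T_def by blast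
qed

lemma K_LTW_subset: "K_LTW scale v0 \<subseteq> K_T scale v0"
  by (auto simp: K_T_def K_LTW_def)

lemma id_in_K_LTW: "id \<in> K_LTW scale v0"
proof -
  have "T_act scale v0 id t = t" if "t \<in> vcarrier (T_space scale v0)" for t
    using T_outside[OF that] by (simp add: T_act_def restrict_def fun_eq_iff)
  then show ?thesis by (simp add: K_LTW_def stab_def GL_id)
qed

lemma Ks_T_scalars:
  assumes "h \<in> Ks_T scale v0"
  obtains a b where "h v0 = scale a v0" "a \<noteq> 0" "b \<noteq> 0"
    "\<And>Y. Y \<in> vcarrier (quot_space scale v0) \<Longrightarrow> h ` Y = vsmul (quot_space scale v0) b Y"
proof -
  have h: "h \<in> stab scale v0" using assms by (simp add: Ks_T_def)
  obtain a where a: "h v0 = scale a v0" "a \<noteq> 0" using stab_v0[OF h] .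
  obtain c where "\<And>t. t \<in> vcarrier (T_space scale v0) \<Longrightarrow> T_act scale v0 h t = vsmul (T_space scale v0) c t"
    using assms by (auto simp: Ks_T_def)
  then have c: "coset scale v0 (h y) = coset scale v0 (scale (a * c) y)" for y
    using T_act_scalar[OF h a(1)] by blast
  show ?thesis
  proof (cases "c = 0")
    \<comment> \<open>Here every \<open>h y\<close> lies in the line, so V is the line and the
      quotient is zero. Any scalar then describes the action, and 1 is a nonzero one.\<close>
    case True
    then have "y \<in> line scale v0" for y
      using c[of y] coset_eq_iff[of "h y" 0] by (simp add: stab_line_iff[OF h])
    then have "coset scale v0 (h y) = coset scale v0 (scale 1 y)" for y by (simp add: coset_eq_iff)
    then show ?thesis using that[OF a one_neq_zero] stab_image_scalar[OF h] by blast
  next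
    case False
    then have "a * c \<noteq> 0" using a by simp
    from that[OF a this] show ?thesis using stab_image_scalar[OF h c] by blast
  qed
qed

lemma K_LTW_trivial:
  assumes "h \<in> K_LTW scale v0"
  shows "h v0 = scale 1 v0"
    and "Y \<in> vcarrier (quot_space scale v0) \<Longrightarrow> h ` Y = vsmul (quot_space scale v0) 1 Y"
proof -
  have h: "h \<in> stab scale v0" using assms by (simp add: K_LTW_def)
  obtain l where l: "l \<in> dual_space scale" "l v0 = 1" using exists_form[OF v0_nonzero] .
  define m where "m s = (if s \<in> line scale v0 then l s else 0)" for s
  have "m \<in> L_rep scale v0"
    using l by (auto simp: L_rep_def linear_forms_def m_def dual_add dual_scale span_add span_scale)
  then have "(\<lambda>x. m (inv h x)) = m" using assms by (simp add: K_LTW_def)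
  from fun_cong[OF this, of "h v0"] have "m v0 = m (h v0)"
    using GL_inv2[OF stab_GL[OF h]] by simp
  moreover obtain a where a: "h v0 = scale a v0" "a \<noteq> 0" using stab_v0[OF h] .
  ultimately show 1: "h v0 = scale 1 v0"
    using l v0_in_line by (simp add: m_def dual_scale span_scale)
  have "T_act scale v0 h t = vsmul (T_space scale v0) 1 t" if "t \<in> vcarrier (T_space scale v0)" for t
    using assms that by (simp add: K_LTW_def vsmul_T_one)
  from T_act_scalar[OF h 1 this] have "coset scale v0 (h y) = coset scale v0 (scale 1 y)" for y by simp
  then show "Y \<in> vcarrier (quot_space scale v0) \<Longrightarrow> h ` Y = vsmul (quot_space scale v0) 1 Y"
    by (rule stab_image_scalar[OF h])
qed

section \<open>From weighted forms to forms on the tangent space\<close>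

text \<open>L is one-dimensional and \<open>l s\<close> is the coordinate of \<open>s\<close> with
  respect to \<open>v0\<close>, so an element is determined by its values with \<open>v0\<close> in
  the first place.\<close>

lemma LW_eval:
  assumes "a \<in> LW scale v0 q" "l \<in> dual_space scale" "l v0 = 1"
  shows "a (s, ys) = of_bool (s \<in> line scale v0 \<and> length ys = q \<and> set ys \<subseteq> vcarrier (quot_space scale v0))
      * l s * a (v0, ys)"
  using assms(1) unfolding LW_def tensor2_def
proof (induction rule: fs.span_induct_alt)
  case (step c x y)
  then obtain f b where x: "x = (\<lambda>(x, y). f x * b y)" "f \<in> L_rep scale v0"
    "b \<in> alt_forms (quot_space scale v0) q" by blast
  have "f s = of_bool (s \<in> line scale v0) * l s * f v0"
  proof (cases "s \<in> line scale v0")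
    case True
    then obtain d where "s = scale d v0" by (auto simp: line_iff)
    then show ?thesis using x(2) v0_in_line assms(2,3) by (auto simp: L_rep_def linear_forms_def dual_scale span_scale)
  qed (use x(2) in \<open>auto simp: L_rep_def linear_forms_def\<close>)
  moreover have "b ys = of_bool (length ys = q \<and> set ys \<subseteq> vcarrier (quot_space scale v0)) * b ys"
    using alt_forms_outside[OF x(3), of ys] by auto
  ultimately have "x (s, ys) = of_bool (s \<in> line scale v0 \<and> length ys = q \<and>
      set ys \<subseteq> vcarrier (quot_space scale v0)) * l s * x (v0, ys)"
    unfolding x(1) by (auto simp: of_bool_def split: if_splits)
  then show ?case using step(2) by (simp add: fscale_def algebra_simps)
qed simp

lemma LW_alt:
  assumes "a \<in> LW scale v0 q"
  shows "(\<lambda>ys. a (v0, ys)) \<in> alt_forms (quot_space scale v0) q"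
  using assms unfolding LW_def tensor2_def
proof (induction rule: fs.span_induct_alt)
  case base
  then show ?case using fs.subspace_0[OF subspace_alt_forms] by (simp add: zero_fun_def)
next
  case (step c x y)
  then obtain f b where x: "x = (\<lambda>(x, y). f x * b y)" "f \<in> L_rep scale v0"
    "b \<in> alt_forms (quot_space scale v0) q" by blast
  have "fscale (c * f v0) b + (\<lambda>ys. y (v0, ys)) \<in> alt_forms (quot_space scale v0) q"
    by (intro fs.subspace_add[OF subspace_alt_forms] fs.subspace_scale[OF subspace_alt_forms] x step)
  then show ?case by (simp add: plus_fun_def fscale_def x mult.assoc)
qed

definition T_supp :: "nat \<Rightarrow> ('v \<Rightarrow> 'v set) list \<Rightarrow> 'k" where
  "T_supp q ts = of_bool (length ts = q \<and> set ts \<subseteq> vcarrier (T_space scale v0))"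

definition T_arg :: "('v \<Rightarrow> 'v set) list \<Rightarrow> 'v \<times> 'v set list" where
  "T_arg ts = (v0, map (\<lambda>t. t v0) ts)"

lemma to_T_pullback: "to_T scale v0 q m = (\<lambda>ts. T_supp q ts * m (T_arg ts))"
  by (auto simp: to_T_def T_supp_def T_arg_def)

lemma to_T_alt:
  assumes "a \<in> LW scale v0 q"
  shows "to_T scale v0 q a \<in> alt_forms (T_space scale v0) q"
proof -
  have "(\<lambda>ts. if length ts = q \<and> set ts \<subseteq> vcarrier (T_space scale v0)
      then a (v0, map (\<lambda>t. t v0) ts) else 0) \<in> alt_forms (T_space scale v0) q"
    by (rule alt_forms_pullback[OF LW_alt[OF assms]])
      (use T_space_closed(1) T_smul_closed v0_in_line in \<open>auto simp: vadd_T vsmul_T\<close>, auto simp: vcarrier_T)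
  then show ?thesis by (simp add: to_T_def)
qed

end

context tensor_form
begin

abbreviation "to_Tn \<equiv> tensor_map n (\<lambda>i. LW scale v0 (p i)) (\<lambda>i. to_T scale v0 (p i))"

lemma to_Tn_eq: "m \<in> LWn scale v0 n p \<Longrightarrow> to_Tn m = (\<lambda>ts. (\<Prod>i<n. T_supp (p i) (ts i)) * m (\<lambda>i. T_arg (ts i)))"
  by (rule tensor_map_pullback) (auto simp: to_T_pullback)

lemma to_Tn_in: "m \<in> LWn scale v0 n p \<Longrightarrow> to_Tn m \<in> Tn scale v0 n p"
  unfolding to_Tn_eq by (erule tensor_prod_pullback) (use to_T_alt in \<open>simp add: to_T_pullback\<close>)

lemma LWn_scale: "m \<in> LWn scale v0 n p \<Longrightarrow> fscale c m \<in> LWn scale v0 n p"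
  unfolding tensor_prod_def by (rule fs.span_scale)

lemma to_Tn_scale:
  assumes m: "m \<in> LWn scale v0 n p"
  shows "to_Tn (fscale c m) = fscale c (to_Tn m)"
  unfolding to_Tn_eq[OF m] to_Tn_eq[OF LWn_scale[OF m]] by (simp add: fscale_def mult_ac)

text \<open>At an argument where \<open>m\<close> is nonzero, \<open>LW_eval\<close> replaces all
  vectors of the line by \<open>v0\<close> at the cost of a factor that cannot vanish. The remaining
  cosets are values at \<open>v0\<close> of elements of T, so \<open>to_Tn m\<close> takes the same
  nonzero value at those elements.\<close>

lemma to_Tn_nonzero:
  assumes m: "m \<in> LWn scale v0 n p" and "m \<noteq> 0"
  shows "to_Tn m \<noteq> 0"
proof -
  obtain l where l: "l \<in> dual_space scale" "l v0 = 1" using exists_form[OF v0_nonzero] .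
  obtain x where x: "m x \<noteq> 0" using assms(2) by (auto simp: fun_eq_iff)
  define s where "s i = fst (x i)" for i
  define ys where "ys i = snd (x i)" for i
  have "m x = (\<Prod>i<n. of_bool (s i \<in> line scale v0 \<and> length (ys i) = p i \<and>
      set (ys i) \<subseteq> vcarrier (quot_space scale v0)) * l (s i)) * m (\<lambda>i. (v0, ys i))"
    by (rule tensor_prod_scale_eval[OF m]) (simp add: LW_eval[OF _ l] s_def ys_def flip: LW_eval[OF _ l])
  then have nz: "m (\<lambda>i. (v0, ys i)) \<noteq> 0"
    and "\<forall>i<n. length (ys i) = p i \<and> set (ys i) \<subseteq> vcarrier (quot_space scale v0)"
    using x by (auto simp: prod_zero_iff)
  then have ok: "length (ys i) = p i" "set (ys i) \<subseteq> vcarrier (quot_space scale v0)" if "i < n" for i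
    using that by auto
  define t where "t Y = (SOME t. t \<in> vcarrier (T_space scale v0) \<and> t v0 = Y)" for Y
  have t: "t Y \<in> vcarrier (T_space scale v0)" "t Y v0 = Y" if "Y \<in> vcarrier (quot_space scale v0)" for Y
    using someI_ex[of "\<lambda>t. t \<in> vcarrier (T_space scale v0) \<and> t v0 = Y"] T_elem[OF that]
    unfolding t_def by blast+
  have "T_arg (map t (ys i)) = (v0, ys i)" if "i < n" for i
    using t ok[OF that] by (auto simp: T_arg_def intro!: map_idI)
  then have "m (\<lambda>i. T_arg (map t (ys i))) = m (\<lambda>i. (v0, ys i))" by (rule tensor_prod_cong[OF m])
  moreover have "T_supp (p i) (map t (ys i)) = 1" if "i < n" for i
    using t ok[OF that] by (auto simp: T_supp_def)
  ultimately have "to_Tn m (\<lambda>i. map t (ys i)) \<noteq> 0" using nz by (simp add: to_Tn_eq[OF m])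
  then show ?thesis by (auto simp: fun_eq_iff)
qed

section \<open>Maps on frames\<close>

lemma proj_pt_scale: "c \<noteq> 0 \<Longrightarrow> proj_pt (fscale c m) = proj_pt (m :: 'x \<Rightarrow> 'k)"
proof -
  assume "c \<noteq> 0"
  then have "fscale d m = fscale (d / c) (fscale c m)" "d \<noteq> 0 \<Longrightarrow> d / c \<noteq> 0"
    "fscale d (fscale c m) = fscale (d * c) m" "d \<noteq> 0 \<Longrightarrow> d * c \<noteq> 0" for d
    by (auto simp: fscale_def)
  then show ?thesis unfolding proj_pt_def by blast
qed

lemma proj_ident_pt: "m \<in> LWn scale v0 n p \<Longrightarrow> proj_ident scale v0 n p (proj_pt m) = proj_pt (to_Tn m)"
  unfolding proj_ident_def proj_pt_def by (force simp: to_Tn_scale image_iff)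

lemma h_proj_scale:
  assumes "as_map \<tau> g' = fscale c (as_map \<tau> g)" "c \<noteq> 0"
  shows "h_proj scale v0 n p I g' = h_proj scale v0 n p I g"
proof -
  have "fscale c m = 0 \<longleftrightarrow> m = 0" for m :: "(nat \<Rightarrow> 'v \<times> 'v set list) \<Rightarrow> 'k"
    using assms(2) by (auto simp: fscale_def fun_eq_iff)
  then show ?thesis by (simp add: h_proj_def assms Let_def proj_pt_scale)
qed

lemma as_map_tau_cong: "(\<And>i. i < n \<Longrightarrow> g i = g' i) \<Longrightarrow> as_map \<tau> g = as_map \<tau> g'"
  unfolding as_map_def by (intro ext tau_cong) simp

text \<open>Since \<open>id\<close> is in \<open>K\<close> the coset of \<open>g i\<close> is
  nonempty, so the chosen element really belongs to it and differs from \<open>g i\<close> by an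
  element of \<open>K\<close> on the right.\<close>

lemma quot_rep_proj:
  assumes "id \<in> K"
  obtains k where "\<And>i. i < n \<Longrightarrow> k i \<in> K" "\<And>i. i < n \<Longrightarrow> quot_rep n (quot_proj n K g) i = g i \<circ> k i"
proof -
  have "\<exists>k. k \<in> K \<and> quot_rep n (quot_proj n K g) i = g i \<circ> k" if "i < n" for i
  proof -
    have "g i \<circ> id \<in> quot_proj n K g i" using assms that unfolding quot_proj_def by (auto simp del: comp_id)
    then have "quot_rep n (quot_proj n K g) i \<in> quot_proj n K g i"
      using that someI[of "\<lambda>f. f \<in> quot_proj n K g i"] unfolding quot_rep_def by simp
    then show ?thesis using that by (auto simp: quot_proj_def)
  qed
  then show ?thesis using that by metis
qed

lemma as_map_tau_quot_rep_LTW: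
  assumes "g \<in> GLn scale n"
  shows "as_map \<tau> (quot_rep n (quot_proj n (K_LTW scale v0) g)) = as_map \<tau> g"
proof -
  obtain k where k: "\<And>i. i < n \<Longrightarrow> k i \<in> K_LTW scale v0"
    "\<And>i. i < n \<Longrightarrow> quot_rep n (quot_proj n (K_LTW scale v0) g) i = g i \<circ> k i"
    using quot_rep_proj[OF id_in_K_LTW, of g] by blast
  have "as_map \<tau> (\<lambda>i. g i \<circ> k i) = fscale (\<Prod>i<n. 1 * 1 ^ p i) (as_map \<tau> g)"
  proof (rule tau_stab_scale)
    fix i Y assume i: "i < n"
    show "g i \<in> GL scale" using assms i by auto
    show "k i \<in> stab scale v0" using k(1)[OF i] by (simp add: K_LTW_def)
    show "k i v0 = scale 1 v0" by (rule K_LTW_trivial(1)[OF k(1)[OF i]])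
    assume "Y \<in> vcarrier (quot_space scale v0)"
    then show "k i ` Y = vsmul (quot_space scale v0) 1 Y" by (rule K_LTW_trivial(2)[OF k(1)[OF i]])
  qed
  moreover have "as_map \<tau> (quot_rep n (quot_proj n (K_LTW scale v0) g)) = as_map \<tau> (\<lambda>i. g i \<circ> k i)"
    by (rule as_map_tau_cong) (rule k(2))
  ultimately show ?thesis by (simp add: fscale_def)
qed

lemma as_map_tau_quot_rep_scale:
  assumes "g \<in> GLn scale n" "id \<in> K" "K \<subseteq> Ks_T scale v0"
  obtains c where "c \<noteq> 0" "as_map \<tau> (quot_rep n (quot_proj n K g)) = fscale c (as_map \<tau> g)"
proof -
  obtain k where k: "\<And>i. i < n \<Longrightarrow> k i \<in> K"
    "\<And>i. i < n \<Longrightarrow> quot_rep n (quot_proj n K g) i = g i \<circ> k i"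
    using quot_rep_proj[OF assms(2), of g] by blast
  have "\<exists>a b. a \<noteq> 0 \<and> b \<noteq> 0 \<and> k i v0 = scale a v0 \<and>
      (\<forall>Y\<in>vcarrier (quot_space scale v0). k i ` Y = vsmul (quot_space scale v0) b Y)" if "i < n" for i
    using Ks_T_scalars[of "k i"] k(1)[OF that] assms(3) by (metis subsetD)
  then obtain a b where ab: "\<And>i. i < n \<Longrightarrow> a i \<noteq> 0 \<and> b i \<noteq> 0 \<and> k i v0 = scale (a i) v0 \<and>
      (\<forall>Y\<in>vcarrier (quot_space scale v0). k i ` Y = vsmul (quot_space scale v0) (b i) Y)" by metis
  have "as_map \<tau> (\<lambda>i. g i \<circ> k i) = fscale (\<Prod>i<n. a i * b i ^ p i) (as_map \<tau> g)"
  proof (rule tau_stab_scale)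
    fix i Y assume i: "i < n"
    show "g i \<in> GL scale" using assms i by auto
    show "k i \<in> stab scale v0" using k(1)[OF i] assms(3) by (auto simp: Ks_T_def)
    show "k i v0 = scale (a i) v0" using ab[OF i] by blast
    assume "Y \<in> vcarrier (quot_space scale v0)"
    then show "k i ` Y = vsmul (quot_space scale v0) (b i) Y" using ab[OF i] by blast
  qed
  moreover have "(\<Prod>i<n. a i * b i ^ p i) \<noteq> 0" using ab by (auto simp: prod_zero_iff)
  moreover have "as_map \<tau> (quot_rep n (quot_proj n K g)) = as_map \<tau> (\<lambda>i. g i \<circ> k i)"
    by (rule as_map_tau_cong) (rule k(2))
  ultimately show ?thesis using that by metis
qed

lemma id_in_K_T: "id \<in> K_T scale v0" "id \<in> Ks_T scale v0"
  using id_in_K_LTW K_LTW_subset K_T_subset by auto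

lemma f_w_proj:
  "g \<in> GLn scale n \<Longrightarrow> f_w scale v0 n p I (quot_proj n (K_LTW scale v0) g) = as_map \<tau> g"
  unfolding f_w_def by (rule as_map_tau_quot_rep_LTW)

lemma h_proj_quot_rep:
  assumes "g \<in> GLn scale n" "id \<in> K" "K \<subseteq> Ks_T scale v0"
  shows "h_proj scale v0 n p I (quot_rep n (quot_proj n K g)) = h_proj scale v0 n p I g"
  using as_map_tau_quot_rep_scale[OF assms] h_proj_scale by metis

lemma f_frames_proj:
  assumes "g \<in> GLn scale n"
  shows "f_frames scale v0 n p I (quot_proj n (K_T scale v0) g) = h_proj scale v0 n p I g"
    and "f_scaled scale v0 n p I (quot_proj n (Ks_T scale v0) g) = h_proj scale v0 n p I g"
proof -
  have "quot_proj n K g \<in> quot_n scale n K" for K using assms unfolding quot_n_def by blast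
  then show "f_frames scale v0 n p I (quot_proj n (K_T scale v0) g) = h_proj scale v0 n p I g"
    and "f_scaled scale v0 n p I (quot_proj n (Ks_T scale v0) g) = h_proj scale v0 n p I g"
    using h_proj_quot_rep[OF assms id_in_K_T(1) K_T_subset] h_proj_quot_rep[OF assms id_in_K_T(2) order.refl]
    by (simp_all only: f_frames_def f_scaled_def if_True)
qed

lemma f_w_regular: "regular_on_quot scale n (K_LTW scale v0) (LWn scale v0 n p) (f_w scale v0 n p I)"
proof -
  have "(\<lambda>g. f_w scale v0 n p I (quot_proj n (K_LTW scale v0) g) x) \<in> reg_GLn scale n" for x
    using as_map_tau_regular[of x] unfolding reg_GLn_def
    by (rule regular_on_cong) (simp add: f_w_proj)
  then show ?thesis
    using as_map_tau_in_LWn unfolding regular_on_quot_def regular_maps_def by (auto simp: f_w_proj PiE_iff)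
qed

text \<open>If \<open>I x \<noteq> 0\<close>, then no first vector \<open>hd (x i)\<close> is zero,
  by linearity in that slot. Some \<open>g i\<close> therefore carries \<open>v0\<close> to it, and
  after pulling the other vectors back by \<open>g i\<close> the value of \<open>\<tau>\<close>
  there is \<open>I x\<close>.\<close>

lemma tau_nonzero:
  assumes "I \<noteq> 0"
  obtains g where "g \<in> GLn scale n" "as_map \<tau> g \<noteq> 0"
proof -
  obtain x where x: "I x \<noteq> 0" using assms by (auto simp: fun_eq_iff)
  have "length (x i) = p i + 1 \<and> hd (x i) \<noteq> 0" if "i < n" for i
  proof -
    define a where "a = (\<lambda>w. I (x(i := w)))"
    have a: "a \<in> alt_forms (full_space scale) (p i + 1)"
      unfolding a_def by (rule tensor_prod_slot[OF I_in that subspace_alt_forms])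
    have ax: "a (x i) \<noteq> 0" using x by (simp add: a_def)
    then have len: "length (x i) = p i + 1" using alt_forms_outside[OF a, of "x i"] by auto
    then obtain y ys where y: "x i = y # ys" by (cases "x i") auto
    then have "a (0 # ys) = 0" using full_zero[OF a, of 0 "x i"] len by simp
    then show ?thesis using y ax len by auto
  qed
  then have "\<exists>g. g \<in> GL scale \<and> g v0 = hd (x i)" if "i < n" for i
    using that GL_transitive[OF v0_nonzero, of "hd (x i)"] by metis
  then obtain g where g: "\<And>i. i < n \<Longrightarrow> g i \<in> GL scale \<and> g i v0 = hd (x i)" by metis
  have "\<tau> (\<lambda>i. (restrict g {..<n} i, v0, map (coset scale v0) (map (inv (g i)) (tl (x i))))) =
      I (\<lambda>i. map (restrict g {..<n} i) (v0 # map (inv (g i)) (tl (x i))))"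
    using g \<open>\<And>i. i < n \<Longrightarrow> length (x i) = p i + 1 \<and> hd (x i) \<noteq> 0\<close>
    by (intro tau_value) (auto simp: v0_in_line)
  also have "\<dots> = I x"
  proof (rule tensor_prod_cong[OF I_in])
    fix i assume i: "i < n"
    then have "x i \<noteq> []" using \<open>\<And>i. i < n \<Longrightarrow> length (x i) = p i + 1 \<and> hd (x i) \<noteq> 0\<close>[of i] by auto
    then show "map (restrict g {..<n} i) (v0 # map (inv (g i)) (tl (x i))) = x i"
      using g[OF i] i by (cases "x i") (auto simp: comp_def GL_inv1)
  qed
  finally have "as_map \<tau> (restrict g {..<n}) (\<lambda>i. (v0, map (coset scale v0) (map (inv (g i)) (tl (x i))))) \<noteq> 0"
    using x unfolding as_map_def by metis
  then have "as_map \<tau> (restrict g {..<n}) \<noteq> 0" by (metis zero_fun_apply)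
  moreover have "restrict g {..<n} \<in> GLn scale n" using g by auto
  ultimately show ?thesis using that by blast
qed

text \<open>A single regular map \<open>\<phi>\<close> represents \<open>F\<close> on its whole
  domain, so no local patching occurs. The domain pulls back to the locus where some evaluation of
  \<open>\<tau>\<close> is nonzero, which is open by definition and nonempty for
  \<open>I \<noteq> 0\<close>.\<close>

lemma rational_frames:
  assumes "I \<noteq> 0" and proj: "\<And>g. g \<in> GLn scale n \<Longrightarrow> F (quot_proj n K g) = h_proj scale v0 n p I g"
    and outside: "\<And>c. c \<notin> quot_n scale n K \<Longrightarrow> F c = None"
  shows "rational_on_quot scale n K (Tn scale v0 n p) F"
proof -
  have LWn: "as_map \<tau> g \<in> LWn scale v0 n p" if "g \<in> GLn scale n" for g
    using that by (intro as_map_tau_in_LWn) auto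
  have F: "F (quot_proj n K g) = (if as_map \<tau> g = 0 then None else Some (proj_pt (to_Tn (as_map \<tau> g))))"
    if "g \<in> GLn scale n" for g
    using that by (simp add: proj h_proj_def Let_def proj_ident_pt LWn)
  have dom_iff: "quot_proj n K g \<in> dom F \<longleftrightarrow> as_map \<tau> g \<noteq> 0" if "g \<in> GLn scale n" for g
    using F[OF that] by (auto simp: dom_def)
  \<comment> \<open>The explicit formula instead of \<open>to_Tn\<close>: for fixed
    \<open>ts\<close> it is a constant times an evaluation of \<open>\<tau>\<close>, hence visibly
    regular in \<open>g\<close>.\<close>
  define \<phi> where "\<phi> g = (\<lambda>ts. (\<Prod>i<n. T_supp (p i) (ts i)) * as_map \<tau> g (\<lambda>i. T_arg (ts i)))" for g
  have \<phi>: "\<phi> g = to_Tn (as_map \<tau> g)" if "g \<in> GLn scale n" for g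
    by (simp add: \<phi>_def to_Tn_eq[OF LWn[OF that]])
  have "(\<lambda>g. \<phi> g ts) \<in> reg_GLn scale n" for ts
    using as_map_tau_regular unfolding \<phi>_def reg_GLn_def
    by (intro regular_on_mult regular_on_const)
  then have reg: "\<phi> \<in> regular_maps scale n (Tn scale v0 n p)"
    using to_Tn_in LWn \<phi> by (simp add: regular_maps_def)
  have dom_sub: "dom F \<subseteq> quot_n scale n K" using outside by force
  moreover have "dom F \<noteq> {}"
  proof -
    obtain g where "g \<in> GLn scale n" "as_map \<tau> g \<noteq> 0" by (rule tau_nonzero[OF assms(1)])
    then have "quot_proj n K g \<in> dom F" by (simp only: dom_iff) simp
    then show ?thesis by blast
  qed
  moreover have "ran F \<subseteq> proj_space (Tn scale v0 n p)"
  proof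
    fix P assume "P \<in> ran F"
    then obtain c where c: "F c = Some P" by (auto simp: ran_def)
    then obtain g where g: "g \<in> GLn scale n" "c = quot_proj n K g"
      using dom_sub by (force simp: quot_n_def)
    then have "as_map \<tau> g \<noteq> 0" "P = proj_pt (to_Tn (as_map \<tau> g))"
      using F[OF g(1)] c by (auto split: if_splits)
    then show "P \<in> proj_space (Tn scale v0 n p)"
      unfolding proj_space_def using to_Tn_in to_Tn_nonzero LWn[OF g(1)] by blast
  qed
  moreover have "zariski_open scale n {g \<in> GLn scale n. quot_proj n K g \<in> dom F}"
    unfolding zariski_open_def
  proof (intro exI[of _ "range (\<lambda>x g. as_map \<tau> g x)"] conjI)
    show "range (\<lambda>x g. as_map \<tau> g x) \<subseteq> reg_GLn scale n" using as_map_tau_regular by auto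
    show "{g \<in> GLn scale n. quot_proj n K g \<in> dom F} =
        {g \<in> GLn scale n. \<exists>q\<in>range (\<lambda>x g. as_map \<tau> g x). q g \<noteq> 0}"
      using dom_iff by (auto simp: fun_eq_iff)
  qed
  moreover have "\<exists>\<phi>\<in>regular_maps scale n (Tn scale v0 n p). \<phi> g0 \<noteq> 0 \<and>
           (\<forall>g\<in>GLn scale n. quot_proj n K g \<in> dom F \<and> \<phi> g \<noteq> 0 \<longrightarrow>
              F (quot_proj n K g) = Some (proj_pt (\<phi> g)))"
    if "g0 \<in> GLn scale n" "quot_proj n K g0 \<in> dom F" for g0
  proof (intro bexI[OF _ reg] conjI ballI impI)
    show "\<phi> g0 \<noteq> 0" using that \<phi> dom_iff to_Tn_nonzero LWn by simp
    show "F (quot_proj n K g) = Some (proj_pt (\<phi> g))"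
      if "g \<in> GLn scale n" "quot_proj n K g \<in> dom F \<and> \<phi> g \<noteq> 0" for g
      using that F dom_iff \<phi> by auto
  qed
  ultimately show ?thesis unfolding rational_on_quot_def by blast
qed

lemma act_cosets_proj:
  assumes "a \<in> GL scale" "g \<in> GLn scale n"
  shows "act_cosets n a (quot_proj n K g) = quot_proj n K (\<lambda>i\<in>{..<n}. a \<circ> g i)"
    and "(\<lambda>i\<in>{..<n}. a \<circ> g i) \<in> GLn scale n"
proof -
  have "(\<lambda>b. a \<circ> b) ` (\<lambda>k. g i \<circ> k) ` K = (\<lambda>k. (a \<circ> g i) \<circ> k) ` K" for i
    by (simp add: image_image comp_assoc)
  then show "act_cosets n a (quot_proj n K g) = quot_proj n K (\<lambda>i\<in>{..<n}. a \<circ> g i)"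
    unfolding act_cosets_def quot_proj_def by (intro restrict_ext) simp
  show "(\<lambda>i\<in>{..<n}. a \<circ> g i) \<in> GLn scale n" using assms GL_comp by (auto simp del: o_apply)
qed

end

section \<open>Relative invariance of the tensor and strict invariance of the frame maps\<close>

locale relative_tensor = tensor_form scale Basis v0 n p I
  for scale :: "'k::field_char_0 \<Rightarrow> 'v::ab_group_add \<Rightarrow> 'v" and Basis :: "'v set" and v0 :: 'v
    and n :: nat and p :: "nat \<Rightarrow> nat" and I :: "(nat \<Rightarrow> 'v list) \<Rightarrow> 'k" +
  fixes \<chi> :: "('v \<Rightarrow> 'v) \<Rightarrow> 'k"
  assumes character: "algebraic_character scale \<chi>"
    and I_relative: "relative_invariant scale \<chi> act_I I"
begin

lemma chi_nonzero: "g \<in> GL scale \<Longrightarrow> \<chi> g \<noteq> 0"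
  using character by (simp add: algebraic_character_def)

lemma I_inv: "g \<in> GL scale \<Longrightarrow> \<chi> g * I (\<lambda>i. map (inv g) (x i)) = I x"
  using I_relative by (auto simp: relative_invariant_def act_I_def fscale_def fun_eq_iff)

text \<open>Left translation of the group variables leaves the support alone and applies
  \<open>inv g\<close> to every vector fed into \<open>I\<close>, where the relative invariance of
  \<open>I\<close> takes over.\<close>

lemma tau_inv:
  assumes "g \<in> GL scale"
  shows "\<chi> g * \<tau> (\<lambda>i. (inv g \<circ> fst (x i), snd (x i))) = \<tau> x"
proof -
  have "psi_supp q (inv g \<circ> fst y, snd y) = psi_supp q y" for q y
    using inv_comp_GL_iff[OF assms] by (auto simp: psi_supp_def split: prod.splits)
  moreover have "psi_arg (inv g \<circ> fst y, snd y) = map (inv g) (psi_arg y)" for y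
    by (auto simp: psi_arg_def split: prod.splits)
  ultimately show ?thesis using I_inv[OF assms, of "\<lambda>i. psi_arg (x i)"] by (simp add: tau_eq)
qed

lemma tau_relative: "relative_invariant scale \<chi> act_tau \<tau>"
  by (simp add: relative_invariant_def act_tau_def fscale_def tau_inv)

lemma as_map_tau_inv: "a \<in> GL scale \<Longrightarrow> fscale (\<chi> a) (as_map \<tau> (\<lambda>i. inv a \<circ> g i)) = as_map \<tau> g"
  using tau_inv[of a "\<lambda>i. (g i, _ i)"] by (simp add: fscale_def as_map_def)

lemma as_map_tau_translate: "a \<in> GL scale \<Longrightarrow> as_map \<tau> (\<lambda>i. a \<circ> g i) = fscale (\<chi> a) (as_map \<tau> g)"
  using as_map_tau_inv[of a "\<lambda>i. a \<circ> g i"] by (simp add: GL_inv2 comp_def)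

lemma f_w_inv:
  assumes "a \<in> GL scale" "c \<in> quot_n scale n (K_LTW scale v0)"
  shows "fscale (\<chi> a) (f_w scale v0 n p I (act_cosets n (inv a) c)) = f_w scale v0 n p I c"
proof -
  obtain g where g: "g \<in> GLn scale n" "c = quot_proj n (K_LTW scale v0) g"
    using assms(2) by (auto simp: quot_n_def)
  have "as_map \<tau> (\<lambda>i\<in>{..<n}. inv a \<circ> g i) = as_map \<tau> (\<lambda>i. inv a \<circ> g i)"
    by (rule as_map_tau_cong) simp
  then show ?thesis
    using act_cosets_proj[OF GL_inv[OF assms(1)] g(1)] g as_map_tau_inv[OF assms(1), of g]
    by (simp add: f_w_proj)
qed

text \<open>Translation multiplies the value of \<open>\<tau>\<close> by \<open>\<chi> a\<close>, a
  nonzero scalar that a point of projective space does not see.\<close>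

lemma h_proj_translate:
  assumes "a \<in> GL scale"
  shows "h_proj scale v0 n p I (\<lambda>i\<in>{..<n}. a \<circ> g i) = h_proj scale v0 n p I g"
proof (rule h_proj_scale)
  have "as_map \<tau> (\<lambda>i\<in>{..<n}. a \<circ> g i) = as_map \<tau> (\<lambda>i. a \<circ> g i)"
    by (rule as_map_tau_cong) simp
  then show "as_map \<tau> (\<lambda>i\<in>{..<n}. a \<circ> g i) = fscale (\<chi> a) (as_map \<tau> g)"
    using as_map_tau_translate[OF assms] by simp
qed (rule chi_nonzero[OF assms])

lemma f_frames_inv:
  assumes "a \<in> GL scale"
  shows "c \<in> quot_n scale n (K_T scale v0) \<Longrightarrow> f_frames scale v0 n p I (act_cosets n a c) = f_frames scale v0 n p I c"
    and "c \<in> quot_n scale n (Ks_T scale v0) \<Longrightarrow> f_scaled scale v0 n p I (act_cosets n a c) = f_scaled scale v0 n p I c"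
  using act_cosets_proj[OF assms] by (auto simp: quot_n_def f_frames_proj h_proj_translate[OF assms])

end

section \<open>The weighted differential form\<close>

context pointed_space
begin

text \<open>The frame chosen inside \<open>to_section\<close>. It carries the line of
  \<open>v0\<close> to that of \<open>v\<close>, but not necessarily \<open>v0\<close> to
  \<open>v\<close>.\<close>

definition frame_at :: "'v \<Rightarrow> 'v \<Rightarrow> 'v" where
  "frame_at v = (SOME g. g \<in> GL scale \<and> g ` line scale v0 = line scale v)"

lemma frame_at:
  assumes "v \<noteq> 0"
  shows "frame_at v \<in> GL scale" "inv (frame_at v) v \<in> line scale v0"
proof -
  obtain g where g: "g \<in> GL scale" "g v0 = v" using GL_transitive[OF v0_nonzero assms] .
  then have "g ` line scale v0 = line scale v"
    by (simp add: span_singleton image_image GL_scale)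
  then have *: "frame_at v \<in> GL scale \<and> frame_at v ` line scale v0 = line scale v"
    unfolding frame_at_def using g(1) someI[of "\<lambda>g. g \<in> GL scale \<and> g ` line scale v0 = line scale v" g]
    by blast
  then show "frame_at v \<in> GL scale" by blast
  have "v \<in> frame_at v ` line scale v0" using * span_base[of v "{v}"] by simp
  then obtain s where s: "frame_at v s = v" "s \<in> line scale v0" by (metis image_iff)
  then have "inv (frame_at v) v = s" using GL_inv2[of "frame_at v" s] * by simp
  then show "inv (frame_at v) v \<in> line scale v0" using s by simp
qed

definition chart_supp :: "nat \<Rightarrow> ('v \<Rightarrow> 'k) \<times> 'v \<times> 'v list \<Rightarrow> 'k" where
  "chart_supp q = (\<lambda>(l, v, us). of_bool (l \<in> nz_forms scale \<and> l v = 1 \<and> length us = q \<and> set us \<subseteq> {u. l u = 0}))"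

definition chart_arg :: "('v \<Rightarrow> 'k) \<times> 'v \<times> 'v list \<Rightarrow> ('v \<Rightarrow> 'v) \<times> 'v \<times> 'v set list" where
  "chart_arg = (\<lambda>(l, v, us). (frame_at v, inv (frame_at v) v, map (\<lambda>u. coset scale v0 (inv (frame_at v) u)) us))"

lemma to_section_pullback: "to_section scale v0 q \<phi> = (\<lambda>x. chart_supp q x * \<phi> (chart_arg x))"
  by (auto simp: to_section_def chart_supp_def chart_arg_def frame_at_def Let_def fun_eq_iff)

lemma nz_form_dual: "l \<in> nz_forms scale \<Longrightarrow> l \<in> dual_space scale"
  by (simp add: nz_forms_def)

lemma chart_point_nonzero: "l \<in> nz_forms scale \<Longrightarrow> l v = 1 \<Longrightarrow> v \<noteq> 0"
  using dual_zero[OF nz_form_dual, of l] by auto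

lemma nz_forms_comp:
  assumes "g \<in> GL scale"
  shows "l \<circ> g \<in> nz_forms scale \<longleftrightarrow> l \<in> nz_forms scale"
proof -
  have "l \<circ> g = 0 \<longleftrightarrow> l = 0"
  proof
    assume *: "l \<circ> g = 0"
    have "l x = 0" for x using fun_cong[OF *, of "inv g x"] GL_inv1[OF assms] by simp
    then show "l = 0" by (simp add: fun_eq_iff)
  qed (simp add: fun_eq_iff)
  then show ?thesis using dual_comp_GL_iff[OF assms] by (simp add: nz_forms_def)
qed

text \<open>Contraction with the point, restricted to the tangent space of the chart: one factor of
  the weighted form.\<close>

lemma alt_ker:
  assumes "a \<in> alt_forms (full_space scale) (Suc q)" "l \<in> dual_space scale"
  shows "(\<lambda>us. of_bool (length us = q \<and> set us \<subseteq> {u. l u = 0}) * a (v # us)) \<in> alt_forms (ker_space scale l) q"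
proof -
  have "(\<lambda>us. if length us = q \<and> set us \<subseteq> vcarrier (ker_space scale l) then a (v # map id us) else 0)
      \<in> alt_forms (ker_space scale l) q"
    by (rule alt_forms_pullback[OF alt_forms_contract[OF assms(1)], where f = id])
      (use assms(2) in \<open>auto simp: dual_add dual_scale\<close>)
  moreover have "(\<lambda>us. if length us = q \<and> set us \<subseteq> vcarrier (ker_space scale l) then a (v # map id us) else 0) =
      (\<lambda>us. of_bool (length us = q \<and> set us \<subseteq> {u. l u = 0}) * a (v # us))"
    by auto
  ultimately show ?thesis by simp
qed

lemma chart_dtrans_kernel:
  assumes "l' \<in> dual_space scale" "l' v \<noteq> 0"
  shows "l' (chart_dtrans scale l' v u) = 0" "l' (chart_trans scale l' v) = 1"
  using assms by (simp_all add: chart_dtrans_def chart_trans_def dual_diff dual_scale power2_eq_square)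

text \<open>Weighted forms transform by the degree because \<open>chart_dtrans\<close> is division by \<open>l' v\<close> modulo \<open>v\<close>.\<close>

lemma alt_chart_trans:
  assumes a: "a \<in> alt_forms (full_space scale) (Suc q)" and "length us = q" "l' v \<noteq> 0"
  shows "a (v # us) = l' v ^ (q + 1) * a (chart_trans scale l' v # map (chart_dtrans scale l' v) us)"
proof -
  let ?c = "1 / l' v"
  have "list_all2 (\<lambda>y z. z - y \<in> line scale (scale ?c v)) (map (scale ?c) us) (map (chart_dtrans scale l' v) us)"
  proof (clarsimp simp: list_all2_conv_all_nth)
    fix i assume "i < length us"
    have "chart_dtrans scale l' v (us ! i) - scale ?c (us ! i) = scale (- (l' (us ! i) / l' v)) (scale ?c v)"
      using assms(3) by (simp add: chart_dtrans_def power2_eq_square)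
    then show "chart_dtrans scale l' v (us ! i) - scale ?c (us ! i) \<in> line scale (scale ?c v)"
      unfolding line_iff by blast
  qed
  then have "a (scale ?c v # map (chart_dtrans scale l' v) us) = a (scale ?c v # map (scale ?c) us)"
    using assms(2) by (intro alt_cons_shift[OF a]) auto
  \<comment> \<open>One factor comes from the point and \<open>q\<close> from the tangent vectors,
    which is why the twist is by \<open>q + 1\<close>.\<close>
  also have "\<dots> = ?c * ?c ^ q * a (v # us)" by (rule alt_cons_scale[OF a assms(2)])
  finally show ?thesis using assms(3) by (simp add: chart_trans_def power_one_over)
qed

end

context tensor_form
begin

abbreviation "\<eta> \<equiv> eta scale v0 n p I"

text \<open>The frame at \<open>v\<close> enters through its inverse in \<open>chart_arg\<close> and
  directly in \<open>\<tau>\<close>, and the two cancel. Where a weight is 0 nothing is known about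
  the frame, so that case is settled separately.\<close>

lemma eta_eq: "\<eta> x = (\<Prod>i<n. chart_supp (p i) (x i)) * I (\<lambda>i. fst (snd (x i)) # snd (snd (x i)))"
proof -
  have 1: "\<eta> x = (\<Prod>i<n. chart_supp (p i) (x i)) * \<tau> (\<lambda>i. chart_arg (x i))"
    unfolding eta_def
    by (subst tensor_map_pullback[OF tau_in, where w = "\<lambda>i. chart_supp (p i)" and e = "\<lambda>i. chart_arg"])
      (auto simp: to_section_pullback)
  show ?thesis
  proof (cases "\<exists>i<n. chart_supp (p i) (x i) = 0")
    case True
    then show ?thesis unfolding 1 by (auto simp: prod_zero_iff)
  next
    case False
    define v where "v i = fst (snd (x i))" for i
    define us where "us i = snd (snd (x i))" for i
    have nz: "v i \<noteq> 0" and len: "length (us i) = p i" if "i < n" for i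
      using False that chart_point_nonzero[of "fst (x i)" "v i"]
      by (cases "x i"; force simp: chart_supp_def v_def us_def)+
    have "chart_arg (x i) = (frame_at (v i), inv (frame_at (v i)) (v i), map (coset scale v0) (map (inv (frame_at (v i))) (us i)))" for i
      by (simp add: chart_arg_def v_def us_def split: prod.splits)
    then have "\<tau> (\<lambda>i. chart_arg (x i)) =
        I (\<lambda>i. map (frame_at (v i)) (inv (frame_at (v i)) (v i) # map (inv (frame_at (v i))) (us i)))"
      using tau_value[of "\<lambda>i. frame_at (v i)" "\<lambda>i. inv (frame_at (v i)) (v i)" "\<lambda>i. map (inv (frame_at (v i))) (us i)"]
        frame_at nz len by simp
    also have "\<dots> = I (\<lambda>i. v i # us i)"
      by (rule tensor_prod_cong[OF I_in]) (simp add: comp_def GL_inv1 frame_at nz)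
    finally show ?thesis by (simp add: 1 v_def us_def)
  qed
qed

lemma eta_cong: "(\<And>i. i < n \<Longrightarrow> x i = y i) \<Longrightarrow> \<eta> x = \<eta> y"
  unfolding eta_eq by (rule arg_cong2[where f = "(*)"]) (auto intro: tensor_prod_cong[OF I_in])

lemma eta_value:
  assumes "\<And>i. i < n \<Longrightarrow> l i \<in> nz_forms scale \<and> l i (v i) = 1 \<and> length (us i) = p i \<and> set (us i) \<subseteq> {u. l i u = 0}"
  shows "\<eta> (\<lambda>i. (l i, v i, us i)) = I (\<lambda>i. v i # us i)"
  using assms by (simp add: eta_eq chart_supp_def)

text \<open>Here the frames are arbitrary rather than those chosen by \<open>frame_at\<close>: both
  sides equal \<open>I\<close> at \<open>v i # us i\<close>. This identifies \<open>\<eta>\<close>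
  as the section that corresponds to \<open>\<tau>\<close>, independently of choices.\<close>

lemma eta_tau:
  assumes g: "g \<in> GLn scale n"
    and ok: "\<And>i. i < n \<Longrightarrow> l i \<in> nz_forms scale \<and> l i (v i) = 1 \<and> length (us i) = p i \<and>
      set (us i) \<subseteq> {u. l i u = 0} \<and> g i ` line scale v0 = line scale (v i)"
  shows "\<eta> (\<lambda>i. (l i, v i, us i)) =
    as_map \<tau> g (\<lambda>i. (inv (g i) (v i), map (\<lambda>u. coset scale v0 (inv (g i) u)) (us i)))"
proof -
  have gi: "g i \<in> GL scale" if "i < n" for i using g that by auto
  have v: "inv (g i) (v i) \<in> line scale v0" if "i < n" for i
  proof -
    have "v i \<in> g i ` line scale v0" using ok[OF that] span_base[of "v i" "{v i}"] by simp
    then show ?thesis using GL_inv2[OF gi[OF that]] by (metis imageE)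
  qed
  have "\<tau> (\<lambda>i. (g i, inv (g i) (v i), map (coset scale v0) (map (inv (g i)) (us i)))) =
      I (\<lambda>i. map (g i) (inv (g i) (v i) # map (inv (g i)) (us i)))"
    using ok by (intro tau_value gi v) auto
  also have "\<dots> = I (\<lambda>i. v i # us i)"
    by (rule tensor_prod_cong[OF I_in]) (simp add: comp_def GL_inv1 gi)
  also have "\<dots> = \<eta> (\<lambda>i. (l i, v i, us i))" using ok by (intro eta_value[symmetric]) blast
  finally show ?thesis by (simp add: as_map_def comp_def)
qed

lemma eta_regular:
  assumes "\<And>i. i < n \<Longrightarrow> l i \<in> nz_forms scale"
  shows "(\<lambda>v. \<eta> (\<lambda>i. (l i, v i, us i))) \<in> reg_affine scale n l"
proof -
  have "(\<lambda>v. I (\<lambda>i. v i # us i)) \<in> reg_affine scale n l"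
    unfolding reg_affine_def
  proof (rule tensor_prod_regular[OF I_in])
    fix i a assume i: "i < n" and a: "a \<in> alt_forms (full_space scale) (p i + 1)"
    \<comment> \<open>The point is the only varying argument; the tangent vectors enter as constant
      functions.\<close>
    let ?fs = "(\<lambda>v :: nat \<Rightarrow> 'v. v i) # map (\<lambda>u _. u) (us i)"
    let ?G = "{(\<lambda>v. m (v i)) |m i. m \<in> dual_space scale \<and> i < n}"
    show "(\<lambda>v. a (v i # us i)) \<in> regular_on (affine_pts n l) ?G"
    proof (cases "length (us i) = p i")
      case True
      have "(\<lambda>v. a ([] @ map (\<lambda>f. f v) ?fs)) \<in> regular_on (affine_pts n l) ?G"
      proof (rule alt_full_regular[OF a])
        fix f m assume f: "f \<in> set ?fs" and m: "m \<in> dual_space scale"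
        show "(\<lambda>v. m (f v)) \<in> regular_on (affine_pts n l) ?G"
        proof (cases "f = (\<lambda>v. v i)")
          case True
          then show ?thesis using i m by (auto intro: regular_on_gen)
        next
          case False
          then show ?thesis using f by (auto simp: regular_on_const)
        qed
      qed (use True in simp)
      then show ?thesis by (simp add: comp_def)
    next
      case False
      then have "a (v i # us i) = 0" for v :: "nat \<Rightarrow> 'v"
        using alt_forms_outside[OF a, of "v i # us i"] by simp
      then show ?thesis by (simp add: regular_on_const)
    qed
  qed
  then have "(\<lambda>v. (\<Prod>i<n. of_bool (length (us i) = p i \<and> set (us i) \<subseteq> {u. l i u = 0})) * I (\<lambda>i. v i # us i))
      \<in> reg_affine scale n l"
    unfolding reg_affine_def by (intro regular_on_mult regular_on_const)
  then show ?thesis unfolding reg_affine_def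
  proof (rule regular_on_cong)
    fix v assume v: "v \<in> affine_pts n l"
    have "chart_supp (p i) (l i, v i, us i) = of_bool (length (us i) = p i \<and> set (us i) \<subseteq> {u. l i u = 0})"
      if "i < n" for i
      using v assms[OF that] that by (auto simp: chart_supp_def affine_pts_def)
    then show "(\<Prod>i<n. of_bool (length (us i) = p i \<and> set (us i) \<subseteq> {u. l i u = 0})) * I (\<lambda>i. v i # us i) =
        \<eta> (\<lambda>i. (l i, v i, us i))" by (simp add: eta_eq)
  qed
qed

lemma eta_in_H0_box: "\<eta> \<in> H0_box scale n p (\<lambda>i. p i + 1)"
  unfolding H0_box_def
proof (intro CollectI conjI allI impI)
  show "\<eta> x = \<eta> y" if "\<forall>i<n. x i = y i" for x y using that by (intro eta_cong) blast
next
  fix l v us assume "\<not> (\<forall>i<n. l i \<in> nz_forms scale \<and> l i (v i) = 1)"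
  then obtain i where "i < n" "chart_supp (p i) (l i, v i, us i) = 0" by (auto simp: chart_supp_def)
  then show "\<eta> (\<lambda>i. (l i, v i, us i)) = 0" unfolding eta_eq by (auto simp: prod_zero_iff)
next
  fix l v assume ok: "\<forall>i<n. l i \<in> nz_forms scale \<and> l i (v i) = (1 :: 'k)"
  have "(\<lambda>us. (\<Prod>i<n. of_bool (length (us i) = p i \<and> set (us i) \<subseteq> {u. l i u = 0})) * I (\<lambda>i. v i # us i))
      \<in> tensor_prod n (\<lambda>i. alt_forms (ker_space scale (l i)) (p i))"
    by (rule tensor_prod_pullback[OF I_in]) (use ok alt_ker nz_form_dual in auto)
  moreover have "\<eta> (\<lambda>i. (l i, v i, us i)) =
      (\<Prod>i<n. of_bool (length (us i) = p i \<and> set (us i) \<subseteq> {u. l i u = 0})) * I (\<lambda>i. v i # us i)" for us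
    using ok by (simp add: eta_eq chart_supp_def)
  ultimately show "(\<lambda>us. \<eta> (\<lambda>i. (l i, v i, us i))) \<in> tensor_prod n (\<lambda>i. alt_forms (ker_space scale (l i)) (p i))"
    by simp
next
  fix l us assume "\<forall>i<n. l i \<in> nz_forms scale"
  then show "(\<lambda>v. \<eta> (\<lambda>i. (l i, v i, us i))) \<in> reg_affine scale n l" by (intro eta_regular) blast
next
  fix l l' v us
  assume ok: "\<forall>i<n. l i \<in> nz_forms scale \<and> l' i \<in> nz_forms scale \<and>
     l i (v i) = (1 :: 'k) \<and> l' i (v i) \<noteq> (0 :: 'k) \<and> length (us i) = p i \<and> set (us i) \<subseteq> {u. l i u = 0}"
  have "\<eta> (\<lambda>i. (l i, v i, us i)) = I (\<lambda>i. v i # us i)" using ok by (intro eta_value) blast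
  also have "\<dots> = (\<Prod>i<n. l' i (v i) ^ (p i + 1)) *
      I (\<lambda>i. chart_trans scale (l' i) (v i) # map (chart_dtrans scale (l' i) (v i)) (us i))"
    by (rule tensor_prod_scale_eval[OF I_in]) (use ok alt_chart_trans in auto)
  also have "I (\<lambda>i. chart_trans scale (l' i) (v i) # map (chart_dtrans scale (l' i) (v i)) (us i)) =
      \<eta> (\<lambda>i. (l' i, chart_trans scale (l' i) (v i), map (chart_dtrans scale (l' i) (v i)) (us i)))"
    using ok chart_dtrans_kernel[OF nz_form_dual] by (intro eta_value[symmetric]) auto
  finally show "\<eta> (\<lambda>i. (l i, v i, us i)) = (\<Prod>i<n. l' i (v i) ^ (p i + 1)) *
      \<eta> (\<lambda>i. (l' i, chart_trans scale (l' i) (v i), map (chart_dtrans scale (l' i) (v i)) (us i)))" .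
qed

end

context relative_tensor
begin

lemma eta_relative: "relative_invariant scale \<chi> act_box \<eta>"
  unfolding relative_invariant_def
proof (intro ballI ext)
  fix g and x :: "nat \<Rightarrow> ('v \<Rightarrow> 'k) \<times> 'v \<times> 'v list" assume g: "g \<in> GL scale"
  let ?y = "\<lambda>i :: nat. case x i of (l, v, us) \<Rightarrow> (l \<circ> g, inv g v, map (inv g) us)"
  have "chart_supp (p i) (?y i) = chart_supp (p i) (x i)" for i
    using g by (cases "x i") (auto simp: chart_supp_def nz_forms_comp GL_inv1)
  moreover have "(\<lambda>i. fst (snd (?y i)) # snd (snd (?y i))) = (\<lambda>i. map (inv g) (fst (snd (x i)) # snd (snd (x i))))"
    by (auto split: prod.splits)
  ultimately have "\<chi> g * \<eta> ?y = \<eta> x"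
    using I_inv[OF g, of "\<lambda>i. fst (snd (x i)) # snd (snd (x i))"] by (simp add: eta_eq del: list.map)
  then show "fscale (\<chi> g) (act_box g \<eta>) x = \<eta> x" by (simp add: fscale_def act_box_def)
qed

end

section \<open>Blocks of slots\<close>

definition offset :: "(nat \<Rightarrow> nat) \<Rightarrow> nat \<Rightarrow> nat" where
  "offset p i = (\<Sum>r<i. p r)"

text \<open>Positions are numbered through all factors, and \<open>block p k\<close> is the factor
  that owns position \<open>k\<close>. The strict inequality together with \<open>LEAST\<close>
  passes over factors with \<open>p i = 0\<close>.\<close>

definition block :: "(nat \<Rightarrow> nat) \<Rightarrow> nat \<Rightarrow> nat" where
  "block p k = (LEAST i. k < offset p (Suc i))"

lemma offset_mono: "i \<le> i' \<Longrightarrow> offset p i \<le> offset p i'"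
  unfolding offset_def by (rule sum_mono2) auto

lemma offset_lt: "i < n \<Longrightarrow> j < p i \<Longrightarrow> offset p i + j < offset p n"
  using offset_mono[of "Suc i" n p] by (simp add: offset_def)

lemma block_offset: "j < p i \<Longrightarrow> block p (offset p i + j) = i"
  unfolding block_def
proof (rule Least_equality)
  show "offset p i + j < offset p (Suc i)" if "j < p i" using that by (simp add: offset_def)
  show "i \<le> y" if "offset p i + j < offset p (Suc y)" for y
    using that offset_mono[of "Suc y" i p] by (rule_tac ccontr) simp
qed

lemma slot_cases:
  assumes "k < offset p n"
  obtains i j where "i < n" "j < p i" "k = offset p i + j"
  using assms
proof (induction n arbitrary: thesis)
  case 0
  then show ?case by (simp add: offset_def)
next
  case (Suc n)
  show ?case
  proof (cases "k < offset p n")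
    case True
    then show ?thesis using Suc.IH Suc.prems(1) less_SucI by metis
  next
    case False
    then show ?thesis using Suc.prems(1)[of n "k - offset p n"] Suc.prems(2) by (simp add: offset_def)
  qed
qed

lemma slot_eq_iff: "j < p i \<Longrightarrow> j' < p i' \<Longrightarrow> offset p i + j = offset p i' + j' \<longleftrightarrow> i = i' \<and> j = j'"
  by (metis block_offset add_left_cancel)

text \<open>Here \<open>u k\<close> is the \<open>k\<close>-th tangent vector of the product and
  \<open>u k i\<close> its component in factor \<open>i\<close>. Factor \<open>i\<close> receives
  the \<open>i\<close>-th components of the vectors in its own block.\<close>

definition flat :: "(nat \<Rightarrow> nat) \<Rightarrow> (nat \<Rightarrow> nat \<Rightarrow> 'x) \<Rightarrow> nat \<Rightarrow> 'x list" where
  "flat p u i = map (\<lambda>j. u (offset p i + j) i) [0..<p i]"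

lemma length_flat [simp]: "length (flat p u i) = p i"
  by (simp add: flat_def)

lemma nth_flat [simp]: "j < p i \<Longrightarrow> flat p u i ! j = u (offset p i + j) i"
  by (simp add: flat_def)

text \<open>A position is read by one factor only, so changing a whole vector changes one entry of
  one factor. Multilinearity in positions thus becomes multilinearity in slots.\<close>

lemma flat_update:
  assumes "j < p i"
  shows "flat p (u(offset p i + j := x)) = (flat p u)(i := (flat p u i)[j := x i])"
proof
  fix i'
  show "flat p (u(offset p i + j := x)) i' = ((flat p u)(i := (flat p u i)[j := x i])) i'"
    using assms by (intro nth_equalityI) (auto simp: nth_list_update slot_eq_iff)
qed

lemma block_transpose: "block p a = block p b \<Longrightarrow> block p (transpose a b x) = block p x"
  by (auto simp: transpose_def)

text \<open>Charts and points are held fixed: \<open>T\<close> stands for the value of a section at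
  one point, where alternating it is pure multilinear algebra on the tangent spaces.\<close>

locale block_form = pointed_space scale Basis v0
  for scale :: "'k::field_char_0 \<Rightarrow> 'v::ab_group_add \<Rightarrow> 'v" and Basis :: "'v set" and v0 :: 'v +
  fixes n :: nat and p :: "nat \<Rightarrow> nat" and l :: "nat \<Rightarrow> 'v \<Rightarrow> 'k" and T :: "(nat \<Rightarrow> 'v list) \<Rightarrow> 'k"
  assumes T_in: "T \<in> tensor_prod n (\<lambda>i. alt_forms (ker_space scale (l i)) (p i))"
    and l_dual: "i < n \<Longrightarrow> l i \<in> dual_space scale"
begin

abbreviation "q \<equiv> offset p n"

definition ker_family :: "(nat \<Rightarrow> nat \<Rightarrow> 'v) \<Rightarrow> bool" where
  "ker_family u \<longleftrightarrow> (\<forall>k<q. \<forall>i<n. l i (u k i) = 0)"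

lemma T_slot: "i < n \<Longrightarrow> (\<lambda>w. T (x(i := w))) \<in> alt_forms (ker_space scale (l i)) (p i)"
  by (rule tensor_prod_slot[OF T_in _ subspace_alt_forms])

lemma T_flat_cong: "(\<And>k i. k < q \<Longrightarrow> i < n \<Longrightarrow> u k i = u' k i) \<Longrightarrow> T (flat p u) = T (flat p u')"
  by (rule tensor_prod_cong[OF T_in]) (auto simp: flat_def offset_lt)

lemma flat_in_ker: "ker_family u \<Longrightarrow> i < n \<Longrightarrow> set (flat p u i) \<subseteq> {u. l i u = 0}"
  by (auto simp: flat_def ker_family_def offset_lt)

lemma T_add:
  assumes "ker_family u" "k < q" "\<And>i. i < n \<Longrightarrow> z i = x i + y i"
    "\<And>i. i < n \<Longrightarrow> l i (x i) = 0" "\<And>i. i < n \<Longrightarrow> l i (y i) = 0"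
  shows "T (flat p (u(k := z))) = T (flat p (u(k := x))) + T (flat p (u(k := y)))"
proof -
  obtain i j where k: "i < n" "j < p i" "k = offset p i + j" using slot_cases[OF assms(2)] .
  show ?thesis
    using alt_forms_add[OF T_slot[OF k(1), of "flat p u"], of "flat p u i" j "x i" "y i"]
      flat_in_ker[OF assms(1) k(1)] assms(3-5)[OF k(1)] k by (simp add: flat_update)
qed

lemma T_scale:
  assumes "ker_family u" "k < q" "\<And>i. i < n \<Longrightarrow> z i = scale c (x i)" "\<And>i. i < n \<Longrightarrow> l i (x i) = 0"
  shows "T (flat p (u(k := z))) = c * T (flat p (u(k := x)))"
proof -
  obtain i j where k: "i < n" "j < p i" "k = offset p i + j" using slot_cases[OF assms(2)] .
  show ?thesis
    using alt_forms_smul[OF T_slot[OF k(1), of "flat p u"], of "flat p u i" j "x i" c]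
      flat_in_ker[OF assms(1) k(1)] assms(3,4)[OF k(1)] k by (simp add: flat_update)
qed

lemma T_zero:
  assumes "ker_family u" "i < n" "j < p i" "u (offset p i + j) i = 0"
  shows "T (flat p u) = 0"
proof -
  \<comment> \<open>The zero entry is written as a multiple so that homogeneity in the slot gives
    the factor 0.\<close>
  have "(flat p u i)[j := scale 0 0] = flat p u i" using assms by (simp add: list_update_same_conv)
  then have "T (flat p u) = T ((flat p u)(i := (flat p u i)[j := scale 0 0]))"
    by (metis fun_upd_triv)
  then show ?thesis
    using alt_forms_smul[OF T_slot[OF assms(2), of "flat p u"], of "flat p u i" j 0 0]
      flat_in_ker[OF assms(1,2)] assms(2,3) dual_zero[OF l_dual] by simp
qed

lemma T_alt:
  assumes "a < q" "b < q" "a \<noteq> b" "block p a = block p b" "u a = u b"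
  shows "T (flat p u) = 0"
proof -
  obtain i j where a: "i < n" "j < p i" "a = offset p i + j" using slot_cases[OF assms(1)] .
  obtain i' j' where b: "i' < n" "j' < p i'" "b = offset p i' + j'" using slot_cases[OF assms(2)] .
  have "i' = i" using a b assms(4) by (simp add: block_offset)
  then have "T ((flat p u)(i := flat p u i)) = 0"
    using a b assms(3,5) by (intro alt_forms_alt[OF T_slot[OF a(1)], of _ j j']) auto
  then show ?thesis by simp
qed

text \<open>Polarisation: with \<open>u a + u b\<close> in both positions the value is 0, and
  expanding it leaves the two mixed terms, since the diagonal terms vanish as well. All of this
  needs the positions to lie in one block.\<close>

lemma T_swap:
  assumes u: "ker_family u" and ab: "a < q" "b < q" "a \<noteq> b" "block p a = block p b"
  shows "T (flat p (u \<circ> transpose a b)) = - T (flat p u)"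
proof -
  define G where "G x y = T (flat p (u(a := x, b := y)))" for x y
  define s where "s i = u a i + u b i" for i
  have ker: "l i (u a i) = 0" "l i (u b i) = 0" "l i (s i) = 0" if "i < n" for i
    using u ab that by (auto simp: ker_family_def s_def dual_add[OF l_dual])
  have fam: "ker_family (u(a := x))" "ker_family (u(b := x))" if "x \<in> {u a, u b, s}" for x
    using u that ker by (auto simp: ker_family_def)
  have 1: "G s y = G (u a) y + G (u b) y" if "y \<in> {u a, u b, s}" for y
    unfolding G_def fun_upd_twist[OF ab(3)]
    by (rule T_add[OF fam(2)[OF that] ab(1)]) (use ker in \<open>auto simp: s_def\<close>)
  have 2: "G x s = G x (u a) + G x (u b)" if "x \<in> {u a, u b, s}" for x
    unfolding G_def by (rule T_add[OF fam(1)[OF that] ab(2)]) (use ker in \<open>auto simp: s_def\<close>)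
  have "G x x = 0" for x unfolding G_def using ab by (intro T_alt[of a b]) auto
  then have "0 = G (u a) (u b) + G (u b) (u a)"
    using 1[of s] 2[of "u a"] 2[of "u b"] by simp
  moreover have "u(a := u a, b := u b) = u" "u(a := u b, b := u a) = u \<circ> transpose a b"
    using ab(3) by (auto simp: fun_eq_iff transpose_def)
  ultimately show ?thesis by (simp add: G_def eq_neg_iff_add_eq_0 add.commute)
qed

text \<open>Induction on a set containing the moved positions. Splitting off the transposition of
  \<open>a\<close> and \<open>\<sigma> a\<close>, which lie in one block, leaves a block-preserving
  permutation of the smaller set.\<close>

lemma T_block_perm:
  assumes "finite S"
  shows "S \<subseteq> {..<q} \<Longrightarrow> \<sigma> permutes S \<Longrightarrow> (\<And>k. k \<in> S \<Longrightarrow> block p (\<sigma> k) = block p k) \<Longrightarrow> ker_family u \<Longrightarrow>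
    T (flat p (u \<circ> \<sigma>)) = of_int (sign \<sigma>) * T (flat p u)"
  using assms
proof (induction S arbitrary: \<sigma> u rule: finite_induct)
  case empty
  then show ?case by simp
next
  case (insert a S)
  define b where "b = \<sigma> a"
  define \<rho> where "\<rho> = transpose a b \<circ> \<sigma>"
  have \<rho>: "\<rho> permutes S" unfolding \<rho>_def b_def using insert.prems(2) by (rule permutes_insert_lemma)
  have \<sigma>: "\<sigma> = transpose a b \<circ> \<rho>" by (auto simp: \<rho>_def fun_eq_iff)
  have bl: "block p a = block p b" using insert.prems(3)[of a] by (simp add: b_def)
  have "b \<in> insert a S" unfolding b_def using permutes_in_image[OF insert.prems(2)] by simp
  then have ab: "a < q" "b < q" using insert.prems(1) by auto
  have fam: "ker_family (u \<circ> transpose a b)"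
    using insert.prems(4) ab by (auto simp: ker_family_def transpose_def)
  have "T (flat p ((u \<circ> transpose a b) \<circ> \<rho>)) = of_int (sign \<rho>) * T (flat p (u \<circ> transpose a b))"
  proof (rule insert.IH[OF _ \<rho> _ fam])
    show "S \<subseteq> {..<q}" using insert.prems(1) by simp
    show "block p (\<rho> k) = block p k" if "k \<in> S" for k
      using insert.prems(3)[of k] that bl by (simp add: \<rho>_def block_transpose)
  qed
  also have "T (flat p (u \<circ> transpose a b)) = of_int (sign (transpose a b)) * T (flat p u)"
    using T_swap[OF insert.prems(4) ab _ bl] by (auto simp: sign_swap_id)
  also have "of_int (sign \<rho>) * (of_int (sign (transpose a b)) * T (flat p u)) = of_int (sign \<sigma>) * T (flat p u)"
    using permutes_imp_permutation[OF insert.hyps(1) \<rho>]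
    by (simp add: \<sigma> sign_compose permutation_swap_id)
  finally show ?case unfolding comp_assoc \<sigma>[symmetric] .
qed

definition alternation :: "(nat \<Rightarrow> nat \<Rightarrow> 'v) \<Rightarrow> 'k" where
  "alternation u = (\<Sum>\<sigma> | \<sigma> permutes {..<q}. of_int (sign \<sigma>) * T (flat p (u \<circ> \<sigma>)))"

lemma perm_lt: "\<sigma> permutes {..<q} \<Longrightarrow> k < q \<Longrightarrow> \<sigma> k < q"
  using permutes_in_image[of \<sigma> "{..<q}" k] by simp

lemma ker_family_perm: "ker_family u \<Longrightarrow> \<sigma> permutes {..<q} \<Longrightarrow> ker_family (u \<circ> \<sigma>)"
  by (auto simp: ker_family_def perm_lt)

lemma alternation_cong: "(\<And>k i. k < q \<Longrightarrow> i < n \<Longrightarrow> u k i = u' k i) \<Longrightarrow> alternation u = alternation u'"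
  unfolding alternation_def by (intro sum.cong refl arg_cong2[where f = "(*)"] T_flat_cong) (auto simp: perm_lt)

lemma upd_comp_perm: "\<sigma> permutes S \<Longrightarrow> u(k := z) \<circ> \<sigma> = (u \<circ> \<sigma>)(inv \<sigma> k := z)"
  by (auto simp: fun_eq_iff permutes_inverses)

lemma alternation_add:
  assumes "ker_family u" "k < q" "\<And>i. i < n \<Longrightarrow> z i = x i + y i"
    "\<And>i. i < n \<Longrightarrow> l i (x i) = 0" "\<And>i. i < n \<Longrightarrow> l i (y i) = 0"
  shows "alternation (u(k := z)) = alternation (u(k := x)) + alternation (u(k := y))"
proof -
  have "T (flat p (u(k := z) \<circ> \<sigma>)) = T (flat p (u(k := x) \<circ> \<sigma>)) + T (flat p (u(k := y) \<circ> \<sigma>))"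
    if "\<sigma> permutes {..<q}" for \<sigma>
    unfolding upd_comp_perm[OF that]
    using assms that by (intro T_add ker_family_perm perm_lt[OF permutes_inv]) auto
  then show ?thesis by (simp add: alternation_def distrib_left sum.distrib)
qed

lemma alternation_scale:
  assumes "ker_family u" "k < q" "\<And>i. i < n \<Longrightarrow> z i = scale c (x i)" "\<And>i. i < n \<Longrightarrow> l i (x i) = 0"
  shows "alternation (u(k := z)) = c * alternation (u(k := x))"
proof -
  have "T (flat p (u(k := z) \<circ> \<sigma>)) = c * T (flat p (u(k := x) \<circ> \<sigma>))"
    if "\<sigma> permutes {..<q}" for \<sigma>
    unfolding upd_comp_perm[OF that]
    using assms that by (intro T_scale ker_family_perm perm_lt[OF permutes_inv]) auto
  then show ?thesis by (simp add: alternation_def sum_distrib_left mult_ac)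
qed

text \<open>The two positions may lie in different blocks, where \<open>T\<close> itself says
  nothing. Composing all permutations with their transposition fixes \<open>u\<close> and reverses
  every sign, so the sum is its own negative, hence 0 in characteristic zero.\<close>

lemma alternation_alt:
  assumes ab: "a < q" "b < q" "a \<noteq> b" and u: "u a = u b"
  shows "alternation u = 0"
proof -
  have t: "transpose a b permutes {..<q}" using ab by (intro permutes_swap_id) auto
  have ut: "u \<circ> transpose a b = u" using u by (auto simp: fun_eq_iff transpose_def)
  have "alternation u = (\<Sum>\<sigma> | \<sigma> permutes {..<q}. of_int (sign (transpose a b \<circ> \<sigma>)) * T (flat p (u \<circ> (transpose a b \<circ> \<sigma>))))"
    unfolding alternation_def by (rule setum_permutations_compose_left[OF t])
  also have "\<dots> = (\<Sum>\<sigma> | \<sigma> permutes {..<q}. - (of_int (sign \<sigma>) * T (flat p (u \<circ> \<sigma>))))"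
  proof (rule sum.cong[OF refl])
    fix \<sigma> assume "\<sigma> \<in> {\<sigma>. \<sigma> permutes {..<q}}"
    then have "permutation \<sigma>" by (auto intro: permutes_imp_permutation[of "{..<q}"])
    then have "sign (transpose a b \<circ> \<sigma>) = - sign \<sigma>"
      using ab by (simp add: sign_compose permutation_swap_id sign_swap_id)
    then show "of_int (sign (transpose a b \<circ> \<sigma>)) * T (flat p (u \<circ> (transpose a b \<circ> \<sigma>))) =
        - (of_int (sign \<sigma>) * T (flat p (u \<circ> \<sigma>)))"
      by (simp add: ut flip: comp_assoc)
  qed
  also have "\<dots> = - alternation u" by (simp add: alternation_def sum_negf)
  finally show ?thesis by (simp add: eq_neg_iff_add_eq_0 flip: mult_2)
qed

text \<open>On a family that is supported on the blocks only the block-preserving permutations contribute,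
  each of them with the same value, so the alternation recovers \<open>T\<close> up to a positive integer factor.\<close>

lemma alternation_block_supported:
  assumes u: "ker_family u" and supp: "\<And>k i. k < q \<Longrightarrow> i < n \<Longrightarrow> i \<noteq> block p k \<Longrightarrow> u k i = 0"
  shows "alternation u = of_nat (card {\<sigma>. \<sigma> permutes {..<q} \<and> (\<forall>k<q. block p (\<sigma> k) = block p k)}) * T (flat p u)"
proof -
  let ?P = "{\<sigma>. \<sigma> permutes {..<q} \<and> (\<forall>k<q. block p (\<sigma> k) = block p k)}"
  have "alternation u = (\<Sum>\<sigma>\<in>?P. of_int (sign \<sigma>) * T (flat p (u \<circ> \<sigma>)))"
    unfolding alternation_def
  proof (rule sum.mono_neutral_right)
    show "finite {\<sigma>. \<sigma> permutes {..<q}}" by (rule finite_permutations) simp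
    show "\<forall>\<sigma>\<in>{\<sigma>. \<sigma> permutes {..<q}} - ?P. of_int (sign \<sigma>) * T (flat p (u \<circ> \<sigma>)) = 0"
    proof
      fix \<sigma> assume "\<sigma> \<in> {\<sigma>. \<sigma> permutes {..<q}} - ?P"
      then obtain k where \<sigma>: "\<sigma> permutes {..<q}" and k: "k < q" "block p (\<sigma> k) \<noteq> block p k" by auto
      obtain i j where ij: "i < n" "j < p i" "k = offset p i + j" using slot_cases[OF k(1)] .
      \<comment> \<open>Factor \<open>i\<close> receives at this position a vector from another
        block, whose \<open>i\<close>-th component is 0.\<close>
      have "(u \<circ> \<sigma>) (offset p i + j) i = 0"
        using supp[OF perm_lt[OF \<sigma> k(1)] ij(1)] k(2) ij block_offset[of j p i, OF ij(2)] by auto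
      then show "of_int (sign \<sigma>) * T (flat p (u \<circ> \<sigma>)) = 0"
        using T_zero[OF ker_family_perm[OF u \<sigma>] ij(1,2)] by simp
    qed
  qed auto
  also have "\<dots> = (\<Sum>\<sigma>\<in>?P. T (flat p u))"
  proof (rule sum.cong[OF refl])
    fix \<sigma> assume "\<sigma> \<in> ?P"
    \<comment> \<open>This sign meets the one in the alternation, so every summand has the same
      value.\<close>
    then have "T (flat p (u \<circ> \<sigma>)) = of_int (sign \<sigma>) * T (flat p u)"
      using u by (intro T_block_perm[of "{..<q}"]) auto
    then show "of_int (sign \<sigma>) * T (flat p (u \<circ> \<sigma>)) = T (flat p u)"
      by (simp flip: of_int_mult mult.assoc)
  qed
  finally show ?thesis by simp
qed

end

section \<open>Wedging the factors\<close>

context pointed_space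
begin

lemma wedge_incl_eq: "wedge_incl scale n p s (l, v, us) =
    (if l \<in> {..<n} \<rightarrow>\<^sub>E nz_forms scale \<and> v \<in> affine_pts n l \<and>
        length us = offset p n \<and> set us \<subseteq> vcarrier (prod_ker_space scale n l)
     then (\<Sum>\<sigma> | \<sigma> permutes {..<offset p n}. of_int (sign \<sigma>) * s (\<lambda>i. (l i, v i, flat p ((!) us \<circ> \<sigma>) i)))
       / (\<Prod>i<n. fact (p i))
     else 0)"
  by (simp add: wedge_incl_def offset_def flat_def)

lemma wedge_incl_linear: "Vector_Spaces.linear fscale fscale (wedge_incl scale n p)"
  unfolding Vector_Spaces.linear_iff
proof (intro conjI vector_space_fscale allI ext)
  fix s t x
  show "wedge_incl scale n p (s + t) x = (wedge_incl scale n p s + wedge_incl scale n p t) x"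
    by (cases x) (simp add: wedge_incl_eq sum.distrib distrib_left add_divide_distrib)
next
  fix c s x
  show "wedge_incl scale n p (fscale c s) x = fscale c (wedge_incl scale n p s) x"
    by (cases x) (simp add: wedge_incl_eq fscale_apply sum_distrib_left mult_ac)
qed

lemma vcarrier_prod_ker: "vcarrier (prod_ker_space scale n l) = (\<Pi>\<^sub>E i\<in>{..<n}. {u. l i u = 0})"
  and vadd_prod_ker: "vadd (prod_ker_space scale n l) x y = (\<lambda>i\<in>{..<n}. x i + y i)"
  and vsmul_prod_ker: "vsmul (prod_ker_space scale n l) c x = (\<lambda>i\<in>{..<n}. scale c (x i))"
  by (simp_all add: prod_ker_space_def)

lemma H0_box_cong: "s \<in> H0_box scale n p m \<Longrightarrow> (\<And>i. i < n \<Longrightarrow> x i = y i) \<Longrightarrow> s x = s y"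
  unfolding H0_box_def by blast

lemma H0_box_outside: "s \<in> H0_box scale n p m \<Longrightarrow> \<not> (\<forall>i<n. l i \<in> nz_forms scale \<and> l i (v i) = 1) \<Longrightarrow>
    s (\<lambda>i. (l i, v i, us i)) = 0"
  unfolding H0_box_def by blast

lemma H0_box_tensor: "s \<in> H0_box scale n p m \<Longrightarrow> \<forall>i<n. l i \<in> nz_forms scale \<and> l i (v i) = 1 \<Longrightarrow>
    (\<lambda>us. s (\<lambda>i. (l i, v i, us i))) \<in> tensor_prod n (\<lambda>i. alt_forms (ker_space scale (l i)) (p i))"
  unfolding H0_box_def by blast

lemma H0_box_regular: "s \<in> H0_box scale n p m \<Longrightarrow> \<forall>i<n. l i \<in> nz_forms scale \<Longrightarrow>
    (\<lambda>v. s (\<lambda>i. (l i, v i, us i))) \<in> reg_affine scale n l"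
  unfolding H0_box_def by blast

lemma H0_box_trans: "s \<in> H0_box scale n p m \<Longrightarrow>
    \<forall>i<n. l i \<in> nz_forms scale \<and> l' i \<in> nz_forms scale \<and>
      l i (v i) = 1 \<and> l' i (v i) \<noteq> 0 \<and> length (us i) = p i \<and> set (us i) \<subseteq> {u. l i u = 0} \<Longrightarrow>
    s (\<lambda>i. (l i, v i, us i)) = (\<Prod>i<n. (l' i (v i)) ^ m i) *
      s (\<lambda>i. (l' i, chart_trans scale (l' i) (v i), map (chart_dtrans scale (l' i) (v i)) (us i)))"
  unfolding H0_box_def by blast

lemma H0_box_block_form:
  assumes "s \<in> H0_box scale n p m" "\<forall>i<n. l i \<in> nz_forms scale \<and> l i (v i) = 1"
  shows "block_form scale Basis v0 n p l (\<lambda>us. s (\<lambda>i. (l i, v i, us i)))"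
  by unfold_locales (use assms H0_box_tensor nz_form_dual in auto)

lemma affine_pts_iff: "v \<in> affine_pts n l \<longleftrightarrow> v \<in> extensional {..<n} \<and> (\<forall>i<n. l i (v i) = 1)"
  by (auto simp: affine_pts_def PiE_iff)

lemma wedge_alternation:
  assumes s: "s \<in> H0_box scale n p m"
    and l: "l \<in> {..<n} \<rightarrow>\<^sub>E nz_forms scale" and v: "v \<in> affine_pts n l"
    and us: "length us = offset p n" "set us \<subseteq> vcarrier (prod_ker_space scale n l)"
  shows "wedge_incl scale n p s (l, v, us) =
    block_form.alternation n p (\<lambda>us. s (\<lambda>i. (l i, v i, us i))) ((!) us) / (\<Prod>i<n. fact (p i))"
proof -
  interpret block_form scale Basis v0 n p l "\<lambda>us. s (\<lambda>i. (l i, v i, us i))"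
    using s l v by (intro H0_box_block_form) (auto simp: affine_pts_iff)
  show ?thesis using l v us by (simp add: wedge_incl_eq alternation_def)
qed

lemma wedge_alt_forms:
  assumes s: "s \<in> H0_box scale n p m"
    and l: "l \<in> {..<n} \<rightarrow>\<^sub>E nz_forms scale" and v: "v \<in> affine_pts n l"
  shows "(\<lambda>us. wedge_incl scale n p s (l, v, us)) \<in> alt_forms (prod_ker_space scale n l) (offset p n)"
proof -
  interpret block_form scale Basis v0 n p l "\<lambda>us. s (\<lambda>i. (l i, v i, us i))"
    using s l v by (intro H0_box_block_form) (auto simp: affine_pts_iff)
  note W = wedge_alternation[OF s l v]
  have fam: "ker_family ((!) us)" if "length us = q" "set us \<subseteq> vcarrier (prod_ker_space scale n l)" for us
    unfolding ker_family_def
  proof (intro allI impI)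
    fix k i assume "k < q" "i < n"
    then have "us ! k \<in> vcarrier (prod_ker_space scale n l)" using that nth_mem[of k us] by auto
    then show "l i ((us ! k) i) = 0" using \<open>i < n\<close> by (auto simp: vcarrier_prod_ker)
  qed
  \<comment> \<open>A list update and a function update agree at the positions below
    \<open>q\<close>, the only ones that \<open>alternation\<close> reads.\<close>
  have upd: "alternation ((!) (us[k := z])) = alternation (((!) us)(k := z))" if "length us = q" for us k z
    using that by (intro alternation_cong) (simp add: nth_list_update)
  have ker: "l i (x i) = 0" if "x \<in> vcarrier (prod_ker_space scale n l)" "i < n" for x i
    using that by (auto simp: vcarrier_prod_ker)
  show ?thesis
  proof (rule alt_formsI, goal_cases)
    case (1 us)
    then show ?case by (auto simp: wedge_incl_eq)
  next
    case (2 us k x y)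
    have c: "vadd (prod_ker_space scale n l) x y \<in> vcarrier (prod_ker_space scale n l)"
      unfolding vcarrier_prod_ker vadd_prod_ker
      by (auto simp: dual_add[OF l_dual] ker[OF 2(4)] ker[OF 2(5)])
    have "alternation (((!) us)(k := vadd (prod_ker_space scale n l) x y)) =
        alternation (((!) us)(k := x)) + alternation (((!) us)(k := y))"
      using 2 by (intro alternation_add fam ker) (auto simp: vadd_prod_ker)
    then show ?case using 2 c by (simp add: W upd set_update_subsetI add_divide_distrib)
  next
    case (3 us k x a)
    have c: "vsmul (prod_ker_space scale n l) a x \<in> vcarrier (prod_ker_space scale n l)"
      unfolding vcarrier_prod_ker vsmul_prod_ker by (auto simp: dual_scale[OF l_dual] ker[OF 3(4)])
    have "alternation (((!) us)(k := vsmul (prod_ker_space scale n l) a x)) = a * alternation (((!) us)(k := x))"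
      using 3 by (intro alternation_scale fam ker) (auto simp: vsmul_prod_ker)
    then show ?case using 3 c by (simp add: W upd set_update_subsetI)
  next
    case (4 us a b)
    then show ?case using alternation_alt[of a b "(!) us"] by (simp add: W)
  qed
qed

lemma wedge_regular:
  assumes s: "s \<in> H0_box scale n p m" and l: "l \<in> {..<n} \<rightarrow>\<^sub>E nz_forms scale"
  shows "(\<lambda>v. wedge_incl scale n p s (l, v, us)) \<in> reg_affine scale n l"
proof (cases "length us = offset p n \<and> set us \<subseteq> vcarrier (prod_ker_space scale n l)")
  case True
  have "(\<lambda>v. s (\<lambda>i. (l i, v i, w i))) \<in> reg_affine scale n l" for w
    using l by (intro H0_box_regular[OF s]) auto
  then have "(\<lambda>v. (\<Sum>\<sigma> | \<sigma> permutes {..<offset p n}. of_int (sign \<sigma>) * s (\<lambda>i. (l i, v i, flat p ((!) us \<circ> \<sigma>) i)))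
       * inverse (\<Prod>i<n. fact (p i))) \<in> reg_affine scale n l"
    unfolding reg_affine_def by (intro regular_on_mult regular_on_sum regular_on_const)
  then show ?thesis unfolding reg_affine_def
    by (rule regular_on_cong) (use True l in \<open>simp add: wedge_incl_eq divide_inverse\<close>)
next
  case False
  then have "wedge_incl scale n p s (l, v, us) = 0" for v unfolding wedge_incl_eq by (intro if_not_P) blast
  then show ?thesis by (simp add: reg_affine_def regular_on_const)
qed

lemma set_flat_ker:
  assumes "length us = offset p n" "set us \<subseteq> vcarrier (prod_ker_space scale n l)"
    and "\<sigma> permutes {..<offset p n}" "i < n"
  shows "set (flat p ((!) us \<circ> \<sigma>) i) \<subseteq> {u. l i u = 0}"
proof -
  have "l i ((us ! \<sigma> (offset p i + j)) i) = 0" if "j < p i" for j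
  proof -
    have "\<sigma> (offset p i + j) < length us"
      using permutes_in_image[OF assms(3), of "offset p i + j"] offset_lt[of i n j p, OF assms(4) that] assms(1) by simp
    then have "us ! \<sigma> (offset p i + j) \<in> vcarrier (prod_ker_space scale n l)" using assms(2) by auto
    then show ?thesis using assms(4) by (auto simp: vcarrier_prod_ker)
  qed
  then show ?thesis by (auto simp: flat_def)
qed

lemma flat_map:
  assumes "length us = offset p n" "\<sigma> permutes {..<offset p n}" "i < n"
  shows "flat p ((!) (map (\<lambda>u. \<lambda>i\<in>{..<n}. f i (u i)) us) \<circ> \<sigma>) i = map (f i) (flat p ((!) us \<circ> \<sigma>) i)"
proof (rule nth_equalityI)
  fix j assume "j < length (flat p ((!) (map (\<lambda>u. \<lambda>i\<in>{..<n}. f i (u i)) us) \<circ> \<sigma>) i)"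
  then have j: "j < p i" by simp
  have "\<sigma> (offset p i + j) < length us"
    using permutes_in_image[OF assms(2), of "offset p i + j"] offset_lt[of i n j p, OF assms(3) j] assms(1) by simp
  then show "flat p ((!) (map (\<lambda>u. \<lambda>i\<in>{..<n}. f i (u i)) us) \<circ> \<sigma>) i ! j = map (f i) (flat p ((!) us \<circ> \<sigma>) i) ! j"
    using j assms(3) by simp
qed simp

text \<open>The transition factor depends on the points alone and not on the permutation, so it
  leaves the sum. The differential of the transition acts on each component separately and commutes
  with \<open>flat\<close>.\<close>

lemma wedge_trans:
  assumes s: "s \<in> H0_box scale n p m"
    and l: "l \<in> {..<n} \<rightarrow>\<^sub>E nz_forms scale" and l': "l' \<in> {..<n} \<rightarrow>\<^sub>E nz_forms scale"
    and v: "v \<in> affine_pts n l" and nz: "\<And>i. i < n \<Longrightarrow> l' i (v i) \<noteq> 0"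
    and us: "length us = offset p n" "set us \<subseteq> vcarrier (prod_ker_space scale n l)"
  shows "wedge_incl scale n p s (l, v, us) = (\<Prod>i<n. (l' i (v i)) ^ m i) *
    wedge_incl scale n p s (l', (\<lambda>i\<in>{..<n}. chart_trans scale (l' i) (v i)),
      map (\<lambda>u. \<lambda>i\<in>{..<n}. chart_dtrans scale (l' i) (v i) (u i)) us)"
proof -
  let ?v = "\<lambda>i\<in>{..<n}. chart_trans scale (l' i) (v i)"
  let ?us = "map (\<lambda>u. \<lambda>i\<in>{..<n}. chart_dtrans scale (l' i) (v i) (u i)) us"
  have l'i: "l' i \<in> nz_forms scale" if "i < n" for i using l' that by auto
  have "?v \<in> affine_pts n l'" "set ?us \<subseteq> vcarrier (prod_ker_space scale n l')"
    using chart_dtrans_kernel[OF nz_form_dual[OF l'i] nz]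
    by (simp_all add: affine_pts_iff vcarrier_prod_ker image_subset_iff restrict_PiE_iff)
  then have ok: "?v \<in> affine_pts n l' \<and> length ?us = offset p n \<and> set ?us \<subseteq> vcarrier (prod_ker_space scale n l')"
    using us by simp
  have "s (\<lambda>i. (l i, v i, flat p ((!) us \<circ> \<sigma>) i)) = (\<Prod>i<n. (l' i (v i)) ^ m i) *
      s (\<lambda>i. (l' i, ?v i, flat p ((!) ?us \<circ> \<sigma>) i))" if \<sigma>: "\<sigma> permutes {..<offset p n}" for \<sigma>
  proof -
    have "s (\<lambda>i. (l i, v i, flat p ((!) us \<circ> \<sigma>) i)) = (\<Prod>i<n. (l' i (v i)) ^ m i) *
      s (\<lambda>i. (l' i, chart_trans scale (l' i) (v i), map (chart_dtrans scale (l' i) (v i)) (flat p ((!) us \<circ> \<sigma>) i)))"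
      using l l'i v nz set_flat_ker[OF us \<sigma>] by (intro H0_box_trans[OF s]) (auto simp: affine_pts_iff)
    also have "s (\<lambda>i. (l' i, chart_trans scale (l' i) (v i), map (chart_dtrans scale (l' i) (v i)) (flat p ((!) us \<circ> \<sigma>) i))) =
        s (\<lambda>i. (l' i, ?v i, flat p ((!) ?us \<circ> \<sigma>) i))"
      by (rule H0_box_cong[OF s]) (simp add: flat_map[OF us(1) \<sigma>, where f = "\<lambda>i. chart_dtrans scale (l' i) (v i)"])
    finally show ?thesis .
  qed
  then show ?thesis
    using l l' v us ok by (simp add: wedge_incl_eq sum_distrib_left mult_ac)
qed

lemma wedge_in_H0_forms:
  assumes s: "s \<in> H0_box scale n p m"
  shows "wedge_incl scale n p s \<in> H0_forms scale n (\<Sum>i<n. p i) m"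
  unfolding H0_forms_def offset_def[symmetric]
  using wedge_alt_forms[OF s] wedge_regular[OF s] wedge_trans[OF s]
  by (auto simp: wedge_incl_eq[of n p s])

text \<open>With the other slots frozen, a section is an alternating form in slot \<open>i\<close>,
  and such forms are normalised to 0 off their carrier.\<close>

lemma H0_box_supp:
  assumes s: "s \<in> H0_box scale n p m" and l: "\<forall>i<n. l i \<in> nz_forms scale \<and> l i (v i) = 1"
    and "i < n" "\<not> (length (us i) = p i \<and> set (us i) \<subseteq> {u. l i u = 0})"
  shows "s (\<lambda>i. (l i, v i, us i)) = 0"
proof -
  have "(\<lambda>w. s (\<lambda>j. (l j, v j, (us(i := w)) j))) \<in> alt_forms (ker_space scale (l i)) (p i)"
    by (rule tensor_prod_slot[OF H0_box_tensor[OF s l] assms(3) subspace_alt_forms])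
  from alt_forms_outside[OF this, of "us i"] show ?thesis using assms(4) by simp
qed

text \<open>The test vector at position \<open>k\<close> has a single component, in the factor
  \<open>block p k\<close>: the vector of \<open>us\<close> that this position stands for. On such a
  family \<open>alternation_block_supported\<close> applies. Multiplying by the factorials undoes
  the normalisation in \<open>wedge_incl\<close>.\<close>

lemma wedge_recovers:
  assumes s: "s \<in> H0_box scale n p m"
    and ok: "\<forall>i<n. l i \<in> nz_forms scale \<and> l i (v i) = 1"
    and us: "\<And>i. i < n \<Longrightarrow> length (us i) = p i \<and> set (us i) \<subseteq> {u. l i u = 0}"
  shows "of_nat (card {\<sigma>. \<sigma> permutes {..<offset p n} \<and> (\<forall>k<offset p n. block p (\<sigma> k) = block p k)}) *
      s (\<lambda>i. (l i, v i, us i)) = (\<Prod>i<n. fact (p i)) * wedge_incl scale n p s (restrict l {..<n}, restrict v {..<n},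
        map (\<lambda>k. \<lambda>i\<in>{..<n}. if i = block p k then us i ! (k - offset p i) else 0) [0..<offset p n])"
proof -
  define u where "u k = (\<lambda>i\<in>{..<n}. if i = block p k then us i ! (k - offset p i) else 0)" for k
  let ?l = "restrict l {..<n}" and ?v = "restrict v {..<n}"
  have ok': "\<forall>i<n. ?l i \<in> nz_forms scale \<and> ?l i (?v i) = 1" using ok by simp
  interpret block_form scale Basis v0 n p ?l "\<lambda>us. s (\<lambda>i. (?l i, ?v i, us i))"
    by (rule H0_box_block_form[OF s ok'])
  have uk: "l i (u k i) = 0" if k: "k < q" and i: "i < n" for k i
  proof (cases "i = block p k")
    case True
    obtain i' j where ij: "i' < n" "j < p i'" "k = offset p i' + j" using slot_cases[OF k] .
    then have "i' = i" using True block_offset[of j p i'] by simp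
    then have "us i ! j \<in> set (us i)" using us[OF i] ij by simp
    then have "l i (us i ! j) = 0" using us[OF i] by blast
    moreover have "u k i = us i ! (k - offset p i)" using True i by (simp add: u_def)
    moreover have "k - offset p i = j" using ij(3) \<open>i' = i\<close> by simp
    ultimately show ?thesis by simp
  next
    case False
    then show ?thesis using i l_dual[OF i] by (simp add: u_def dual_zero)
  qed
  have fam: "ker_family u" using uk by (simp add: ker_family_def)
  have flat: "flat p u i = us i" if "i < n" for i
    using us[OF that] that by (intro nth_equalityI) (simp_all add: u_def block_offset)
  have "alternation u = of_nat (card {\<sigma>. \<sigma> permutes {..<q} \<and> (\<forall>k<q. block p (\<sigma> k) = block p k)}) *
      s (\<lambda>i. (?l i, ?v i, flat p u i))"
    by (rule alternation_block_supported[OF fam]) (simp add: u_def)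
  also have "s (\<lambda>i. (?l i, ?v i, flat p u i)) = s (\<lambda>i. (l i, v i, us i))"
    by (rule H0_box_cong[OF s]) (simp add: flat)
  also have "alternation u = alternation ((!) (map u [0..<q]))"
    by (rule alternation_cong) simp
  finally have 1: "alternation ((!) (map u [0..<q])) =
    of_nat (card {\<sigma>. \<sigma> permutes {..<q} \<and> (\<forall>k<q. block p (\<sigma> k) = block p k)}) * s (\<lambda>i. (l i, v i, us i))" .
  have "set (map u [0..<q]) \<subseteq> vcarrier (prod_ker_space scale n ?l)"
  proof -
    have arb: "u k i = undefined" if "i \<notin> {..<n}" for k i using that by (simp add: u_def)
    have "u k \<in> vcarrier (prod_ker_space scale n ?l)" if "k < q" for k
      unfolding vcarrier_prod_ker by (rule PiE_I) (use uk[OF that] in simp, rule arb)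
    then show ?thesis by auto
  qed
  then have "wedge_incl scale n p s (?l, ?v, map u [0..<q]) = alternation ((!) (map u [0..<q])) / (\<Prod>i<n. fact (p i))"
    using ok by (intro wedge_alternation[OF s]) (auto simp: affine_pts_iff)
  then show ?thesis unfolding 1 by (simp add: u_def[abs_def] prod_zero_iff)
qed

text \<open>At admissible arguments \<open>wedge_recovers\<close> determines the value up to the
  number of block-preserving permutations, which is positive because of the identity and invertible
  in characteristic zero. At all other arguments every section is 0.\<close>

lemma wedge_inj: "inj_on (wedge_incl scale n p) (H0_box scale n p m)"
proof (rule inj_onI, rule ext)
  fix s t and x :: "nat \<Rightarrow> ('v \<Rightarrow> 'k) \<times> 'v \<times> 'v list"
  assume s: "s \<in> H0_box scale n p m" and t: "t \<in> H0_box scale n p m"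
    and eq: "wedge_incl scale n p s = wedge_incl scale n p t"
  define l v us where "l i = fst (x i)" and "v i = fst (snd (x i))" and "us i = snd (snd (x i))" for i
  have x: "x = (\<lambda>i. (l i, v i, us i))" by (simp add: l_def v_def us_def)
  show "s x = t x"
  proof (cases "\<forall>i<n. l i \<in> nz_forms scale \<and> l i (v i) = 1")
    case ok: True
    show ?thesis
    proof (cases "\<forall>i<n. length (us i) = p i \<and> set (us i) \<subseteq> {u. l i u = 0}")
      case True
      let ?P = "{\<sigma>. \<sigma> permutes {..<offset p n} \<and> (\<forall>k<offset p n. block p (\<sigma> k) = block p k)}"
      have fin: "finite ?P" using finite_permutations[of "{..<offset p n}"] by (rule rev_finite_subset) auto
      have "id \<in> ?P" by simp
      then have "card ?P \<noteq> 0" unfolding card_0_eq[OF fin] by blast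
      moreover have "of_nat (card ?P) * s x = of_nat (card ?P) * t x"
        using wedge_recovers[OF s ok, of us] wedge_recovers[OF t ok, of us] True unfolding x eq by simp
      ultimately show ?thesis by simp
    next
      case False
      then obtain i where i: "i < n" "\<not> (length (us i) = p i \<and> set (us i) \<subseteq> {u. l i u = 0})" by blast
      show ?thesis unfolding x H0_box_supp[where l = l and v = v and us = us, OF s ok i] H0_box_supp[where l = l and v = v and us = us, OF t ok i] ..
    qed
  next
    case False
    then show ?thesis unfolding x using H0_box_outside[where l = l and v = v and us = us, OF s False] H0_box_outside[where l = l and v = v and us = us, OF t False] by simp
  qed
qed

text \<open>The delicate point is the support. \<open>restrict\<close> could turn an inadmissible
  tuple into an admissible one, which is why \<open>act_forms\<close> tests extensionality;
  \<open>dom\<close> shows that with this test the two supports coincide.\<close>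

lemma act_forms_wedge:
  assumes s: "s \<in> H0_box scale n p m" and g: "g \<in> GL scale"
  shows "act_forms n g (wedge_incl scale n p s) = wedge_incl scale n p (act_box g s)"
proof (rule ext, clarify)
  fix l :: "nat \<Rightarrow> 'v \<Rightarrow> 'k" and v :: "nat \<Rightarrow> 'v" and us :: "(nat \<Rightarrow> 'v) list"
  let ?ext = "l \<in> extensional {..<n} \<and> v \<in> extensional {..<n} \<and> set us \<subseteq> extensional {..<n}"
  let ?l = "\<lambda>i\<in>{..<n}. l i \<circ> g" and ?v = "\<lambda>i\<in>{..<n}. inv g (v i)"
  let ?us = "map (\<lambda>u. \<lambda>i\<in>{..<n}. inv g (u i)) us"
  let ?ok = "\<lambda>l v us. l \<in> {..<n} \<rightarrow>\<^sub>E nz_forms scale \<and> v \<in> affine_pts n l \<and>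
        length us = offset p n \<and> set us \<subseteq> vcarrier (prod_ker_space scale n l)"
  have dom: "?ok l v us \<longleftrightarrow> ?ext \<and> ?ok ?l ?v ?us"
  proof -
    have "l \<in> {..<n} \<rightarrow>\<^sub>E nz_forms scale \<longleftrightarrow> l \<in> extensional {..<n} \<and> (\<forall>i<n. l i \<in> nz_forms scale)"
      unfolding PiE_iff by blast
    moreover have "?l \<in> {..<n} \<rightarrow>\<^sub>E nz_forms scale \<longleftrightarrow> (\<forall>i<n. l i \<in> nz_forms scale)"
      unfolding restrict_PiE_iff nz_forms_comp[OF g] by blast
    moreover have "?v \<in> affine_pts n ?l \<longleftrightarrow> (\<forall>i<n. l i (v i) = 1)"
      by (simp add: affine_pts_iff GL_inv1[OF g])
    moreover have "set us \<subseteq> vcarrier (prod_ker_space scale n l) \<longleftrightarrow>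
        set us \<subseteq> extensional {..<n} \<and> (\<forall>u\<in>set us. \<forall>i<n. l i (u i) = 0)"
      unfolding vcarrier_prod_ker PiE_iff subset_iff by blast
    moreover have "set ?us \<subseteq> vcarrier (prod_ker_space scale n ?l) \<longleftrightarrow> (\<forall>u\<in>set us. \<forall>i<n. l i (u i) = 0)"
      unfolding set_map vcarrier_prod_ker image_subset_iff restrict_PiE_iff
      by (simp add: GL_inv1[OF g] Ball_def)
    ultimately show ?thesis unfolding affine_pts_iff[of v] length_map by blast
  qed
  have "s (\<lambda>i. (?l i, ?v i, flat p ((!) ?us \<circ> \<sigma>) i)) = act_box g s (\<lambda>i. (l i, v i, flat p ((!) us \<circ> \<sigma>) i))"
    if "length us = offset p n" "\<sigma> permutes {..<offset p n}" for \<sigma>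
    unfolding act_box_def by (rule H0_box_cong[OF s]) (simp add: flat_map[OF that, where f = "\<lambda>_. inv g"])
  then show "act_forms n g (wedge_incl scale n p s) (l, v, us) = wedge_incl scale n p (act_box g s) (l, v, us)"
    using dom by (simp add: act_forms_def wedge_incl_eq)
qed

lemma wedge_relative:
  assumes s: "s \<in> H0_box scale n p m" and inv: "relative_invariant scale \<chi> act_box s"
  shows "relative_invariant scale \<chi> (act_forms n) (wedge_incl scale n p s)"
  unfolding relative_invariant_def
proof
  fix g assume g: "g \<in> GL scale"
  have "wedge_incl scale n p (fscale (\<chi> g) (act_box g s)) = fscale (\<chi> g) (wedge_incl scale n p (act_box g s))"
    using wedge_incl_linear unfolding Vector_Spaces.linear_iff by blast
  then show "fscale (\<chi> g) (act_forms n g (wedge_incl scale n p s)) = wedge_incl scale n p s"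
    using inv g unfolding act_forms_wedge[OF s g] relative_invariant_def by metis
qed

end

theorem theorem28:
  fixes scale :: "'k::field_char_0 \<Rightarrow> 'v::ab_group_add \<Rightarrow> 'v"
    and Basis :: "'v set" and v0 :: 'v and n :: nat and p :: "nat \<Rightarrow> nat"
    and \<chi> :: "('v \<Rightarrow> 'v) \<Rightarrow> 'k" and I :: "(nat \<Rightarrow> 'v list) \<Rightarrow> 'k"
  assumes "finite_dimensional_vector_space scale Basis"
    and "v0 \<noteq> 0"
    and "algebraic_character scale \<chi>"
    and "I \<in> inv_space scale n p"
    and "relative_invariant scale \<chi> act_I I"
  shows
    "(eta scale v0 n p I \<in> H0_box scale n p (\<lambda>i. p i + 1) \<and>
      relative_invariant scale \<chi> act_box (eta scale v0 n p I) \<and>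
      (\<forall>g\<in>GLn scale n. \<forall>l v us.
         (\<forall>i<n. l i \<in> nz_forms scale \<and> l i (v i) = 1 \<and> length (us i) = p i \<and>
            set (us i) \<subseteq> {u. l i u = 0} \<and> g i ` line scale v0 = line scale (v i)) \<longrightarrow>
         eta scale v0 n p I (\<lambda>i. (l i, v i, us i)) =
           as_map (tau scale v0 n p I) g (\<lambda>i. (inv (g i) (v i), map (\<lambda>u. coset scale v0 (inv (g i) u)) (us i)))) \<and>
      Vector_Spaces.linear fscale fscale (wedge_incl scale n p) \<and>
      inj_on (wedge_incl scale n p) (H0_box scale n p (\<lambda>i. p i + 1)) \<and>
      wedge_incl scale n p ` H0_box scale n p (\<lambda>i. p i + 1)
        \<subseteq> H0_forms scale n (\<Sum>i<n. p i) (\<lambda>i. p i + 1) \<and>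
      relative_invariant scale \<chi> (act_forms n) (wedge_incl scale n p (eta scale v0 n p I))) \<and>

     (tau scale v0 n p I \<in> O_bal_n_inv scale v0 n p \<and>
      relative_invariant scale \<chi> act_tau (tau scale v0 n p I) \<and>
      (\<forall>g\<in>GLn scale n. \<forall>s y. (\<forall>i<n. s i \<in> line scale v0 \<and> length (y i) = p i) \<longrightarrow>
         as_map (tau scale v0 n p I) g (\<lambda>i. (s i, map (coset scale v0) (y i))) = I (\<lambda>i. map (g i) (s i # y i)))) \<and>

     (regular_on_quot scale n (K_LTW scale v0) (LWn scale v0 n p) (f_w scale v0 n p I) \<and>
      (\<forall>g\<in>GLn scale n. f_w scale v0 n p I (quot_proj n (K_LTW scale v0) g) = as_map (tau scale v0 n p I) g) \<and>
      (\<forall>a\<in>GL scale. \<forall>c\<in>quot_n scale n (K_LTW scale v0).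
         fscale (\<chi> a) (f_w scale v0 n p I (act_cosets n (inv a) c)) = f_w scale v0 n p I c)) \<and>

     ((I \<noteq> 0 \<longrightarrow>
        rational_on_quot scale n (K_T scale v0) (Tn scale v0 n p) (f_frames scale v0 n p I) \<and>
        rational_on_quot scale n (Ks_T scale v0) (Tn scale v0 n p) (f_scaled scale v0 n p I)) \<and>
      (\<forall>g\<in>GLn scale n.
         f_frames scale v0 n p I (quot_proj n (K_T scale v0) g) = h_proj scale v0 n p I g \<and>
         f_scaled scale v0 n p I (quot_proj n (Ks_T scale v0) g) = h_proj scale v0 n p I g) \<and>
      (\<forall>a\<in>GL scale. \<forall>c\<in>quot_n scale n (K_T scale v0). f_frames scale v0 n p I (act_cosets n a c) = f_frames scale v0 n p I c) \<and>
      (\<forall>a\<in>GL scale. \<forall>c\<in>quot_n scale n (Ks_T scale v0). f_scaled scale v0 n p I (act_cosets n a c) = f_scaled scale v0 n p I c))"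

proof -
  interpret relative_tensor scale Basis v0 n p I \<chi>
    using assms by (intro relative_tensor.intro tensor_form.intro pointed_space.intro
        pointed_space_axioms.intro tensor_form_axioms.intro relative_tensor_axioms.intro)
  have eta: "\<eta> \<in> H0_box scale n p (\<lambda>i. p i + 1)" by (rule eta_in_H0_box)
  show ?thesis
  proof (intro conjI impI ballI allI)
    show "\<eta> \<in> H0_box scale n p (\<lambda>i. p i + 1)" by (rule eta_in_H0_box)
    show "relative_invariant scale \<chi> act_box \<eta>" by (rule eta_relative)
    show "\<eta> (\<lambda>i. (l i, v i, us i)) =
        as_map \<tau> g (\<lambda>i. (inv (g i) (v i), map (\<lambda>u. coset scale v0 (inv (g i) u)) (us i)))"
      if "g \<in> GLn scale n" "\<forall>i<n. l i \<in> nz_forms scale \<and> l i (v i) = 1 \<and> length (us i) = p i \<and>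
        set (us i) \<subseteq> {u. l i u = 0} \<and> g i ` line scale v0 = line scale (v i)" for g l v us
      using that by (intro eta_tau) blast+
    show "Vector_Spaces.linear fscale fscale (wedge_incl scale n p)" by (rule wedge_incl_linear)
    show "inj_on (wedge_incl scale n p) (H0_box scale n p (\<lambda>i. p i + 1))" by (rule wedge_inj)
    show "wedge_incl scale n p ` H0_box scale n p (\<lambda>i. p i + 1) \<subseteq> H0_forms scale n (\<Sum>i<n. p i) (\<lambda>i. p i + 1)"
      using wedge_in_H0_forms by blast
    show "relative_invariant scale \<chi> (act_forms n) (wedge_incl scale n p \<eta>)"
      by (rule wedge_relative[OF eta eta_relative])
    show "\<tau> \<in> O_bal_n_inv scale v0 n p" by (rule tau_in_O_bal_n_inv)
    show "relative_invariant scale \<chi> act_tau \<tau>" by (rule tau_relative)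
    show "as_map \<tau> g (\<lambda>i. (s i, map (coset scale v0) (y i))) = I (\<lambda>i. map (g i) (s i # y i))"
      if "g \<in> GLn scale n" "\<forall>i<n. s i \<in> line scale v0 \<and> length (y i) = p i" for g s y
      unfolding as_map_def using that by (intro tau_value) auto
    show "regular_on_quot scale n (K_LTW scale v0) (LWn scale v0 n p) (f_w scale v0 n p I)"
      by (rule f_w_regular)
    show "f_w scale v0 n p I (quot_proj n (K_LTW scale v0) g) = as_map \<tau> g" if "g \<in> GLn scale n" for g
      using that by (rule f_w_proj)
    show "fscale (\<chi> a) (f_w scale v0 n p I (act_cosets n (inv a) c)) = f_w scale v0 n p I c"
      if "a \<in> GL scale" "c \<in> quot_n scale n (K_LTW scale v0)" for a c using that by (rule f_w_inv)
    show "rational_on_quot scale n (K_T scale v0) (Tn scale v0 n p) (f_frames scale v0 n p I)" if "I \<noteq> 0"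
      by (rule rational_frames[OF that f_frames_proj(1)]) (simp_all add: f_frames_def)
    show "rational_on_quot scale n (Ks_T scale v0) (Tn scale v0 n p) (f_scaled scale v0 n p I)" if "I \<noteq> 0"
      by (rule rational_frames[OF that f_frames_proj(2)]) (simp_all add: f_scaled_def)
    show "f_frames scale v0 n p I (quot_proj n (K_T scale v0) g) = h_proj scale v0 n p I g"
      "f_scaled scale v0 n p I (quot_proj n (Ks_T scale v0) g) = h_proj scale v0 n p I g"
      if "g \<in> GLn scale n" for g using f_frames_proj[OF that] by blast+
    show "f_frames scale v0 n p I (act_cosets n a c) = f_frames scale v0 n p I c"
      if "a \<in> GL scale" "c \<in> quot_n scale n (K_T scale v0)" for a c using that by (rule f_frames_inv(1))
    show "f_scaled scale v0 n p I (act_cosets n a c) = f_scaled scale v0 n p I c"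
      if "a \<in> GL scale" "c \<in> quot_n scale n (Ks_T scale v0)" for a c using that by (rule f_frames_inv(2))
  qed
qed

end
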